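(* Let $k=4$ on the reference equilateral triangle, with the orthonormal Dubiner basis $\phi_1,\dots,\phi_{15}$. A $15\times15$ matrix $\tilde{\mathbf Q}$ satisfies the extended-range conditions (E1)–(E3) of the context if and only if, for some $q_0,q_1,q_2,q_3\in\mathbb R$, it is symmetric and its only (possibly) nonzero entries are, up to symmetry, $$\tilde Q_{5,5}=\theta_4,\quad \tilde Q_{5,12}=q_3,\quad \tilde Q_{5,15}=q_2,\quad \tilde Q_{12,12}=\theta_3,\quad \tilde Q_{12,15}=\theta_2,\quad \tilde Q_{15,15}=\theta_0,$$ $$\tilde Q_{9,9}=q_1,\quad \tilde Q_{9,14}=q_0,\quad \tilde Q_{14,14}=\theta_1,$$ where $$\theta_0=\tfrac{16\sqrt{21}q_0+98q_1+99q_2-9\sqrt5q_3}{98},\quad \theta_1=\tfrac{8\sqrt{21}q_0+42q_1+75q_2-45\sqrt5q_3}{42},\quad \theta_2=\tfrac{5\sqrt{105}q_0+20\sqrt5q_2-18q_3}{49},$$ $$\theta_3=\tfrac{4\sqrt{21}q_0+147q_1+240q_2-102\sqrt5q_3}{147},\quad \theta_4=\tfrac{2\sqrt{21}q_0+6q_1+12q_2-3\sqrt5q_3}{6}.$$ The stability requirement that $\tilde{\mathbf M}+\tilde{\mathbf Q}$ be positive definite is then equivalent to $$\theta_4>-1,\qquad q_1>-1,\qquad -q_3^2+\theta_3+\theta_4+\theta_3\theta_4>-1,\qquad -q_0^2+q_1+\theta_1+q_1\theta_1>-1,$$ $$2\theta_2q_2q_3+\theta_3(\theta_4-q_2^2+1)+\theta_0\big((\theta_3+1)(\theta_4+1)-q_3^2\big)-(\theta_4+1)\theta_2^2+\theta_4-q_2^2-q_3^2>-1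 .$$ Moreover, the single-parameter matrix $\tilde{\mathbf Q}_{\mathrm C}$ of Castonguay et al. (see context) is recovered for $$q_0=-30240\sqrt{21}c,\quad q_1=564480c,\quad q_2=5040c,\quad q_3=-80640\sqrt5c,$$ for which the stability condition is $c>\dfrac{\sqrt{1129}-115}{76204800}$.
   Context: Reference triangle $\hat K$: vertices $(-1,-1/\sqrt3)$, $(1,-1/\sqrt3)$, $(0,2/\sqrt3)$. Dubiner basis of polynomials of total degree $\le k$: $$\phi_i(x,y)=\frac{2}{3^{1/4}}(1-b)^v\psi_v^{(0,0)}(a)\,\psi_w^{(2v+1,0)}(b),\quad a=\frac{3x}{2-\sqrt3y},\quad b=\frac{2\sqrt3y-1}{3},$$ where $v,w\ge0$, $v+w\le k$, and the index is $i=w+1+v(2k+3-v)/2$ (indices start at 1). Here $\psi_n^{(\alpha,\beta)}$ is the Jacobi polynomial normalised to unit norm in $L^2([-1,1],(1-s)^\alpha(1+s)^\beta\mathrm ds)$ with positive leading coefficient. The basis is $L^2(\hat K)$-orthonormal, so the modal mass matrix $\tilde{\mathbf M}$ is the identity. $\tilde{\mathbf D}_x,\tilde{\mathbf D}_y$ are the matrices of $\partial_x,\partial_y$ in this basis. Extended-range conditions on $\tilde{\mathbf Q}$: (E1) $\tilde{\mathbf Q}=\tilde{\mathbf Q}^T$; (E2) $\tilde{\mathbf Q}\tilde{\mathbf D}_x+\tilde{\mathbf D}_x^T\tilde{\mathbf Q}^T=0$ and $\tilde{\mathbf Q}\tilde{\mathbf D}_y+\tilde{\mathbf D}_y^T\tilde{\mathbf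 Q}^T=0$; (E3) symmetry: $\tilde{\mathbf Q}$ commutes with the matrix (in the basis $\phi_i$) of $f\mapsto f\circ R$ for the rotation $R$ by $2\pi/3$ about the centroid (the origin), and with the matrix of $f(x,y)\mapsto f(-x,y)$. Together with positive definiteness of $\tilde{\mathbf M}+\tilde{\mathbf Q}$, (E1)–(E2) define the extended range of linearly stable flux reconstruction schemes, with correction matrix $\tilde{\mathbf C}=(\tilde{\mathbf M}+\tilde{\mathbf Q})^{-1}\tilde{\mathbf L}_\partial^T\mathbf W_\partial$. Single-parameter matrix: for $c\in\mathbb R$, $$\tilde{\mathbf Q}_{\mathrm C}=c\sum_{m=1}^{k+1}\binom{k}{m-1}(\tilde{\mathbf K}^{m,k})^T\tilde{\mathbf M}\tilde{\mathbf K}^{m,k},\qquad \tilde{\mathbf K}^{m,k}=\tilde{\mathbf D}_x^{\,k-m+1}\tilde{\mathbf D}_y^{\,m-1}.$$ *)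

theory Defs
  imports
    "HOL-Analysis.Analysis"
    "HOL-Computational_Algebra.Polynomial"
    "Jordan_Normal_Form.Matrix"
begin

definition ref_triangle :: "(real \<times> real) set" where
  "ref_triangle = convex hull {(-1, -1 / sqrt 3), (1, -1 / sqrt 3), (0, 2 / sqrt 3)}"

(* The Jacobi polynomial P_n^(a,b) in Szego's normalisation, as an expansion in
   ((s-1)/2)^m ((s+1)/2)^(n-m); natural parameters suffice here.
   Its leading coefficient is positive. *)
definition jacobi_poly :: "nat \<Rightarrow> nat \<Rightarrow> nat \<Rightarrow> real poly" where
  "jacobi_poly \<alpha> \<beta> n =
     (\<Sum>m\<le>n. Polynomial.smult (real ((n + \<alpha>) choose (n - m)) * real ((n + \<beta>) choose m) / 2 ^ n)
               ([:-1, 1:] ^ m * [:1, 1:] ^ (n - m)))"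

definition jacobi_normalised :: "nat \<Rightarrow> nat \<Rightarrow> nat \<Rightarrow> real poly" where
  "jacobi_normalised \<alpha> \<beta> n =
     Polynomial.smult (1 / sqrt (integral {-1..1}
              (\<lambda>s. (poly (jacobi_poly \<alpha> \<beta> n) s)\<^sup>2 * ((1 - s) ^ \<alpha> * (1 + s) ^ \<beta>))))
       (jacobi_poly \<alpha> \<beta> n)"

(* The formula is singular only on the line y = 2 / sqrt 3, which meets the triangle just in
   its apex (0, 2 / sqrt 3). There x / 0 = 0 gives the value of the polynomial, but off the
   triangle that line is to be avoided; this is why identities between polynomials are
   required on the interior of the triangle below. *)
definition dubiner_mode :: "nat \<Rightarrow> nat \<Rightarrow> real \<times> real \<Rightarrow> real" where
  "dubiner_mode v w = (\<lambda>(x, y).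
     let a = 3 * x / (2 - sqrt 3 * y);
         b = (2 * sqrt 3 * y - 1) / 3
     in 2 / 3 powr (1 / 4) * (1 - b) ^ v * poly (jacobi_normalised 0 0 v) a
          * poly (jacobi_normalised (2 * v + 1) 0 w) b)"

definition num_modes :: "nat \<Rightarrow> nat" where
  "num_modes k = (k + 1) * (k + 2) div 2"

(* Indices i run over {1..num_modes k}; the division by 2 is exact. *)
definition dubiner :: "nat \<Rightarrow> nat \<Rightarrow> real \<times> real \<Rightarrow> real" where
  "dubiner k i = (THE f. \<exists>v w. v + w \<le> k \<and> i = w + 1 + v * (2 * k + 3 - v) div 2
                                \<and> f = dubiner_mode v w)"

(* Matrix entries with indices starting at 1. *)
definition entry :: "'a mat \<Rightarrow> nat \<Rightarrow> nat \<Rightarrow> 'a" where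
  "entry A i j = A $$ (i - 1, j - 1)"

(* The matrix A of an operator T in the Dubiner basis: T phi_j = (SUM i. A_ij phi_i).
   Polynomials are identified with their restrictions to the interior of the triangle. *)
definition modal_matrix :: "nat \<Rightarrow> ((real \<times> real \<Rightarrow> real) \<Rightarrow> real \<times> real \<Rightarrow> real) \<Rightarrow> real mat" where
  "modal_matrix k T = (THE A. A \<in> carrier_mat (num_modes k) (num_modes k) \<and>
     (\<forall>j\<in>{1..num_modes k}. \<forall>p\<in>interior ref_triangle.
        T (dubiner k j) p = (\<Sum>i = 1..num_modes k. entry A i j * dubiner k i p)))"

definition partial_x :: "(real \<times> real \<Rightarrow> real) \<Rightarrow> real \<times> real \<Rightarrow> real" where
  "partial_x f = (\<lambda>(x, y). deriv (\<lambda>t. f (t, y)) x)"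

definition partial_y :: "(real \<times> real \<Rightarrow> real) \<Rightarrow> real \<times> real \<Rightarrow> real" where
  "partial_y f = (\<lambda>(x, y). deriv (\<lambda>t. f (x, t)) y)"

definition rotation3 :: "real \<times> real \<Rightarrow> real \<times> real" where
  "rotation3 = (\<lambda>(x, y). (cos (2 * pi / 3) * x - sin (2 * pi / 3) * y,
                           sin (2 * pi / 3) * x + cos (2 * pi / 3) * y))"

definition reflection_x :: "real \<times> real \<Rightarrow> real \<times> real" where
  "reflection_x = (\<lambda>(x, y). (- x, y))"

definition Dx_mat :: "nat \<Rightarrow> real mat" where
  "Dx_mat k = modal_matrix k partial_x"

definition Dy_mat :: "nat \<Rightarrow> real mat" where
  "Dy_mat k = modal_matrix k partial_y"

definition rotation_mat :: "nat \<Rightarrow> real mat" where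
  "rotation_mat k = modal_matrix k (\<lambda>f. f \<circ> rotation3)"

definition reflection_mat :: "nat \<Rightarrow> real mat" where
  "reflection_mat k = modal_matrix k (\<lambda>f. f \<circ> reflection_x)"

definition mass_mat :: "nat \<Rightarrow> real mat" where
  "mass_mat k = Matrix.mat (num_modes k) (num_modes k)
     (\<lambda>(i, j). integral ref_triangle (\<lambda>p. dubiner k (i + 1) p * dubiner k (j + 1) p))"

definition extended_range_conditions :: "nat \<Rightarrow> real mat \<Rightarrow> bool" where
  "extended_range_conditions k Q \<longleftrightarrow>
     Q \<in> carrier_mat (num_modes k) (num_modes k) \<and>
     Q = transpose_mat Q \<and>
     Q * Dx_mat k + transpose_mat (Dx_mat k) * transpose_mat Q
       = 0\<^sub>m (num_modes k) (num_modes k) \<and>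
     Q * Dy_mat k + transpose_mat (Dy_mat k) * transpose_mat Q
       = 0\<^sub>m (num_modes k) (num_modes k) \<and>
     Q * rotation_mat k = rotation_mat k * Q \<and>
     Q * reflection_mat k = reflection_mat k * Q"

definition positive_definite_mat :: "real mat \<Rightarrow> bool" where
  "positive_definite_mat A \<longleftrightarrow>
     A \<in> carrier_mat (dim_row A) (dim_row A) \<and> transpose_mat A = A \<and>
     (\<forall>u\<in>carrier_vec (dim_row A). u \<noteq> 0\<^sub>v (dim_row A) \<longrightarrow> scalar_prod u (A *\<^sub>v u) > 0)"

definition K_mat :: "nat \<Rightarrow> nat \<Rightarrow> real mat" where
  "K_mat k m = (Dx_mat k ^\<^sub>m (k + 1 - m)) * (Dy_mat k ^\<^sub>m (m - 1))"

definition QC_mat :: "nat \<Rightarrow> real \<Rightarrow> real mat" where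
  "QC_mat k c = Matrix.mat (num_modes k) (num_modes k)
     (\<lambda>(i, j). c * (\<Sum>m = 1..k + 1. real (k choose (m - 1)) *
                      (transpose_mat (K_mat k m) * mass_mat k * K_mat k m) $$ (i, j)))"

definition theta0 :: "real \<Rightarrow> real \<Rightarrow> real \<Rightarrow> real \<Rightarrow> real" where
  "theta0 q0 q1 q2 q3 = (16 * sqrt 21 * q0 + 98 * q1 + 99 * q2 - 9 * sqrt 5 * q3) / 98"

definition theta1 :: "real \<Rightarrow> real \<Rightarrow> real \<Rightarrow> real \<Rightarrow> real" where
  "theta1 q0 q1 q2 q3 = (8 * sqrt 21 * q0 + 42 * q1 + 75 * q2 - 45 * sqrt 5 * q3) / 42"

definition theta2 :: "real \<Rightarrow> real \<Rightarrow> real \<Rightarrow> real \<Rightarrow> real" where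
  "theta2 q0 q1 q2 q3 = (5 * sqrt 105 * q0 + 20 * sqrt 5 * q2 - 18 * q3) / 49"

definition theta3 :: "real \<Rightarrow> real \<Rightarrow> real \<Rightarrow> real \<Rightarrow> real" where
  "theta3 q0 q1 q2 q3 = (4 * sqrt 21 * q0 + 147 * q1 + 240 * q2 - 102 * sqrt 5 * q3) / 147"

definition theta4 :: "real \<Rightarrow> real \<Rightarrow> real \<Rightarrow> real \<Rightarrow> real" where
  "theta4 q0 q1 q2 q3 = (2 * sqrt 21 * q0 + 6 * q1 + 12 * q2 - 3 * sqrt 5 * q3) / 6"

definition four_param_form :: "real \<Rightarrow> real \<Rightarrow> real \<Rightarrow> real \<Rightarrow> real mat \<Rightarrow> bool" where
  "four_param_form q0 q1 q2 q3 Q \<longleftrightarrow>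
     Q \<in> carrier_mat 15 15 \<and> transpose_mat Q = Q \<and>
     entry Q 5 5 = theta4 q0 q1 q2 q3 \<and>
     entry Q 5 12 = q3 \<and>
     entry Q 5 15 = q2 \<and>
     entry Q 12 12 = theta3 q0 q1 q2 q3 \<and>
     entry Q 12 15 = theta2 q0 q1 q2 q3 \<and>
     entry Q 15 15 = theta0 q0 q1 q2 q3 \<and>
     entry Q 9 9 = q1 \<and>
     entry Q 9 14 = q0 \<and>
     entry Q 14 14 = theta1 q0 q1 q2 q3 \<and>
     (\<forall>i\<in>{1..15}. \<forall>j\<in>{i..15}.
        (i, j) \<notin> {(5, 5), (5, 12), (5, 15), (12, 12), (12, 15), (15, 15),
                   (9, 9), (9, 14), (14, 14)} \<longrightarrow> entry Q i j = 0)"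

end

(* With t = (2 - sqrt 3 y) / 3 the collapsed coordinates are a = x / t and b = 1 - 2 t, the modes
   are polynomials in x and t, and the triangle is |x| <= t <= 1. A symmetric Q satisfying (E2) is a
   symmetric bilinear form on the polynomials of degree <= 4 for which both derivatives are
   skew-adjoint. Since differentiating x^a t^b in a direction that does not occur gives 0, shifting
   factors x and t from one argument to the other shows that the form vanishes as soon as one
   argument has degree <= 3; conversely any form on the five modes of degree 4 is admissible. On these
   modes the reflection acts by parity, and the rotation by a 5 x 5 matrix that becomes rational after
   rescaling by the norms; its symmetric commutant is the four-parameter family. Positive definiteness
   splits into a 3 x 3 and a 2 x 2 block, to which Sylvester's criterion applies. For the
   single-parameter matrix, each fourth-order derivative of a mode is a constant that depends only on
   the leading form of the mode. *)

theory Submission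
  imports Defs
begin

unbundle no vec_syntax

section \<open>The reference triangle\<close>

text \<open>Why four parameters: modulo lower degree the quartics are spanned by z^4, z^3 z', z^2
  z'^2, z z'^3, z'^4, where z = x + iy and z' is its conjugate. The rotation acts with weights 1, 2,
  0, 1, 2 mod 3, so together with the reflection it yields one trivial representation and two copies
  of the planar one. The commutant is R + M_2(R), whose symmetric part has dimension 1 + 3. The
  reflection-even block is the trivial line plus one vector of each planar copy, the odd block
  consists of their partners; hence the odd determinant is a factor of the even one. The obstacle
  lies in the definitions: \<open>modal_matrix\<close> is a definite description, its equations hold
  on the interior only, and the modes contain a division. Matrices are therefore reached through
  coordinates, unique by orthonormality. (E2) is exploited on monomials, whose derivatives are again
  monomials, and only then carried over to modes. As k = 4 is fixed, orthogonality, change of basis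
  and rotation are finite explicit computations instead of instances of a general theory of Jacobi
  polynomials.\<close>

definition tcoord :: "real \<Rightarrow> real" where
  "tcoord y = (2 - sqrt 3 * y) / 3"

lemma sqrt3_cancel: "sqrt 3 * (sqrt 3 * x) = 3 * x"
  by (simp add: mult.assoc[symmetric])

lemma tcoord_inverse: "tcoord ((2 - 3 * t) / sqrt 3) = t"
  by (simp add: tcoord_def)

text \<open>The inequalities are x <= t, -x <= t and t <= 1. From an intersection of half-spaces the
  interior can be read off face by face.\<close>

lemma ref_triangle_halfspaces:
  "ref_triangle = {z. inner (1, sqrt 3 / 3) z \<le> 2 / 3} \<inter> {z. inner (-1, sqrt 3 / 3) z \<le> 2 / 3}
                  \<inter> {z. inner (0, - sqrt 3 / 3) z \<le> 1 / 3}" (is "_ = ?S")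
proof
  have s: "1 / sqrt 3 = sqrt 3 / 3" "- 1 / sqrt 3 = - sqrt 3 / 3" "2 / sqrt 3 = 2 * sqrt 3 / 3"
    by (simp_all add: field_simps)
  have "convex ?S"
    by (intro convex_Int convex_halfspace_le)
  moreover have "{(-1, -1 / sqrt 3), (1, -1 / sqrt 3), (0, 2 / sqrt 3)} \<subseteq> ?S"
    unfolding s by (simp add: inner_prod_def order_trans[OF _ mult_nonneg_nonneg])
  ultimately show "ref_triangle \<subseteq> ?S"
    unfolding ref_triangle_def by (intro hull_minimal)
  show "?S \<subseteq> ref_triangle"
  proof
    fix z assume z: "z \<in> ?S"
    obtain x y where xy: "z = (x, y)" by (cases z)
    define t where "t = tcoord y"
    have b: "\<bar>x\<bar> \<le> t" "t \<le> 1"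
      using z unfolding xy t_def tcoord_def by (auto simp: inner_prod_def algebra_simps abs_le_iff)
    have y: "y = (2 - 3 * t) / sqrt 3"
      by (simp add: t_def tcoord_def field_simps sqrt3_cancel)
    \<comment> \<open>The weights (t - x) / 2, (t + x) / 2 and 1 - t are the barycentric coordinates
      of \<open>z\<close>.\<close>
    have "z = ((t - x) / 2) *\<^sub>R (-1, -1 / sqrt 3) + ((t + x) / 2) *\<^sub>R (1, -1 / sqrt 3)
              + (1 - t) *\<^sub>R (0, 2 / sqrt 3)"
      unfolding xy y by (simp add: field_simps)
    moreover have "0 \<le> (t - x) / 2" "0 \<le> (t + x) / 2" "0 \<le> 1 - t"
        "(t - x) / 2 + (t + x) / 2 + (1 - t) = 1"
      using b by (auto simp: field_simps)
    ultimately show "z \<in> ref_triangle"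
      unfolding ref_triangle_def convex_hull_3 by blast
  qed
qed

lemma ref_triangle_eq: "ref_triangle = {(x, y). \<bar>x\<bar> \<le> tcoord y \<and> tcoord y \<le> 1}"
  unfolding ref_triangle_halfspaces
  by (auto simp: inner_prod_def algebra_simps abs_le_iff tcoord_def)

lemma interior_ref_triangle: "interior ref_triangle = {(x, y). \<bar>x\<bar> < tcoord y \<and> tcoord y < 1}"
proof -
  have nz: "(1, sqrt 3 / 3) \<noteq> (0::real \<times> real)" "(-1, sqrt 3 / 3) \<noteq> (0::real \<times> real)"
       "(0, - sqrt 3 / 3) \<noteq> (0::real \<times> real)"
    by (simp_all add: zero_prod_def)
  show ?thesis
    unfolding ref_triangle_halfspaces interior_Int interior_halfspace_le[OF nz(1)]
      interior_halfspace_le[OF nz(2)] interior_halfspace_le[OF nz(3)]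
    by (auto simp: inner_prod_def algebra_simps abs_less_iff tcoord_def)
qed

lemma compact_ref_triangle: "compact ref_triangle"
  unfolding ref_triangle_def by (simp add: finite_imp_compact_convex_hull)

lemma negligible_ref_triangle_boundary: "negligible (ref_triangle - interior ref_triangle)"
proof -
  have "convex ref_triangle" unfolding ref_triangle_def by simp
  from negligible_convex_frontier[OF this] show ?thesis
    using compact_imp_closed[OF compact_ref_triangle] by (simp add: frontier_def)
qed

text \<open>In the coordinates (x, t) the rotation is affine with rational coefficients; this is
  what makes the table \<open>rotation_coeff\<close> rational.\<close>

lemma rotation3_eq: "rotation3 (x, y) = (- x / 2 - 1 + 3 * tcoord y / 2, (sqrt 3 * x - y) / 2)"
  unfolding rotation3_def prod.case cos_120 sin_120 by (simp add: tcoord_def field_simps)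

lemma tcoord_rotation3: "tcoord ((sqrt 3 * x - y) / 2) = 1 - x / 2 - tcoord y / 2"
  by (simp add: tcoord_def field_simps sqrt3_cancel)

lemma rotation3_interior: "p \<in> interior ref_triangle \<Longrightarrow> rotation3 p \<in> interior ref_triangle"
  by (cases p) (auto simp: interior_ref_triangle rotation3_eq tcoord_rotation3 abs_less_iff)

lemma reflection_x_interior: "p \<in> interior ref_triangle \<Longrightarrow> reflection_x p \<in> interior ref_triangle"
  by (cases p) (auto simp: interior_ref_triangle reflection_x_def)

text \<open>Fubini is applied to the Lebesgue integral, so the integral is converted there and back.
  The substitution y = (2 - 3 t) / sqrt 3 produces the factor sqrt 3 and turns the slices into
  [-t, t].\<close>

lemma integral_ref_triangle_iterated:
  fixes F :: "real \<times> real \<Rightarrow> real"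
  assumes cont: "continuous_on UNIV F"
  shows "integral ref_triangle F = sqrt 3 *
     (LBINT t. indicator {0..1} t * integral {-t..t} (\<lambda>x. F (x, (2 - 3 * t) / sqrt 3)))"
proof -
  let ?f = "\<lambda>x y. indicator ref_triangle (x, y) * F (x, y)"
  let ?g = "\<lambda>t. indicator {0..1} t * integral {-t..t} (\<lambda>x. F (x, (2 - 3 * t) / sqrt 3))"
  have int: "integrable lborel (\<lambda>p. indicator ref_triangle p *\<^sub>R F p)"
    by (rule borel_integrable_compact[OF compact_ref_triangle])
       (use cont continuous_on_subset in blast)
  then have "integral ref_triangle F = (LBINT p. indicator ref_triangle p * F p)"
    using set_borel_integral_eq_integral(2)[of ref_triangle F]
    by (simp add: set_integrable_def set_lebesgue_integral_def)
  also have "\<dots> = (\<integral>p. (case p of (x, y) \<Rightarrow> ?f x y) \<partial>(lborel \<Otimes>\<^sub>M lborel))"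
    by (simp add: lborel_prod case_prod_unfold)
  also have "\<dots> = (LBINT y. LBINT x. ?f x y)"
    by (subst lborel_pair.integral_snd) (use int in \<open>simp_all add: lborel_prod case_prod_unfold\<close>)
  also have "\<dots> = \<bar>- sqrt 3\<bar> * (LBINT t. LBINT x. ?f x (2 / sqrt 3 + (- sqrt 3) * t))"
    by (subst lborel_integral_real_affine[where c = "- sqrt 3" and t = "2 / sqrt 3"]) simp_all
  also have "(\<lambda>t. LBINT x. ?f x (2 / sqrt 3 + (- sqrt 3) * t)) = ?g"
  proof
    fix t
    have y: "2 / sqrt 3 + (- sqrt 3) * t = (2 - 3 * t) / sqrt 3"
      by (simp add: field_simps)
    have "indicator ref_triangle (x, (2 - 3 * t) / sqrt 3)
          = (indicator {0..1} t * indicator {-t..t} x :: real)" for x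
      by (auto simp: ref_triangle_eq tcoord_inverse indicator_def)
    then have "(LBINT x. ?f x (2 / sqrt 3 + (- sqrt 3) * t))
        = (LBINT x. indicator {0..1} t * (indicator {-t..t} x * F (x, (2 - 3 * t) / sqrt 3)))"
      unfolding y by (simp add: mult.assoc)
    also have "\<dots> = indicator {0..1} t * (LBINT x. indicator {-t..t} x * F (x, (2 - 3 * t) / sqrt 3))"
      by simp
    also have "(LBINT x. indicator {-t..t} x * F (x, (2 - 3 * t) / sqrt 3))
        = integral {-t..t} (\<lambda>x. F (x, (2 - 3 * t) / sqrt 3))"
    proof -
      have "continuous_on {-t..t} (\<lambda>x. F (x, (2 - 3 * t) / sqrt 3))"
        by (rule continuous_on_compose2[OF cont]) (auto intro!: continuous_intros)
      then have "set_integrable lborel {-t..t} (\<lambda>x. F (x, (2 - 3 * t) / sqrt 3))"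
        unfolding set_integrable_def by (intro borel_integrable_compact) auto
      then show ?thesis
        using set_borel_integral_eq_integral(2) by (fastforce simp: set_lebesgue_integral_def)
    qed
    finally show "(LBINT x. ?f x (2 / sqrt 3 + (- sqrt 3) * t)) = ?g t" .
  qed
  finally show ?thesis by simp
qed

text \<open>Stretching the slice [-t, t] to [-1, 1] separates the variables and leaves a factor t,
  which is the 1 in the Jacobi exponent 2 v + 1. The product form is demanded for t > 0 only, where
  x / t makes sense; the slice at t = 0 is a point.\<close>

lemma integral_ref_triangle_separated:
  fixes F :: "real \<times> real \<Rightarrow> real" and g h :: "real \<Rightarrow> real"
  assumes F: "continuous_on UNIV F" and g: "continuous_on UNIV g" and h: "continuous_on UNIV h"
    and sep: "\<And>x t. t > 0 \<Longrightarrow> F (x, (2 - 3 * t) / sqrt 3) = g (x / t) * h t"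
  shows "integral ref_triangle F
           = sqrt 3 * (integral {-1..1} g * integral {0..1} (\<lambda>t. t * h t))"
proof -
  have scale: "indicator {0..1} t * integral {-t..t} (\<lambda>x. F (x, (2 - 3 * t) / sqrt 3))
        = indicator {0..1} t *\<^sub>R (integral {-1..1} g * (t * h t))" for t :: real
  proof (cases "0 < t")
    case True
    have "g integrable_on {-1..1}"
      by (rule integrable_continuous_real) (use g continuous_on_subset in blast)
    then have "(g has_integral integral {-1..1} g) {-1..1}" by blast
    from has_integral_stretch_real[OF this, of "1 / t"] True
    have "((\<lambda>x. g (x / t)) has_integral t * integral {-1..1} g) ((\<lambda>x. x * t) ` {-1..1})"
      by simp
    moreover have "(\<lambda>x. x * t) ` {-1..1} = {-t..t}"
      using True image_mult_atLeastAtMost[of t "-1" 1] by (simp add: mult.commute)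
    ultimately have "integral {-t..t} (\<lambda>x. g (x / t)) = t * integral {-1..1} g"
      by (simp add: integral_unique)
    then show ?thesis using True by (simp add: sep)
  next
    case False
    then show ?thesis by (cases "t = 0") auto
  qed
  have "(LBINT t. indicator {0..1} t *\<^sub>R (integral {-1..1} g * (t * h t)))
      = integral {0..1} (\<lambda>t. integral {-1..1} g * (t * h t))"
  proof -
    have "continuous_on {0..1} (\<lambda>t. integral {-1..1} g * (t * h t))"
      by (intro continuous_intros continuous_on_subset[OF h]) auto
    then have "set_integrable lborel {0..1} (\<lambda>t. integral {-1..1} g * (t * h t))"
      unfolding set_integrable_def by (intro borel_integrable_compact) auto
    then show ?thesis
      using set_borel_integral_eq_integral(2) by (fastforce simp: set_lebesgue_integral_def)
  qed
  then show ?thesis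
    unfolding integral_ref_triangle_iterated[OF F] scale by simp
qed

section \<open>Orthonormality of the Dubiner modes\<close>

lemma degree_jacobi_poly: "degree (jacobi_poly \<alpha> \<beta> n) \<le> n"
  unfolding jacobi_poly_def
proof (intro degree_sum_le order_trans[OF degree_smult_le] order_trans[OF degree_mult_le])
  fix m assume "m \<in> {..n}"
  have "degree ([:-1, 1:] ^ m :: real poly) \<le> m" "degree ([:1, 1:] ^ (n - m) :: real poly) \<le> n - m"
    using degree_power_le[of "[:-1, 1:] :: real poly" m]
      degree_power_le[of "[:1, 1:] :: real poly" "n - m"] by simp_all
  then show "degree ([:-1, 1:] ^ m :: real poly) + degree ([:1, 1:] ^ (n - m) :: real poly) \<le> n"
    using \<open>m \<in> {..n}\<close> by simp
qed simp

lemma legendre_explicit: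
  "jacobi_poly 0 0 0 = [:1:]"
  "jacobi_poly 0 0 (Suc 0) = [:0, 1:]"
  "jacobi_poly 0 0 2 = [:-1/2, 0, 3/2:]"
  "jacobi_poly 0 0 3 = [:0, -3/2, 0, 5/2:]"
  "jacobi_poly 0 0 4 = [:3/8, 0, -15/4, 0, 35/8:]"
  by (simp_all add: jacobi_poly_def numeral_eq_Suc)

text \<open>With b = 1 - 2 t the weight (1 - b)^(2 v + 1) on [-1, 1] becomes a multiple of t^(2 v +
  1) on [0, 1].\<close>

definition shifted_jacobi :: "nat \<Rightarrow> nat \<Rightarrow> real poly" where
  "shifted_jacobi v w = pcompose (jacobi_poly (2 * v + 1) 0 w) [:1, -2:]"

lemma poly_shifted_jacobi: "poly (shifted_jacobi v w) t = poly (jacobi_poly (2 * v + 1) 0 w) (1 - 2 * t)"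
  by (simp add: shifted_jacobi_def poly_pcompose mult.commute)

lemma degree_shifted_jacobi: "degree (shifted_jacobi v w) \<le> w"
  using degree_jacobi_poly[of "2 * v + 1" 0 w] by (simp add: shifted_jacobi_def degree_pcompose)

lemma shifted_jacobi_explicit:
  "shifted_jacobi v 0 = [:1:]"
  "shifted_jacobi 0 (Suc 0) = [:2, -3:]"
  "shifted_jacobi 0 2 = [:3, -12, 10:]"
  "shifted_jacobi 0 3 = [:4, -30, 60, -35:]"
  "shifted_jacobi 0 4 = [:5, -60, 210, -280, 126:]"
  "shifted_jacobi (Suc 0) (Suc 0) = [:4, -5:]"
  "shifted_jacobi (Suc 0) 2 = [:10, -30, 21:]"
  "shifted_jacobi (Suc 0) 3 = [:20, -105, 168, -84:]"
  "shifted_jacobi 2 (Suc 0) = [:6, -7:]"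
  "shifted_jacobi 2 2 = [:21, -56, 36:]"
  "shifted_jacobi 3 (Suc 0) = [:8, -9:]"
  by (simp_all add: shifted_jacobi_def jacobi_poly_def numeral_eq_Suc pcompose_pCons)

text \<open>The order is that of the Dubiner numbering: position i holds the pair (v, w) with index
  i + 1, as \<open>modes_index\<close> confirms.\<close>

definition modes :: "(nat \<times> nat) list" where
  "modes = [(0,0), (0,1), (0,2), (0,3), (0,4), (1,0), (1,1), (1,2), (1,3), (2,0), (2,1), (2,2),
            (3,0), (3,1), (4,0)]"

lemma set_modes: "set modes = {(v, w). v + w \<le> 4}"
proof -
  have "(v, w) \<in> set modes" if "v + w \<le> 4" for v w
  proof -
    have "v = 0 \<or> v = 1 \<or> v = 2 \<or> v = 3 \<or> v = 4" "w = 0 \<or> w = 1 \<or> w = 2 \<or> w = 3 \<or> w = 4"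
      using that by linarith+
    then show ?thesis using that by (elim disjE) (simp_all add: modes_def)
  qed
  moreover have "v + w \<le> 4" if "(v, w) \<in> set modes" for v w
    using that by (auto simp: modes_def)
  ultimately show ?thesis by auto
qed

lemma length_modes: "length modes = 15"
  by (simp add: modes_def)

text \<open>The exponent \<open>m\<close> serves as an accumulator: \<open>moment_pCons\<close>
  removes one coefficient and raises it, so the integral of an explicit polynomial is evaluated by
  recursion.\<close>

definition moment :: "nat \<Rightarrow> real poly \<Rightarrow> real" where
  "moment m p = integral {0..1} (\<lambda>t. t ^ m * poly p t)"

definition symmetric_moment :: "nat \<Rightarrow> real poly \<Rightarrow> real" where
  "symmetric_moment m p = integral {-1..1} (\<lambda>t. t ^ m * poly p t)"

lemma has_integral_power:
  fixes a b :: real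
  assumes "a \<le> b"
  shows "((\<lambda>t. t ^ m) has_integral (b ^ Suc m - a ^ Suc m) / real (Suc m)) {a..b}"
proof -
  have "((\<lambda>t. t ^ m) has_integral b ^ Suc m / real (Suc m) - a ^ Suc m / real (Suc m)) {a..b}"
    by (rule fundamental_theorem_of_calculus[OF assms])
       (auto intro!: derivative_eq_intros simp: has_real_derivative_iff_has_vector_derivative[symmetric]
             simp del: of_nat_Suc power_Suc)
  then show ?thesis by (simp add: diff_divide_distrib)
qed

lemma integral_power_times_pCons:
  fixes a b :: real
  assumes "a \<le> b"
  shows "integral {a..b} (\<lambda>t. t ^ m * poly (pCons c p) t)
    = c * ((b ^ Suc m - a ^ Suc m) / real (Suc m)) + integral {a..b} (\<lambda>t. t ^ Suc m * poly p t)"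
proof -
  have "((\<lambda>t. t ^ Suc m * poly p t) has_integral integral {a..b} (\<lambda>t. t ^ Suc m * poly p t)) {a..b}"
    by (intro integrable_integral integrable_continuous_real continuous_intros)
  from has_integral_add[OF has_integral_mult_right[OF has_integral_power[OF assms, of m], of c] this]
  show ?thesis by (intro integral_unique) (simp add: algebra_simps)
qed

lemma moment_pCons: "moment m (pCons c p) = c / real (Suc m) + moment (Suc m) p"
  unfolding moment_def by (subst integral_power_times_pCons) (simp_all del: power_Suc)

lemma symmetric_moment_pCons:
  "symmetric_moment m (pCons c p)
     = c * ((1 - (-1) ^ Suc m) / real (Suc m)) + symmetric_moment (Suc m) p"
  unfolding symmetric_moment_def by (subst integral_power_times_pCons) (simp_all del: power_Suc)

lemma moment_zero: "moment m 0 = 0" "symmetric_moment m 0 = 0"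
  by (simp_all add: moment_def symmetric_moment_def)

lemma legendre_orthogonal:
  assumes "v \<le> 4" "v' \<le> 4"
  shows "symmetric_moment 0 (jacobi_poly 0 0 v * jacobi_poly 0 0 v')
           = (if v = v' then 2 / (2 * real v + 1) else 0)"
proof -
  have "v \<in> {0, Suc 0, 2, 3, 4}" "v' \<in> {0, Suc 0, 2, 3, 4}"
    using assms by auto
  moreover have "\<forall>v \<in> {0, Suc 0, 2, 3, 4}. \<forall>v' \<in> {0, Suc 0, 2, 3, 4}.
     symmetric_moment 0 (jacobi_poly 0 0 v * jacobi_poly 0 0 v')
           = (if v = v' then 2 / (2 * real v + 1) else 0)"
    by (simp add: legendre_explicit symmetric_moment_pCons moment_zero)
  ultimately show ?thesis by blast
qed

text \<open>For each v only w <= 4 - v occurs, so the tables of cases shrink with v, and every entry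
  follows from the explicit coefficients.\<close>

lemma jacobi_orthogonal:
  assumes "v + w \<le> 4" "v + w' \<le> 4"
  shows "moment (2 * v + 1) (shifted_jacobi v w * shifted_jacobi v w')
           = (if w = w' then 1 / (2 * (real v + real w + 1)) else 0)"
proof -
  let ?P = "\<lambda>v w w'. moment (2 * v + 1) (shifted_jacobi v w * shifted_jacobi v w')
           = (if w = w' then 1 / (2 * (real v + real w + 1)) else 0)"
  have *: "\<forall>w\<in>{0, Suc 0, 2, 3, 4}. \<forall>w'\<in>{0, Suc 0, 2, 3, 4}. ?P 0 w w'"
    "\<forall>w\<in>{0, Suc 0, 2, 3}. \<forall>w'\<in>{0, Suc 0, 2, 3}. ?P (Suc 0) w w'"
    "\<forall>w\<in>{0, Suc 0, 2}. \<forall>w'\<in>{0, Suc 0, 2}. ?P 2 w w'"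
    "\<forall>w\<in>{0, Suc 0}. \<forall>w'\<in>{0, Suc 0}. ?P 3 w w'"
    "?P 4 0 0"
    by (simp_all add: shifted_jacobi_explicit moment_pCons moment_zero)
  have "v = 0 \<or> v = Suc 0 \<or> v = 2 \<or> v = 3 \<or> v = 4"
    using assms by linarith
  then show ?thesis
  proof (elim disjE)
    assume v: "v = 0"
    then have "w \<in> {0, Suc 0, 2, 3, 4}" "w' \<in> {0, Suc 0, 2, 3, 4}" using assms by auto
    with *(1) show ?thesis unfolding v by blast
  next
    assume v: "v = Suc 0"
    then have "w \<in> {0, Suc 0, 2, 3}" "w' \<in> {0, Suc 0, 2, 3}" using assms by auto
    with *(2) show ?thesis unfolding v by blast
  next
    assume v: "v = 2"
    then have "w \<in> {0, Suc 0, 2}" "w' \<in> {0, Suc 0, 2}" using assms by auto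
    with *(3) show ?thesis unfolding v by blast
  next
    assume v: "v = 3"
    then have "w \<in> {0, Suc 0}" "w' \<in> {0, Suc 0}" using assms by auto
    with *(4) show ?thesis unfolding v by blast
  next
    assume v: "v = 4"
    then have "w = 0" "w' = 0" using assms by auto
    with *(5) show ?thesis unfolding v by blast
  qed
qed

lemma integral_reflect_halve:
  fixes f :: "real \<Rightarrow> real"
  assumes "continuous_on UNIV f"
  shows "integral {-1..1} f = 2 * integral {0..1} (\<lambda>t. f (1 - 2 * t))"
proof -
  have "f integrable_on {-1..1}"
    by (rule integrable_continuous_real) (use assms continuous_on_subset in blast)
  then have "(f has_integral integral {-1..1} f) (cbox (-1) 1)" by auto
  from has_integral_affinity[OF this, of "-2" 1]
  have "((\<lambda>t. f (1 - 2 * t)) has_integral (1/2) * integral {-1..1} f)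
          ((\<lambda>x. - (x / 2) + 1 / 2) ` {-1..1})"
    by simp
  moreover have "(\<lambda>x::real. - (x / 2) + 1 / 2) ` {-1..1} = {0..1}"
  proof
    show "{0..1} \<subseteq> (\<lambda>x::real. - (x / 2) + 1 / 2) ` {-1..1}"
    proof
      fix t :: real assume "t \<in> {0..1}"
      then have "1 - 2 * t \<in> {-1..1}" "t = - ((1 - 2 * t) / 2) + 1 / 2" by (auto simp: field_simps)
      then show "t \<in> (\<lambda>x::real. - (x / 2) + 1 / 2) ` {-1..1}" by blast
    qed
  qed auto
  ultimately show ?thesis by (simp add: integral_unique)
qed

lemma legendre_normalised:
  assumes "v \<le> 4"
  shows "jacobi_normalised 0 0 v = Polynomial.smult (sqrt ((2 * real v + 1) / 2)) (jacobi_poly 0 0 v)"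
proof -
  have "integral {-1..1} (\<lambda>s. (poly (jacobi_poly 0 0 v) s)\<^sup>2 * ((1 - s) ^ 0 * (1 + s) ^ 0))
      = 2 / (2 * real v + 1)"
    using legendre_orthogonal[OF assms assms]
    by (simp add: symmetric_moment_def power2_eq_square)
  then show ?thesis
    unfolding jacobi_normalised_def by (simp add: real_sqrt_divide)
qed

text \<open>Under s = 1 - 2 t the weight (1 - s)^(2 v + 1) contributes 2^(2 v + 1), and the 2 from
  the change of variable cancels the 2 in the denominator of
  \<open>jacobi_orthogonal\<close>.\<close>

lemma jacobi_normalised_eq:
  assumes "v + w \<le> 4"
  shows "jacobi_normalised (2 * v + 1) 0 w
    = Polynomial.smult (sqrt ((real v + real w + 1) / 2 ^ (2 * v + 1))) (jacobi_poly (2 * v + 1) 0 w)"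
proof -
  let ?J = "poly (jacobi_poly (2 * v + 1) 0 w)"
  have "integral {-1..1} (\<lambda>s. (?J s)\<^sup>2 * ((1 - s) ^ (2 * v + 1) * (1 + s) ^ 0))
      = 2 * integral {0..1} (\<lambda>t. (?J (1 - 2 * t))\<^sup>2
               * ((1 - (1 - 2 * t)) ^ (2 * v + 1) * (1 + (1 - 2 * t)) ^ 0))"
    by (rule integral_reflect_halve) (intro continuous_intros)
  also have "(\<lambda>t. (?J (1 - 2 * t))\<^sup>2 * ((1 - (1 - 2 * t)) ^ (2 * v + 1) * (1 + (1 - 2 * t)) ^ 0))
      = (\<lambda>t. 2 ^ (2 * v + 1) * (t ^ (2 * v + 1) * poly (shifted_jacobi v w * shifted_jacobi v w) t))"
    by (rule ext) (simp add: poly_shifted_jacobi power_mult_distrib power2_eq_square del: power_Suc)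
  also have "integral {0..1} \<dots> = 2 ^ (2 * v + 1) * moment (2 * v + 1) (shifted_jacobi v w * shifted_jacobi v w)"
    by (simp add: moment_def del: power_Suc)
  also have "moment (2 * v + 1) (shifted_jacobi v w * shifted_jacobi v w)
      = 1 / (2 * (real v + real w + 1))"
    using jacobi_orthogonal[OF assms assms] by simp
  also have "2 * (2 ^ (2 * v + 1) * (1 / (2 * (real v + real w + 1))))
      = 2 ^ (2 * v + 1) / (real v + real w + 1)"
    by (simp only: times_divide_eq_right mult_1_right mult_divide_mult_cancel_left_if) simp
  finally have "integral {-1..1} (\<lambda>s. (?J s)\<^sup>2 * ((1 - s) ^ (2 * v + 1) * (1 + s) ^ 0))
      = 2 ^ (2 * v + 1) / (real v + real w + 1)" .
  then show ?thesis
    unfolding jacobi_normalised_def by (simp add: real_sqrt_divide del: power_Suc)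
qed

section \<open>The modes as polynomials and their inner products\<close>

definition mode_norm :: "nat \<Rightarrow> nat \<Rightarrow> real" where
  "mode_norm v w = sqrt ((2 * real v + 1) * (real v + real w + 1)) / 3 powr (1 / 4)"

lemma mode_norm_pos: "mode_norm v w > 0"
  by (simp add: mode_norm_def)

text \<open>This is t^v P_v(x / t) with the denominator cleared, a polynomial that stays meaningful
  on the line t = 0.\<close>

definition homogeneous_legendre :: "nat \<Rightarrow> real \<Rightarrow> real \<Rightarrow> real" where
  "homogeneous_legendre v x t = (\<Sum>m\<le>v. coeff (jacobi_poly 0 0 v) m * x ^ m * t ^ (v - m))"

lemma poly_as_sum_degree_le:
  fixes p :: "real poly"
  assumes "degree p \<le> n"
  shows "poly p x = (\<Sum>i\<le>n. coeff p i * x ^ i)"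
  unfolding poly_altdef using assms
  by (intro sum.mono_neutral_left) (auto simp: coeff_eq_0)

lemma homogeneous_legendre_eq:
  assumes "t \<noteq> 0"
  shows "homogeneous_legendre v x t = t ^ v * poly (jacobi_poly 0 0 v) (x / t)"
  unfolding homogeneous_legendre_def poly_as_sum_degree_le[OF degree_jacobi_poly] sum_distrib_left
proof (rule sum.cong)
  fix m assume "m \<in> {..v}"
  then have "t ^ v = t ^ m * t ^ (v - m)" by (simp add: power_add[symmetric])
  then show "coeff (jacobi_poly 0 0 v) m * x ^ m * t ^ (v - m)
      = t ^ v * (coeff (jacobi_poly 0 0 v) m * (x / t) ^ m)"
    using assms by (simp add: power_divide)
qed simp

definition mode_poly :: "nat \<Rightarrow> nat \<Rightarrow> real \<times> real \<Rightarrow> real" where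
  "mode_poly v w = (\<lambda>(x, y). homogeneous_legendre v x (tcoord y) * poly (shifted_jacobi v w) (tcoord y))"

lemma dubiner_mode_eq:
  assumes "v + w \<le> 4" "tcoord y \<noteq> 0"
  shows "dubiner_mode v w (x, y) = mode_norm v w * mode_poly v w (x, y)"
proof -
  let ?t = "tcoord y"
  have a: "3 * x / (2 - sqrt 3 * y) = x / ?t"
    using assms(2) by (simp add: tcoord_def field_simps)
  have b: "(2 * sqrt 3 * y - 1) / 3 = 1 - 2 * ?t"
    by (simp add: tcoord_def field_simps)
  \<comment> \<open>The 2 is the prefactor of the mode and 2^v comes from (1 - b)^v = (2 t)^v; with
    the two normalising constants they collapse to the numerator of
    \<open>mode_norm\<close>.\<close>
  have "2 * 2 ^ v * sqrt ((2 * real v + 1) / 2) * sqrt ((real v + real w + 1) / 2 ^ (2 * v + 1))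
      = sqrt ((2 * 2 ^ v)\<^sup>2 * ((2 * real v + 1) / 2) * ((real v + real w + 1) / 2 ^ (2 * v + 1)))"
    by (simp only: real_sqrt_mult real_sqrt_abs) simp
  also have "(2 * 2 ^ v)\<^sup>2 * ((2 * real v + 1) / 2) * ((real v + real w + 1) / 2 ^ (2 * v + 1))
      = (2 * real v + 1) * (real v + real w + 1)"
    by (simp add: power_mult_distrib power_mult[symmetric] mult.commute field_simps)
  finally have n: "2 * 2 ^ v * sqrt ((2 * real v + 1) / 2) * sqrt ((real v + real w + 1) / 2 ^ (2 * v + 1))
      = sqrt ((2 * real v + 1) * (real v + real w + 1))" .
  have "dubiner_mode v w (x, y)
      = (2 * 2 ^ v * sqrt ((2 * real v + 1) / 2) * sqrt ((real v + real w + 1) / 2 ^ (2 * v + 1)))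
        / 3 powr (1 / 4) * (?t ^ v * poly (jacobi_poly 0 0 v) (x / ?t))
        * poly (jacobi_poly (2 * v + 1) 0 w) (1 - 2 * ?t)"
    using assms(1) unfolding dubiner_mode_def prod.case a b Let_def
    by (simp only: legendre_normalised jacobi_normalised_eq poly_smult) (simp add: power_mult_distrib)
  then show ?thesis
    unfolding n mode_poly_def prod.case mode_norm_def poly_shifted_jacobi
      homogeneous_legendre_eq[OF assms(2)] by simp
qed

lemma continuous_mode_poly: "continuous_on UNIV (mode_poly v w)"
  unfolding mode_poly_def homogeneous_legendre_def tcoord_def case_prod_unfold
  by (intro continuous_intros) auto

lemma integral_dubiner_mode:
  assumes "v + w \<le> 4" "v' + w' \<le> 4"
  shows "integral ref_triangle (\<lambda>p. dubiner_mode v w p * dubiner_mode v' w' p)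
           = (if (v, w) = (v', w') then 1 else 0)"
proof -
  let ?J = "shifted_jacobi v w * shifted_jacobi v' w'"
  let ?P = "jacobi_poly 0 0 v * jacobi_poly 0 0 v'"
  have "integral ref_triangle (\<lambda>p. dubiner_mode v w p * dubiner_mode v' w' p)
      = integral ref_triangle (\<lambda>p. mode_norm v w * mode_norm v' w' * (mode_poly v w p * mode_poly v' w' p))"
  proof (rule integral_spike)
    \<comment> \<open>Within the triangle the quotient in \<open>dubiner_mode\<close> degenerates
      only at the apex.\<close>
    show "negligible {(0::real, 2 / sqrt 3)}" by simp
    fix p assume p: "p \<in> ref_triangle - {(0, 2 / sqrt 3)}"
    obtain x y where xy: "p = (x, y)" by (cases p)
    have "tcoord y \<noteq> 0"
    proof
      assume "tcoord y = 0"
      moreover from this have "y = 2 / sqrt 3" by (simp add: tcoord_def field_simps)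
      ultimately show False using p unfolding xy by (auto simp: ref_triangle_eq)
    qed
    then show "mode_norm v w * mode_norm v' w' * (mode_poly v w p * mode_poly v' w' p)
        = dubiner_mode v w p * dubiner_mode v' w' p"
      unfolding xy using assms by (simp add: dubiner_mode_eq)
  qed
  also have "\<dots> = mode_norm v w * mode_norm v' w'
      * integral ref_triangle (\<lambda>p. mode_poly v w p * mode_poly v' w' p)"
    by simp
  also have "integral ref_triangle (\<lambda>p. mode_poly v w p * mode_poly v' w' p)
      = sqrt 3 * (integral {-1..1} (poly ?P) * integral {0..1} (\<lambda>t. t * (t ^ (v + v') * poly ?J t)))"
  proof (rule integral_ref_triangle_separated)
    fix x t :: real assume "t > 0"
    then show "mode_poly v w (x, (2 - 3 * t) / sqrt 3) * mode_poly v' w' (x, (2 - 3 * t) / sqrt 3)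
        = poly ?P (x / t) * (t ^ (v + v') * poly ?J t)"
      by (simp add: mode_poly_def tcoord_inverse homogeneous_legendre_eq power_add)
  qed (intro continuous_intros continuous_mode_poly)+
  also have "integral {-1..1} (poly ?P) = symmetric_moment 0 ?P"
    by (simp add: symmetric_moment_def del: poly_mult)
  also have "integral {0..1} (\<lambda>t. t * (t ^ (v + v') * poly ?J t)) = moment (Suc (v + v')) ?J"
    by (simp add: moment_def mult.assoc del: poly_mult)
  finally have eq: "integral ref_triangle (\<lambda>p. dubiner_mode v w p * dubiner_mode v' w' p)
      = mode_norm v w * mode_norm v' w'
        * (sqrt 3 * (symmetric_moment 0 ?P * moment (Suc (v + v')) ?J))" .
  show ?thesis
  proof (cases "v = v'")
    case False
    then show ?thesis unfolding eq using legendre_orthogonal[of v v'] assms by simp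
  next
    case v: True
    \<comment> \<open>For equal v the exponent Suc (v + v') is 2 v + 1, the weight for which the
      shifted Jacobi polynomials are orthogonal.\<close>
    have m: "moment (Suc (v + v')) ?J = (if w = w' then 1 / (2 * (real v + real w + 1)) else 0)"
      using jacobi_orthogonal[of v w w'] assms unfolding v by (simp add: mult_2)
    have l: "symmetric_moment 0 ?P = 2 / (2 * real v + 1)"
      using legendre_orthogonal[of v v'] assms v by simp
    show ?thesis
    proof (cases "w = w'")
      case False
      then show ?thesis unfolding eq m by simp
    next
      case True
      \<comment> \<open>The squared norm of \<open>mode_poly v w\<close> is sqrt 3 / ((2 v + 1) (v +
        w + 1)), the reciprocal of the square of \<open>mode_norm v w\<close>.\<close>
      have "(3::real) powr (1 / 4) * 3 powr (1 / 4) = sqrt 3"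
        by (simp add: powr_add[symmetric] powr_half_sqrt)
      then have "mode_norm v w * mode_norm v w
          = (2 * real v + 1) * (real v + real w + 1) / sqrt 3"
        by (simp add: mode_norm_def)
      moreover have "A * B / sqrt 3 * (sqrt 3 * (2 / A * (1 / (2 * B)))) = 1"
        if "A > 0" "B > 0" for A B :: real using that by simp
      from this[of "2 * real v + 1" "real v + real w + 1"]
      have "(2 * real v + 1) * (real v + real w + 1) / sqrt 3
          * (sqrt 3 * (2 / (2 * real v + 1) * (1 / (2 * (real v + real w + 1))))) = 1" by simp
      ultimately show ?thesis
        unfolding eq m l using True v by simp
    qed
  qed
qed

abbreviation mode_degree :: "nat \<Rightarrow> nat" where
  "mode_degree i \<equiv> fst (modes ! i) + snd (modes ! i)"

abbreviation nth_poly :: "nat \<Rightarrow> real \<times> real \<Rightarrow> real" where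
  "nth_poly i \<equiv> mode_poly (fst (modes ! i)) (snd (modes ! i))"

abbreviation nth_norm :: "nat \<Rightarrow> real" where
  "nth_norm i \<equiv> mode_norm (fst (modes ! i)) (snd (modes ! i))"

lemma mode_degree_le: "i < 15 \<Longrightarrow> mode_degree i \<le> 4"
  using nth_mem[of i modes] by (auto simp: length_modes set_modes case_prod_unfold)

lemma modes_index: "map (\<lambda>(v, w). w + 1 + v * (11 - v) div 2) modes = [1..<16]"
  by (simp add: modes_def upt_conv_Cons)

text \<open>The index map is injective on the fifteen pairs, since its values along
  \<open>modes\<close> are the distinct numbers 1 to 15. The definite description in
  \<open>dubiner\<close> thus has a single candidate.\<close>

lemma dubiner_eq_mode:
  assumes "i < 15"
  shows "dubiner 4 (Suc i) = dubiner_mode (fst (modes ! i)) (snd (modes ! i))"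
proof -
  let ?idx = "\<lambda>(v, w). w + 1 + v * (11 - v) div 2"
  have idx: "?idx (modes ! i) = Suc i"
    using arg_cong[OF modes_index, of "\<lambda>xs. xs ! i"] assms by (simp add: length_modes)
  have inj: "inj_on ?idx (set modes)"
    using modes_index by (metis distinct_map distinct_upt)
  have mem: "modes ! i \<in> set modes" using assms by (simp add: length_modes)
  show ?thesis
    unfolding dubiner_def
  proof (rule the_equality)
    show "\<exists>v w. v + w \<le> 4 \<and> Suc i = w + 1 + v * (2 * 4 + 3 - v) div 2
        \<and> dubiner_mode (fst (modes ! i)) (snd (modes ! i)) = dubiner_mode v w"
      using idx mem by (intro exI[of _ "fst (modes ! i)"] exI[of _ "snd (modes ! i)"])
        (auto simp: set_modes case_prod_unfold)
    fix f assume "\<exists>v w. v + w \<le> 4 \<and> Suc i = w + 1 + v * (2 * 4 + 3 - v) div 2 \<and> f = dubiner_mode v w"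
    then obtain v w where vw: "v + w \<le> 4" "Suc i = ?idx (v, w)" "f = dubiner_mode v w" by auto
    have "(v, w) = modes ! i"
      by (rule inj_onD[OF inj _ _ mem]) (use vw idx in \<open>simp_all add: set_modes\<close>)
    then show "f = dubiner_mode (fst (modes ! i)) (snd (modes ! i))"
      using vw(3) by (metis fst_conv snd_conv)
  qed
qed

lemma dubiner_interior:
  assumes "i < 15" "p \<in> interior ref_triangle"
  shows "dubiner 4 (Suc i) p = nth_norm i * nth_poly i p"
proof (cases p)
  case (Pair x y)
  with assms(2) have "tcoord y \<noteq> 0" by (auto simp: interior_ref_triangle)
  then show ?thesis
    unfolding Pair dubiner_eq_mode[OF assms(1)]
    by (rule dubiner_mode_eq[OF mode_degree_le[OF assms(1)]])
qed

lemma integral_dubiner: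
  assumes "i < 15" "j < 15"
  shows "integral ref_triangle (\<lambda>p. dubiner 4 (Suc i) p * dubiner 4 (Suc j) p) = (if i = j then 1 else 0)"
proof -
  have "distinct modes" by (simp add: modes_def)
  then have "(fst (modes ! i), snd (modes ! i)) = (fst (modes ! j), snd (modes ! j)) \<longleftrightarrow> i = j"
    using assms by (simp add: length_modes nth_eq_iff_index_eq)
  then show ?thesis
    using integral_dubiner_mode[OF mode_degree_le[OF assms(1)] mode_degree_le[OF assms(2)]]
    by (simp add: dubiner_eq_mode assms)
qed

lemma num_modes_4: "num_modes 4 = 15"
  by (simp add: num_modes_def)

lemma mass_mat_4: "mass_mat 4 = 1\<^sub>m 15"
  by (rule eq_matI) (auto simp: mass_mat_def num_modes_4 integral_dubiner)

lemma dubiner_product_integrable: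
  assumes "i < 15" "j < 15"
  shows "(\<lambda>p. dubiner 4 (Suc i) p * dubiner 4 (Suc j) p) integrable_on ref_triangle"
proof (rule integrable_spike)
  let ?f = "\<lambda>p. nth_norm i * nth_poly i p * (nth_norm j * nth_poly j p)"
  have "continuous_on ref_triangle ?f"
    by (intro continuous_intros continuous_on_subset[OF continuous_mode_poly]) auto
  then have "set_integrable lborel ref_triangle ?f"
    unfolding set_integrable_def by (rule borel_integrable_compact[OF compact_ref_triangle])
  then show "?f integrable_on ref_triangle"
    by (rule set_borel_integral_eq_integral(1))
  show "negligible (ref_triangle - interior ref_triangle)"
    by (rule negligible_ref_triangle_boundary)
  fix p assume "p \<in> ref_triangle - (ref_triangle - interior ref_triangle)"
  then show "dubiner 4 (Suc i) p * dubiner 4 (Suc j) p = ?f p"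
    using assms by (simp add: dubiner_interior)
qed

text \<open>Pairing the vanishing combination with mode j isolates \<open>c j\<close> by
  orthonormality; the boundary, where nothing is assumed, has measure zero.\<close>

lemma dubiner_independent:
  assumes zero: "\<forall>p\<in>interior ref_triangle. (\<Sum>i<15. c i * dubiner 4 (Suc i) p) = 0" and j: "j < 15"
  shows "c j = 0"
proof -
  have "0 = integral ref_triangle (\<lambda>p. 0 :: real)" by simp
  also have "\<dots> = integral ref_triangle (\<lambda>p. (\<Sum>i<15. c i * dubiner 4 (Suc i) p) * dubiner 4 (Suc j) p)"
    by (rule integral_spike[OF negligible_ref_triangle_boundary]) (use zero in auto)
  also have "\<dots> = integral ref_triangle (\<lambda>p. \<Sum>i<15. c i * (dubiner 4 (Suc i) p * dubiner 4 (Suc j) p))"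
    by (simp add: sum_distrib_right mult.assoc)
  also have "\<dots> = (\<Sum>i<15. integral ref_triangle (\<lambda>p. c i * (dubiner 4 (Suc i) p * dubiner 4 (Suc j) p)))"
    by (rule integral_sum) (auto intro!: integrable_on_mult_right dubiner_product_integrable j)
  also have "\<dots> = (\<Sum>i<15. if i = j then c i else 0)"
    by (intro sum.cong) (auto simp: integral_dubiner j)
  also have "\<dots> = c j" using j by simp
  finally show ?thesis by simp
qed

section \<open>Modal coordinates and modal matrices\<close>

text \<open>Only values on the interior count, as in \<open>modal_matrix\<close>; vector positions
  start at 0, hence the \<open>Suc\<close>.\<close>

definition is_coords :: "real vec \<Rightarrow> (real \<times> real \<Rightarrow> real) \<Rightarrow> bool" where
  "is_coords c f \<longleftrightarrow> c \<in> carrier_vec 15 \<and>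
     (\<forall>p\<in>interior ref_triangle. f p = (\<Sum>i<15. c $ i * dubiner 4 (Suc i) p))"

lemma is_coords_carrier: "is_coords c f \<Longrightarrow> c \<in> carrier_vec 15"
  by (simp add: is_coords_def)

lemma is_coords_unique:
  assumes "is_coords c f" "is_coords d g" "\<forall>p\<in>interior ref_triangle. f p = g p"
  shows "c = d"
proof (rule eq_vecI)
  have dim: "dim_vec c = 15" "dim_vec d = 15"
    using assms(1,2) by (auto simp: is_coords_def)
  then show "dim_vec c = dim_vec d" by simp
  fix i assume "i < dim_vec d"
  then have "c $ i - d $ i = 0"
    using assms dim
    by (intro dubiner_independent[of "\<lambda>i. c $ i - d $ i"])
       (auto simp: is_coords_def left_diff_distrib sum_subtractf)
  then show "c $ i = d $ i" by simp
qed

lemma is_coords_add: "is_coords c f \<Longrightarrow> is_coords d g \<Longrightarrow> is_coords (c + d) (\<lambda>p. f p + g p)"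
  by (auto simp: is_coords_def distrib_right sum.distrib[symmetric] intro!: sum.cong)

lemma is_coords_scale: "is_coords c f \<Longrightarrow> is_coords (a \<cdot>\<^sub>v c) (\<lambda>p. a * f p)"
  by (auto simp: is_coords_def sum_distrib_left intro!: sum.cong)

lemma is_coords_zero: "is_coords (0\<^sub>v 15) (\<lambda>p. 0)"
  by (auto simp: is_coords_def)

lemma is_coords_unit:
  assumes "i < 15"
  shows "is_coords (unit_vec 15 i) (dubiner 4 (Suc i))"
proof -
  have "(\<Sum>j<15. unit_vec 15 i $ j * dubiner 4 (Suc j) p) = (\<Sum>j<15. if j = i then dubiner 4 (Suc j) p else 0)" for p
    using assms by (intro sum.cong) auto
  then show ?thesis using assms by (auto simp: is_coords_def)
qed

lemma is_coords_cong:
  "is_coords c f \<Longrightarrow> (\<And>p. p \<in> interior ref_triangle \<Longrightarrow> f p = g p) \<Longrightarrow> is_coords c g"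
  by (simp add: is_coords_def)

text \<open>Two facts make the definite description in \<open>modal_matrix\<close> usable. Linearity
  is demanded only for functions that have coordinates and only on the interior, because
  \<open>deriv\<close> is not additive on arbitrary functions.\<close>

locale modal_operator =
  fixes T :: "(real \<times> real \<Rightarrow> real) \<Rightarrow> real \<times> real \<Rightarrow> real"
  assumes image: "\<And>j. j < 15 \<Longrightarrow> \<exists>c. is_coords c (T (dubiner 4 (Suc j)))"
    and linear: "\<And>c f p. is_coords c f \<Longrightarrow> p \<in> interior ref_triangle \<Longrightarrow>
       T f p = (\<Sum>j<15. c $ j * T (dubiner 4 (Suc j)) p)"
begin

text \<open>Existence comes from assembling the coordinates of the images as columns, uniqueness
  from the independence of the modes.\<close>

lemma modal_matrix_columns:
  shows carrier: "modal_matrix 4 T \<in> carrier_mat 15 15"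
    and column: "j < 15 \<Longrightarrow> is_coords (col (modal_matrix 4 T) j) (T (dubiner 4 (Suc j)))"
proof -
  have reindex: "(\<Sum>i = 1..15. f i) = (\<Sum>i<15. f (Suc i))" for f :: "nat \<Rightarrow> real"
    using sum.atLeast1_atMost_eq[of f 15] by simp
  let ?P = "\<lambda>A. A \<in> carrier_mat (num_modes 4) (num_modes 4) \<and>
     (\<forall>j\<in>{1..num_modes 4}. \<forall>p\<in>interior ref_triangle.
        T (dubiner 4 j) p = (\<Sum>i = 1..num_modes 4. entry A i j * dubiner 4 i p))"
  have P_iff: "?P A \<longleftrightarrow> A \<in> carrier_mat 15 15 \<and> (\<forall>j<15. is_coords (col A j) (T (dubiner 4 (Suc j))))"
    for A :: "real mat"
  proof -
    have ball: "(\<forall>j\<in>{1..15}. Q j) \<longleftrightarrow> (\<forall>j<15. Q (Suc j))" for Q :: "nat \<Rightarrow> bool"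
      by (auto simp: Ball_def) (metis Suc_le_D Suc_le_lessD less_Suc_eq_le)
    show ?thesis
      by (simp only: num_modes_4 reindex ball) (auto simp: entry_def is_coords_def)
  qed
  obtain c where c: "\<And>j. j < 15 \<Longrightarrow> is_coords (c j) (T (dubiner 4 (Suc j)))"
    using image by metis
  have "?P (mat_of_cols 15 (map c [0..<15]))"
    unfolding P_iff using c is_coords_carrier[OF c] by (auto simp: mat_of_cols_def[symmetric])
  moreover have "A = B" if "?P A" "?P B" for A B
  proof -
    have AB: "A \<in> carrier_mat 15 15" "B \<in> carrier_mat 15 15" using that unfolding P_iff by auto
    have "col A j = col B j" if "j < 15" for j
    proof (rule is_coords_unique)
      show "is_coords (col A j) (T (dubiner 4 (Suc j)))" "is_coords (col B j) (T (dubiner 4 (Suc j)))"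
        using \<open>?P A\<close> \<open>?P B\<close> that unfolding P_iff by simp_all
    qed simp
    then show ?thesis using AB by (intro mat_col_eqI) auto
  qed
  ultimately have "?P (modal_matrix 4 T)"
    unfolding modal_matrix_def by (intro theI[of ?P]) auto
  then show "modal_matrix 4 T \<in> carrier_mat 15 15"
    and "j < 15 \<Longrightarrow> is_coords (col (modal_matrix 4 T) j) (T (dubiner 4 (Suc j)))"
    unfolding P_iff by auto
qed

lemma apply_coords:
  assumes c: "is_coords c f"
  shows "is_coords (modal_matrix 4 T *\<^sub>v c) (T f)"
  unfolding is_coords_def
proof (intro conjI ballI)
  let ?A = "modal_matrix 4 T"
  have A: "?A \<in> carrier_mat 15 15" and dim: "dim_vec c = 15"
    using carrier is_coords_carrier[OF c] by auto
  show "?A *\<^sub>v c \<in> carrier_vec 15" by (rule mult_mat_vec_carrier[OF A is_coords_carrier[OF c]])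
  fix p assume p: "p \<in> interior ref_triangle"
  have "T f p = (\<Sum>j<15. c $ j * (\<Sum>i<15. ?A $$ (i, j) * dubiner 4 (Suc i) p))"
    unfolding linear[OF c p]
  proof (intro sum.cong refl)
    fix j assume "j \<in> {..<15::nat}"
    then show "c $ j * T (dubiner 4 (Suc j)) p = c $ j * (\<Sum>i<15. ?A $$ (i, j) * dubiner 4 (Suc i) p)"
      using column[of j] p A by (auto simp: is_coords_def)
  qed
  also have "\<dots> = (\<Sum>i<15. (\<Sum>j<15. ?A $$ (i, j) * c $ j) * dubiner 4 (Suc i) p)"
    unfolding sum_distrib_left sum_distrib_right
    by (subst sum.swap) (simp add: mult_ac)
  also have "\<dots> = (\<Sum>i<15. (?A *\<^sub>v c) $ i * dubiner 4 (Suc i) p)"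
    using A dim by (intro sum.cong) (auto simp: scalar_prod_def atLeast0LessThan)
  finally show "T f p = (\<Sum>i<15. (?A *\<^sub>v c) $ i * dubiner 4 (Suc i) p)" .
qed

end

section \<open>Polynomials of bounded degree\<close>

definition xt_monomial :: "nat \<Rightarrow> nat \<Rightarrow> real \<times> real \<Rightarrow> real" where
  "xt_monomial a b = (\<lambda>(x, y). x ^ a * tcoord y ^ b)"

text \<open>As an inductively generated span of monomials, it makes closure properties rule
  inductions. Its members are genuine polynomials on the whole plane, free of the division in
  \<open>dubiner_mode\<close>, and can be differentiated and composed everywhere.\<close>

inductive polys :: "nat \<Rightarrow> (real \<times> real \<Rightarrow> real) \<Rightarrow> bool" where
  monomial: "a + b \<le> n \<Longrightarrow> polys n (xt_monomial a b)"
| add: "polys n f \<Longrightarrow> polys n g \<Longrightarrow> polys n (\<lambda>p. f p + g p)"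
| scale: "polys n f \<Longrightarrow> polys n (\<lambda>p. c * f p)"

lemma polys_le: "polys n f \<Longrightarrow> n \<le> m \<Longrightarrow> polys m f"
  by (induction rule: polys.induct) (auto intro: polys.intros)

lemma polys_const: "polys n (\<lambda>p. c)"
  using polys.scale[OF polys.monomial[of 0 0 n], of c] by (simp add: xt_monomial_def case_prod_unfold)

lemma polys_mult_mono: "polys m f \<Longrightarrow> a + b \<le> n \<Longrightarrow> polys (m + n) (\<lambda>p. f p * xt_monomial a b p)"
proof (induction rule: polys.induct)
  case (monomial c d m)
  have "(\<lambda>p. xt_monomial c d p * xt_monomial a b p) = xt_monomial (c + a) (d + b)"
    by (auto simp: xt_monomial_def power_add)
  then show ?case using monomial by (auto intro!: polys.monomial)
next
  case (add m f g)
  then show ?case using polys.add[of "m + n"] by (simp add: distrib_right)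
next
  case (scale m f c)
  then show ?case using polys.scale[of "m + n" "\<lambda>p. f p * xt_monomial a b p" c] by (simp add: mult.assoc)
qed

lemma polys_mult: "polys n g \<Longrightarrow> polys m f \<Longrightarrow> polys (m + n) (\<lambda>p. f p * g p)"
proof (induction rule: polys.induct)
  case (monomial a b n)
  then show ?case by (simp add: polys_mult_mono)
next
  case (add n g h)
  then show ?case using polys.add[of "m + n"] by (simp add: distrib_left)
next
  case (scale n g c)
  then show ?case using polys.scale[of "m + n" "\<lambda>p. f p * g p" c] by (simp add: mult.left_commute)
qed

lemma polys_power: "polys 1 f \<Longrightarrow> k \<le> n \<Longrightarrow> polys n (\<lambda>p. f p ^ k)"
proof (induction k arbitrary: n)
  case 0
  show ?case by (simp add: polys_const)
next
  case (Suc k)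
  then have "polys (k + 1) (\<lambda>p. f p ^ k * f p)" by (intro polys_mult) auto
  then show ?case using Suc.prems polys_le[of "k + 1" _ n] by (simp add: mult.commute)
qed

lemma polys_sum: "(\<And>i. i \<in> A \<Longrightarrow> polys n (f i)) \<Longrightarrow> polys n (\<lambda>p. \<Sum>i\<in>A. f i p)"
  by (induction A rule: infinite_finite_induct) (auto intro: polys_const polys.add)

lemma polys_mode_poly: "polys (v + w) (mode_poly v w)"
proof -
  have "polys v (\<lambda>p. \<Sum>m\<le>v. coeff (jacobi_poly 0 0 v) m * xt_monomial m (v - m) p)"
    by (intro polys_sum polys.scale polys.monomial) auto
  moreover have "polys w (\<lambda>p. \<Sum>i\<le>w. coeff (shifted_jacobi v w) i * xt_monomial 0 i p)"
    by (intro polys_sum polys.scale polys.monomial) auto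
  ultimately have "polys (v + w) (\<lambda>p. (\<Sum>m\<le>v. coeff (jacobi_poly 0 0 v) m * xt_monomial m (v - m) p)
      * (\<Sum>i\<le>w. coeff (shifted_jacobi v w) i * xt_monomial 0 i p))"
    by (intro polys_mult)
  then show ?thesis
    by (simp add: mode_poly_def homogeneous_legendre_def xt_monomial_def case_prod_unfold mult.assoc
          poly_as_sum_degree_le[OF degree_shifted_jacobi])
qed

lemma polys_compose:
  assumes "polys n f" "polys 1 (\<lambda>p. fst (R p))" "polys 1 (\<lambda>p. tcoord (snd (R p)))"
  shows "polys n (\<lambda>p. f (R p))"
  using assms(1)
proof (induction rule: polys.induct)
  case (monomial a b n)
  have "polys (a + b) (\<lambda>p. fst (R p) ^ a * tcoord (snd (R p)) ^ b)"
    by (intro polys_mult polys_power assms) auto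
  then show ?case
    using monomial polys_le by (simp add: xt_monomial_def case_prod_unfold)
qed (auto intro: polys.intros)

lemma xt_monomial_deriv_x:
  "((\<lambda>u. xt_monomial a b (u, y)) has_real_derivative real a * xt_monomial (a - 1) b (x, y)) (at x)"
  unfolding xt_monomial_def by (auto intro!: derivative_eq_intros)

lemma xt_monomial_deriv_y:
  "((\<lambda>u. xt_monomial a b (x, u)) has_real_derivative - (real b / sqrt 3) * xt_monomial a (b - 1) (x, y)) (at y)"
proof -
  have "(tcoord has_real_derivative - (1 / sqrt 3)) (at y)"
    unfolding tcoord_def by (auto intro!: derivative_eq_intros simp: field_simps)
  from DERIV_cmult[OF DERIV_power[OF this, of b], of "x ^ a"] show ?thesis
    by (simp add: xt_monomial_def mult_ac)
qed

lemma polys_deriv_x: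
  "polys n f \<Longrightarrow> \<exists>g. polys (n - 1) g \<and>
     (\<forall>x y. ((\<lambda>u. f (u, y)) has_real_derivative g (x, y)) (at x))"
proof (induction rule: polys.induct)
  case (monomial a b n)
  \<comment> \<open>For a = 0 the truncated exponent is harmless because the coefficient is
    0.\<close>
  have "polys (n - 1) (\<lambda>p. real a * xt_monomial (a - 1) b p)"
    using monomial by (cases a) (auto intro!: polys.scale polys.monomial polys_const)
  then show ?case using xt_monomial_deriv_x by blast
next
  case (add n f g)
  then obtain f' g' where "polys (n - 1) f'" "polys (n - 1) g'"
     "\<And>x y. ((\<lambda>u. f (u, y)) has_real_derivative f' (x, y)) (at x)"
     "\<And>x y. ((\<lambda>u. g (u, y)) has_real_derivative g' (x, y)) (at x)" by blast
  then show ?case by (intro exI[of _ "\<lambda>p. f' p + g' p"]) (auto intro: polys.add DERIV_add)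
next
  case (scale n f c)
  then obtain f' where "polys (n - 1) f'"
     "\<And>x y. ((\<lambda>u. f (u, y)) has_real_derivative f' (x, y)) (at x)" by blast
  then show ?case by (intro exI[of _ "\<lambda>p. c * f' p"]) (auto intro: polys.scale DERIV_cmult)
qed

lemma polys_deriv_y:
  "polys n f \<Longrightarrow> \<exists>g. polys (n - 1) g \<and>
     (\<forall>x y. ((\<lambda>u. f (x, u)) has_real_derivative g (x, y)) (at y))"
proof (induction rule: polys.induct)
  case (monomial a b n)
  have "polys (n - 1) (\<lambda>p. - (real b / sqrt 3) * xt_monomial a (b - 1) p)"
  proof (cases b)
    case 0
    then show ?thesis by (simp add: polys_const)
  next
    case (Suc c)
    then show ?thesis using monomial by (intro polys.scale polys.monomial) auto
  qed
  then show ?case using xt_monomial_deriv_y by blast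
next
  case (add n f g)
  then obtain f' g' where "polys (n - 1) f'" "polys (n - 1) g'"
     "\<And>x y. ((\<lambda>u. f (x, u)) has_real_derivative f' (x, y)) (at y)"
     "\<And>x y. ((\<lambda>u. g (x, u)) has_real_derivative g' (x, y)) (at y)" by blast
  then show ?case by (intro exI[of _ "\<lambda>p. f' p + g' p"]) (auto intro: polys.add DERIV_add)
next
  case (scale n f c)
  then obtain f' where "polys (n - 1) f'"
     "\<And>x y. ((\<lambda>u. f (x, u)) has_real_derivative f' (x, y)) (at y)" by blast
  then show ?case by (intro exI[of _ "\<lambda>p. c * f' p"]) (auto intro: polys.scale DERIV_cmult)
qed

lemma homogeneous_legendre_explicit:
  "homogeneous_legendre 0 x t = 1"
  "homogeneous_legendre (Suc 0) x t = x"
  "homogeneous_legendre 2 x t = (3 * x^2 - t^2) / 2"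
  "homogeneous_legendre 3 x t = (5 * x^3 - 3 * x * t^2) / 2"
  "homogeneous_legendre 4 x t = (35 * x^4 - 30 * x^2 * t^2 + 3 * t^4) / 8"
  by (simp_all add: homogeneous_legendre_def legendre_explicit atMost_nat_numeral atMost_Suc
        coeff_pCons field_simps)

definition in_span :: "nat \<Rightarrow> (real \<times> real \<Rightarrow> real) \<Rightarrow> bool" where
  "in_span n f \<longleftrightarrow> (\<exists>c. (\<forall>i<15. mode_degree i > n \<longrightarrow> c i = 0) \<and> (\<forall>p. f p = (\<Sum>i<15. c i * nth_poly i p)))"

text \<open>The lists invert the change from modes to monomials, in the order of
  \<open>modes\<close>. First x^a is expanded in homogenised Legendre polynomials of the same
  parity, then the remaining power of t in the shifted Jacobi polynomials belonging to v. Total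
  degree never rises, which accounts for the index of \<open>in_span\<close>.\<close>

lemma in_span_mono:
  assumes "a + b \<le> 4"
  shows "in_span (a + b) (xt_monomial a b)"
proof -
  have span: "in_span n f"
    if "\<And>x y. f (x, y) = (\<Sum>i<15. c ! i * nth_poly i (x, y))" "\<forall>i\<in>{..<15}. mode_degree i > n \<longrightarrow> c ! i = 0"
    for n f and c :: "real list"
    unfolding in_span_def using that by (intro exI[of _ "\<lambda>i. c ! i"]) auto
  note rules = xt_monomial_def mode_poly_def modes_def lessThan_nat_numeral lessThan_Suc
    homogeneous_legendre_explicit shifted_jacobi_explicit less_Suc_eq field_simps
    power2_eq_square power3_eq_cube power4_eq_xxxx
  have "in_span 0 (xt_monomial 0 0)"
    by (rule span[of _ "[1, 0, 0, 0, 0, 0, 0, 0, 0, 0, 0, 0, 0, 0, 0]"]) (simp_all add: rules)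
  moreover
  have "in_span (Suc 0) (xt_monomial 0 (Suc 0))"
    by (rule span[of _ "[2/3, -1/3, 0, 0, 0, 0, 0, 0, 0, 0, 0, 0, 0, 0, 0]"]) (simp_all add: rules)
  moreover
  have "in_span 2 (xt_monomial 0 2)"
    by (rule span[of _ "[1/2, -2/5, 1/10, 0, 0, 0, 0, 0, 0, 0, 0, 0, 0, 0, 0]"]) (simp_all add: rules)
  moreover
  have "in_span 3 (xt_monomial 0 3)"
    by (rule span[of _ "[2/5, -2/5, 6/35, -1/35, 0, 0, 0, 0, 0, 0, 0, 0, 0, 0, 0]"]) (simp_all add: rules)
  moreover
  have "in_span 4 (xt_monomial 0 4)"
    by (rule span[of _ "[1/3, -8/21, 3/14, -4/63, 1/126, 0, 0, 0, 0, 0, 0, 0, 0, 0, 0]"]) (simp_all add: rules)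
  moreover
  have "in_span (Suc 0) (xt_monomial (Suc 0) 0)"
    by (rule span[of _ "[0, 0, 0, 0, 0, 1, 0, 0, 0, 0, 0, 0, 0, 0, 0]"]) (simp_all add: rules)
  moreover
  have "in_span 2 (xt_monomial (Suc 0) (Suc 0))"
    by (rule span[of _ "[0, 0, 0, 0, 0, 4/5, -1/5, 0, 0, 0, 0, 0, 0, 0, 0]"]) (simp_all add: rules)
  moreover
  have "in_span 3 (xt_monomial (Suc 0) 2)"
    by (rule span[of _ "[0, 0, 0, 0, 0, 2/3, -2/7, 1/21, 0, 0, 0, 0, 0, 0, 0]"]) (simp_all add: rules)
  moreover
  have "in_span 4 (xt_monomial (Suc 0) 3)"
    by (rule span[of _ "[0, 0, 0, 0, 0, 4/7, -9/28, 2/21, -1/84, 0, 0, 0, 0, 0, 0]"]) (simp_all add: rules)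
  moreover
  have "in_span 2 (xt_monomial 2 0)"
    by (rule span[of _ "[1/6, -2/15, 1/30, 0, 0, 0, 0, 0, 0, 2/3, 0, 0, 0, 0, 0]"]) (simp_all add: rules)
  moreover
  have "in_span 3 (xt_monomial 2 (Suc 0))"
    by (rule span[of _ "[2/15, -2/15, 2/35, -1/105, 0, 0, 0, 0, 0, 4/7, -2/21, 0, 0, 0, 0]"]) (simp_all add: rules)
  moreover
  have "in_span 4 (xt_monomial 2 2)"
    by (rule span[of _ "[1/9, -8/63, 1/14, -4/189, 1/378, 0, 0, 0, 0, 1/2, -4/27, 1/54, 0, 0, 0]"]) (simp_all add: rules)
  moreover
  have "in_span 3 (xt_monomial 3 0)"
    by (rule span[of _ "[0, 0, 0, 0, 0, 2/5, -6/35, 1/35, 0, 0, 0, 0, 2/5, 0, 0]"]) (simp_all add: rules)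
  moreover
  have "in_span 4 (xt_monomial 3 (Suc 0))"
    by (rule span[of _ "[0, 0, 0, 0, 0, 12/35, -27/140, 2/35, -1/140, 0, 0, 0, 16/45, -2/45, 0]"]) (simp_all add: rules)
  moreover
  have "in_span 4 (xt_monomial 4 0)"
    by (rule span[of _ "[1/15, -8/105, 3/70, -4/315, 1/630, 0, 0, 0, 0, 3/7, -8/63, 1/63, 0, 0, 8/35]"]) (simp_all add: rules)
  moreover from assms have "(a, b) \<in> set modes" by (simp add: set_modes)
  ultimately show ?thesis by (auto simp: modes_def numeral_2_eq_2[symmetric] numeral_3_eq_3[symmetric])
qed

lemma in_span_le: "in_span n f \<Longrightarrow> n \<le> m \<Longrightarrow> in_span m f"
  unfolding in_span_def by (meson le_less_trans)

lemma in_span_add: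
  assumes "in_span n f" "in_span n g"
  shows "in_span n (\<lambda>p. f p + g p)"
proof -
  obtain c d where "\<forall>i<15. mode_degree i > n \<longrightarrow> c i = 0" "\<forall>p. f p = (\<Sum>i<15. c i * nth_poly i p)"
    "\<forall>i<15. mode_degree i > n \<longrightarrow> d i = 0" "\<forall>p. g p = (\<Sum>i<15. d i * nth_poly i p)"
    using assms unfolding in_span_def by blast
  then show ?thesis
    unfolding in_span_def
    by (intro exI[of _ "\<lambda>i. c i + d i"]) (simp add: distrib_right sum.distrib)
qed

lemma in_span_scale:
  assumes "in_span n f"
  shows "in_span n (\<lambda>p. a * f p)"
proof -
  obtain c where "\<forall>i<15. mode_degree i > n \<longrightarrow> c i = 0" "\<forall>p. f p = (\<Sum>i<15. c i * nth_poly i p)"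
    using assms unfolding in_span_def by blast
  then show ?thesis
    unfolding in_span_def
    by (intro exI[of _ "\<lambda>i. a * c i"]) (simp add: sum_distrib_left mult.assoc)
qed

lemma polys_in_span: "polys n f \<Longrightarrow> n \<le> 4 \<Longrightarrow> in_span n f"
proof (induction rule: polys.induct)
  case (monomial a b n)
  then show ?case using in_span_le[OF in_span_mono[of a b]] by simp
qed (auto intro: in_span_add in_span_scale)

lemma polys_coords:
  assumes "polys n f" "n \<le> 4"
  shows "\<exists>c. is_coords c f \<and> (\<forall>i<15. mode_degree i > n \<longrightarrow> c $ i = 0)"
proof -
  obtain c where c: "\<forall>i<15. mode_degree i > n \<longrightarrow> c i = 0" "\<forall>p. f p = (\<Sum>i<15. c i * nth_poly i p)"
    using polys_in_span[OF assms] unfolding in_span_def by blast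
  have "is_coords (vec 15 (\<lambda>i. c i / nth_norm i)) f"
    using c(2) mode_norm_pos by (auto simp: is_coords_def dubiner_interior less_imp_neq[symmetric] intro!: sum.cong)
  then show ?thesis using c(1) by (intro exI[of _ "vec 15 (\<lambda>i. c i / nth_norm i)"]) auto
qed

section \<open>Derivatives and symmetries as operators on modes\<close>

lemma coords_interior:
  assumes "is_coords c f" "p \<in> interior ref_triangle"
  shows "f p = (\<Sum>i<15. c $ i * (nth_norm i * nth_poly i p))"
  using assms by (auto simp: is_coords_def dubiner_interior intro!: sum.cong)

text \<open>The interior is open, so agreement with \<open>g\<close> on it is agreement near each of
  its points, and the derivative transfers. Derivatives of modes are thereby computed on
  polynomials.\<close>

lemma partial_x_eq:
  assumes fg: "\<And>p. p \<in> interior ref_triangle \<Longrightarrow> f p = g p" and p: "(x, y) \<in> interior ref_triangle"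
    and deriv: "((\<lambda>u. g (u, y)) has_real_derivative d) (at x)"
  shows "partial_x f (x, y) = d"
proof -
  have "open ((\<lambda>u. (u, y)) -` interior ref_triangle)"
    by (intro open_vimage) (auto intro!: continuous_intros)
  from has_field_derivative_transform_within_open[OF deriv this] p fg
  have "((\<lambda>u. f (u, y)) has_real_derivative d) (at x)" by simp
  then show ?thesis by (simp add: partial_x_def DERIV_imp_deriv)
qed

lemma partial_y_eq:
  assumes fg: "\<And>p. p \<in> interior ref_triangle \<Longrightarrow> f p = g p" and p: "(x, y) \<in> interior ref_triangle"
    and deriv: "((\<lambda>u. g (x, u)) has_real_derivative d) (at y)"
  shows "partial_y f (x, y) = d"
proof -
  have "open ((\<lambda>u. (x, u)) -` interior ref_triangle)"
    by (intro open_vimage) (auto intro!: continuous_intros)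
  from has_field_derivative_transform_within_open[OF deriv this] p fg
  have "((\<lambda>u. f (x, u)) has_real_derivative d) (at y)" by simp
  then show ?thesis by (simp add: partial_y_def DERIV_imp_deriv)
qed

lemma nth_poly_deriv:
  assumes "j < 15"
  shows "\<exists>g. polys 3 g \<and> (\<forall>x y. ((\<lambda>u. nth_norm j * nth_poly j (u, y)) has_real_derivative g (x, y)) (at x))"
    and "\<exists>g. polys 3 g \<and> (\<forall>x y. ((\<lambda>u. nth_norm j * nth_poly j (x, u)) has_real_derivative g (x, y)) (at y))"
proof -
  have "polys 4 (\<lambda>p. nth_norm j * nth_poly j p)"
    by (intro polys.scale polys_le[OF polys_mode_poly mode_degree_le[OF assms]])
  from polys_deriv_x[OF this] polys_deriv_y[OF this] show
    "\<exists>g. polys 3 g \<and> (\<forall>x y. ((\<lambda>u. nth_norm j * nth_poly j (u, y)) has_real_derivative g (x, y)) (at x))"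
    "\<exists>g. polys 3 g \<and> (\<forall>x y. ((\<lambda>u. nth_norm j * nth_poly j (x, u)) has_real_derivative g (x, y)) (at y))"
    by simp_all
qed

text \<open>A derivative has degree at most 3, hence no component along the modes of degree 4. In
  \<open>derivative_top_rows\<close> this becomes zero rows of the differentiation matrices, the
  reason why every form on the top modes satisfies (E2).\<close>

lemma derivative_top_coords:
  assumes "j < 15"
  shows "\<exists>c. is_coords c (partial_x (dubiner 4 (Suc j))) \<and> (\<forall>i<15. mode_degree i > 3 \<longrightarrow> c $ i = 0)"
    and "\<exists>c. is_coords c (partial_y (dubiner 4 (Suc j))) \<and> (\<forall>i<15. mode_degree i > 3 \<longrightarrow> c $ i = 0)"
proof -
  obtain g where g: "polys 3 g"
    "\<And>x y. ((\<lambda>u. nth_norm j * nth_poly j (u, y)) has_real_derivative g (x, y)) (at x)"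
    using nth_poly_deriv(1)[OF assms] by blast
  obtain c where c: "is_coords c g" "\<forall>i<15. mode_degree i > 3 \<longrightarrow> c $ i = 0"
    using polys_coords[OF g(1)] by auto
  have "partial_x (dubiner 4 (Suc j)) p = g p" if "p \<in> interior ref_triangle" for p
    using that partial_x_eq[OF dubiner_interior[OF assms] _ g(2)] by (cases p) auto
  then have "is_coords c (partial_x (dubiner 4 (Suc j)))"
    using is_coords_cong[OF c(1)] by auto
  then show "\<exists>c. is_coords c (partial_x (dubiner 4 (Suc j))) \<and> (\<forall>i<15. mode_degree i > 3 \<longrightarrow> c $ i = 0)"
    using c(2) by blast
next
  obtain g where g: "polys 3 g"
    "\<And>x y. ((\<lambda>u. nth_norm j * nth_poly j (x, u)) has_real_derivative g (x, y)) (at y)"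
    using nth_poly_deriv(2)[OF assms] by blast
  obtain c where c: "is_coords c g" "\<forall>i<15. mode_degree i > 3 \<longrightarrow> c $ i = 0"
    using polys_coords[OF g(1)] by auto
  have "partial_y (dubiner 4 (Suc j)) p = g p" if "p \<in> interior ref_triangle" for p
    using that partial_y_eq[OF dubiner_interior[OF assms] _ g(2)] by (cases p) auto
  then have "is_coords c (partial_y (dubiner 4 (Suc j)))"
    using is_coords_cong[OF c(1)] by auto
  then show "\<exists>c. is_coords c (partial_y (dubiner 4 (Suc j))) \<and> (\<forall>i<15. mode_degree i > 3 \<longrightarrow> c $ i = 0)"
    using c(2) by blast
qed

interpretation Dx: modal_operator partial_x
proof
  show "\<exists>c. is_coords c (partial_x (dubiner 4 (Suc j)))" if "j < 15" for j
    using derivative_top_coords(1)[OF that] by blast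
  fix c f and p :: "real \<times> real" assume c: "is_coords c f" and p: "p \<in> interior ref_triangle"
  obtain x y where xy: "p = (x, y)" by (cases p)
  obtain g where g: "\<And>j x y. j < 15 \<Longrightarrow>
      ((\<lambda>u. nth_norm j * nth_poly j (u, y)) has_real_derivative g j (x, y)) (at x)"
    using nth_poly_deriv(1) by metis
  have "partial_x (dubiner 4 (Suc j)) p = g j p" if "j < 15" for j
    unfolding xy by (rule partial_x_eq[OF dubiner_interior[OF that] p[unfolded xy] g[OF that]])
  moreover have "partial_x f p = (\<Sum>j<15. c $ j * g j p)"
    unfolding xy
  proof (rule partial_x_eq[OF coords_interior[OF c] p[unfolded xy]])
    show "((\<lambda>u. \<Sum>j<15. c $ j * (nth_norm j * nth_poly j (u, y)))
        has_real_derivative (\<Sum>j<15. c $ j * g j (x, y))) (at x)"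
      by (rule DERIV_sum, rule DERIV_cmult, rule g, simp)
  qed
  ultimately show "partial_x f p = (\<Sum>j<15. c $ j * partial_x (dubiner 4 (Suc j)) p)" by simp
qed

interpretation Dy: modal_operator partial_y
proof
  show "\<exists>c. is_coords c (partial_y (dubiner 4 (Suc j)))" if "j < 15" for j
    using derivative_top_coords(2)[OF that] by blast
  fix c f and p :: "real \<times> real" assume c: "is_coords c f" and p: "p \<in> interior ref_triangle"
  obtain x y where xy: "p = (x, y)" by (cases p)
  obtain g where g: "\<And>j x y. j < 15 \<Longrightarrow>
      ((\<lambda>u. nth_norm j * nth_poly j (x, u)) has_real_derivative g j (x, y)) (at y)"
    using nth_poly_deriv(2) by metis
  have "partial_y (dubiner 4 (Suc j)) p = g j p" if "j < 15" for j
    unfolding xy by (rule partial_y_eq[OF dubiner_interior[OF that] p[unfolded xy] g[OF that]])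
  moreover have "partial_y f p = (\<Sum>j<15. c $ j * g j p)"
    unfolding xy
  proof (rule partial_y_eq[OF coords_interior[OF c] p[unfolded xy]])
    show "((\<lambda>u. \<Sum>j<15. c $ j * (nth_norm j * nth_poly j (x, u)))
        has_real_derivative (\<Sum>j<15. c $ j * g j (x, y))) (at y)"
      by (rule DERIV_sum, rule DERIV_cmult, rule g, simp)
  qed
  ultimately show "partial_y f p = (\<Sum>j<15. c $ j * partial_y (dubiner 4 (Suc j)) p)" by simp
qed

text \<open>An affine substitution preserves the degree bound, and mapping the interior into itself
  keeps identities between functions where they are known to hold.\<close>

lemma modal_operator_composition:
  assumes R: "\<And>p. p \<in> interior ref_triangle \<Longrightarrow> R p \<in> interior ref_triangle"
    and polys: "polys 1 (\<lambda>p. fst (R p))" "polys 1 (\<lambda>p. tcoord (snd (R p)))"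
  shows "modal_operator (\<lambda>f. f \<circ> R)"
proof
  fix j :: nat assume j: "j < 15"
  have "polys 4 (\<lambda>p. nth_norm j * nth_poly j (R p))"
    by (rule polys.scale, rule polys_compose[OF _ polys], rule polys_le[OF polys_mode_poly mode_degree_le[OF j]])
  then obtain c where c: "is_coords c (\<lambda>p. nth_norm j * nth_poly j (R p))"
    using polys_coords by blast
  show "\<exists>c. is_coords c (dubiner 4 (Suc j) \<circ> R)"
    by (rule exI, rule is_coords_cong[OF c]) (simp add: dubiner_interior j R)
next
  fix c f and p :: "real \<times> real" assume "is_coords c f" "p \<in> interior ref_triangle"
  then show "(f \<circ> R) p = (\<Sum>j<15. c $ j * (dubiner 4 (Suc j) \<circ> R) p)"
    using R[of p] by (simp add: is_coords_def)
qed

lemma polys_affine: "polys 1 (\<lambda>p. a + (b * xt_monomial 1 0 p + c * xt_monomial 0 1 p))"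
proof (rule polys.add)
  show "polys 1 (\<lambda>p. b * xt_monomial 1 0 p + c * xt_monomial 0 1 p)"
  proof (rule polys.add)
    have "polys 1 (xt_monomial 1 0)" "polys 1 (xt_monomial 0 1)"
      by (rule polys.monomial, simp)+
    then show "polys 1 (\<lambda>p. b * xt_monomial 1 0 p)" "polys 1 (\<lambda>p. c * xt_monomial 0 1 p)"
      by (simp_all only: polys.scale)
  qed
qed (rule polys_const)

lemma rotation_affine: "polys 1 (\<lambda>p. fst (rotation3 p))" "polys 1 (\<lambda>p. tcoord (snd (rotation3 p)))"
proof -
  have eq: "(\<lambda>p. fst (rotation3 p)) = (\<lambda>p. - 1 + (- 1 / 2 * xt_monomial 1 0 p + 3 / 2 * xt_monomial 0 1 p))"
    by (auto simp: rotation3_eq xt_monomial_def fun_eq_iff)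
  show "polys 1 (\<lambda>p. fst (rotation3 p))"
    unfolding eq by (rule polys_affine)
  have eq: "(\<lambda>p. tcoord (snd (rotation3 p))) = (\<lambda>p. 1 + (- 1 / 2 * xt_monomial 1 0 p + - 1 / 2 * xt_monomial 0 1 p))"
    by (auto simp: rotation3_eq tcoord_rotation3 xt_monomial_def fun_eq_iff)
  show "polys 1 (\<lambda>p. tcoord (snd (rotation3 p)))"
    unfolding eq by (rule polys_affine)
qed

interpretation rotation: modal_operator "\<lambda>f. f \<circ> rotation3"
  by (rule modal_operator_composition[OF rotation3_interior rotation_affine])

interpretation reflection: modal_operator "\<lambda>f. f \<circ> reflection_x"
proof (rule modal_operator_composition)
  have eq: "(\<lambda>p. fst (reflection_x p)) = (\<lambda>p. 0 + (- 1 * xt_monomial 1 0 p + 0 * xt_monomial 0 1 p))"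
    by (auto simp: reflection_x_def xt_monomial_def fun_eq_iff)
  show "polys 1 (\<lambda>p. fst (reflection_x p))"
    unfolding eq by (rule polys_affine)
  have eq: "(\<lambda>p. tcoord (snd (reflection_x p))) = (\<lambda>p. 0 + (0 * xt_monomial 1 0 p + 1 * xt_monomial 0 1 p))"
    by (auto simp: reflection_x_def xt_monomial_def fun_eq_iff)
  show "polys 1 (\<lambda>p. tcoord (snd (reflection_x p)))"
    unfolding eq by (rule polys_affine)
qed (rule reflection_x_interior)

lemma derivative_top_rows:
  assumes i: "i < 15" "mode_degree i > 3" and j: "j < 15"
  shows "Dx_mat 4 $$ (i, j) = 0" "Dy_mat 4 $$ (i, j) = 0"
proof -
  obtain c where "is_coords c (partial_x (dubiner 4 (Suc j)))" "c $ i = 0"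
    using derivative_top_coords(1)[OF j] i by blast
  with is_coords_unique[OF Dx.column[OF j]] have "col (modal_matrix 4 partial_x) j $ i = 0" by blast
  then show "Dx_mat 4 $$ (i, j) = 0" using Dx.carrier i j by (auto simp: Dx_mat_def)
next
  obtain c where "is_coords c (partial_y (dubiner 4 (Suc j)))" "c $ i = 0"
    using derivative_top_coords(2)[OF j] i by blast
  with is_coords_unique[OF Dy.column[OF j]] have "col (modal_matrix 4 partial_y) j $ i = 0" by blast
  then show "Dy_mat 4 $$ (i, j) = 0" using Dy.carrier i j by (auto simp: Dy_mat_def)
qed

section \<open>Coordinates of monomials and vectors orthogonal to low degrees\<close>

definition monomial_coords :: "nat \<Rightarrow> nat \<Rightarrow> real vec" where
  "monomial_coords a b = (THE c. is_coords c (xt_monomial a b))"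

lemma is_coords_monomial:
  assumes "a + b \<le> 4"
  shows "is_coords (monomial_coords a b) (xt_monomial a b)"
proof -
  obtain c where c: "is_coords c (xt_monomial a b)"
    using polys_coords[OF polys.monomial[OF assms]] by auto
  show ?thesis
    unfolding monomial_coords_def by (rule theI[where P = "\<lambda>c. is_coords c (xt_monomial a b)", OF c]) (use is_coords_unique[OF _ c] in blast)
qed

lemma monomial_coords_carrier: "a + b \<le> 4 \<Longrightarrow> monomial_coords a b \<in> carrier_vec 15"
  using is_coords_monomial is_coords_carrier by blast

lemma Dx_monomial:
  assumes "a + b \<le> 4"
  shows "Dx_mat 4 *\<^sub>v monomial_coords a b = real a \<cdot>\<^sub>v monomial_coords (a - 1) b"
proof (rule is_coords_unique)
  show "is_coords (Dx_mat 4 *\<^sub>v monomial_coords a b) (partial_x (xt_monomial a b))"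
    unfolding Dx_mat_def by (rule Dx.apply_coords[OF is_coords_monomial[OF assms]])
  show "is_coords (real a \<cdot>\<^sub>v monomial_coords (a - 1) b) (\<lambda>p. real a * xt_monomial (a - 1) b p)"
    using assms by (intro is_coords_scale is_coords_monomial) simp
  show "\<forall>p\<in>interior ref_triangle. partial_x (xt_monomial a b) p = real a * xt_monomial (a - 1) b p"
    using partial_x_eq[OF refl _ xt_monomial_deriv_x] by (auto simp del: of_nat_diff)
qed

text \<open>The factor is the exponent times dt/dy = -1 / sqrt 3; for b = 0 the truncated exponent
  comes with coefficient 0.\<close>

lemma Dy_monomial:
  assumes "a + b \<le> 4"
  shows "Dy_mat 4 *\<^sub>v monomial_coords a b = (- (real b / sqrt 3)) \<cdot>\<^sub>v monomial_coords a (b - 1)"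
proof (rule is_coords_unique)
  show "is_coords (Dy_mat 4 *\<^sub>v monomial_coords a b) (partial_y (xt_monomial a b))"
    unfolding Dy_mat_def by (rule Dy.apply_coords[OF is_coords_monomial[OF assms]])
  show "is_coords ((- (real b / sqrt 3)) \<cdot>\<^sub>v monomial_coords a (b - 1))
          (\<lambda>p. - (real b / sqrt 3) * xt_monomial a (b - 1) p)"
    using assms by (intro is_coords_scale is_coords_monomial) simp
  show "\<forall>p\<in>interior ref_triangle. partial_y (xt_monomial a b) p = - (real b / sqrt 3) * xt_monomial a (b - 1) p"
    using partial_y_eq[OF refl _ xt_monomial_deriv_y] by auto
qed

lemma orthogonal_polys_coords:
  assumes z: "z \<in> carrier_vec 15"
    and orth: "\<And>a b. a + b \<le> n \<Longrightarrow> scalar_prod z (monomial_coords a b) = 0"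
    and n: "n \<le> 4" and f: "polys n f" and c: "is_coords c f"
  shows "scalar_prod z c = 0"
proof -
  have "\<exists>d. is_coords d f \<and> scalar_prod z d = 0"
    using f n orth
  proof (induction rule: polys.induct)
    case (monomial a b n)
    then show ?case using is_coords_monomial[of a b] by auto
  next
    case (add n f g)
    then obtain d e where de: "is_coords d f" "scalar_prod z d = 0" "is_coords e g" "scalar_prod z e = 0"
      by meson
    then show ?case
      using scalar_prod_add_distrib[OF z is_coords_carrier[OF de(1)] is_coords_carrier[OF de(3)]]
      by (intro exI[of _ "d + e"]) (simp add: is_coords_add)
  next
    case (scale n f a)
    then obtain d where d: "is_coords d f" "scalar_prod z d = 0" by meson
    then show ?case
      using scalar_prod_smult_distrib[OF z is_coords_carrier[OF d(1)]]
      by (intro exI[of _ "a \<cdot>\<^sub>v d"]) (simp add: is_coords_scale)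
  qed
  then show ?thesis using is_coords_unique[OF c] by blast
qed

text \<open>Mode i is a polynomial of degree at most n, so orthogonality extends from monomials to
  its unit vector, which reads off one entry. This carries statements about monomials to matrix
  entries, both for \<open>Q\<close> and for \<open>K_mat\<close>.\<close>

lemma orthogonal_low_modes:
  assumes z: "z \<in> carrier_vec 15"
    and orth: "\<And>a b. a + b \<le> n \<Longrightarrow> scalar_prod z (monomial_coords a b) = 0"
    and n: "n \<le> 4" and i: "i < 15" "mode_degree i \<le> n"
  shows "z $ i = 0"
proof -
  have "scalar_prod z (unit_vec 15 i) = 0"
  proof (rule orthogonal_polys_coords[OF z orth n])
    show "polys n (\<lambda>p. nth_norm i * nth_poly i p)"
      by (intro polys.scale polys_le[OF polys_mode_poly i(2)])
    show "is_coords (unit_vec 15 i) (\<lambda>p. nth_norm i * nth_poly i p)"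
      by (rule is_coords_cong[OF is_coords_unit[OF i(1)]]) (simp add: dubiner_interior i(1))
  qed
  then show ?thesis using z i(1) by (simp add: scalar_prod_right_unit)
qed

text \<open>Moving one factor \<open>x\<close> from the second argument to the first and one factor \<open>t\<close> back keeps both
  degrees admissible and lowers the exponent \<open>c\<close>; the induction is on \<open>c\<close>.\<close>

lemma skew_shift_vanishes:
  fixes \<beta> :: "nat \<Rightarrow> nat \<Rightarrow> nat \<Rightarrow> nat \<Rightarrow> real"
  assumes X: "\<And>a b c d. a + b \<le> k \<Longrightarrow> c + d \<le> k \<Longrightarrow>
      real a * \<beta> (a - 1) b c d = - (real c * \<beta> a b (c - 1) d)"
    and Y: "\<And>a b c d. a + b \<le> k \<Longrightarrow> c + d \<le> k \<Longrightarrow>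
      real b * \<beta> a (b - 1) c d = - (real d * \<beta> a b c (d - 1))"
  shows "a + b < k \<Longrightarrow> c + d \<le> k \<Longrightarrow> \<beta> a b c d = 0"
proof (induction c arbitrary: a b d)
  case 0
  \<comment> \<open>The strict bound a + b < k leaves room to raise a by one; with c = 0 the
    right-hand side of \<open>X\<close> vanishes.\<close>
  then show ?case using X[of "Suc a" b 0 d] by simp
next
  case (Suc c)
  have shift: "real (Suc a) * \<beta> a b (Suc c) d = - (real (Suc c) * \<beta> (Suc a) b c d)"
    using X[of "Suc a" b "Suc c" d] Suc.prems by simp
  have "real (Suc d) * \<beta> (Suc a) b c d = - (real b * \<beta> (Suc a) (b - 1) c (Suc d))"
    using Y[of "Suc a" b c "Suc d"] Suc.prems by simp
  also have "real b * \<beta> (Suc a) (b - 1) c (Suc d) = 0"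
    using Suc.IH[of "Suc a" "b - 1" "Suc d"] Suc.prems by (cases b) auto
  finally have "\<beta> (Suc a) b c d = 0" by (simp del: of_nat_Suc)
  then show ?case using shift by (simp del: of_nat_Suc)
qed

section \<open>The extended-range conditions\<close>

text \<open>Position of the mode (k, 4 - k) in \<open>modes\<close>, one less than the indices 5, 9,
  12, 14, 15 of the theorem.\<close>

definition top_index :: "nat \<Rightarrow> nat" where
  "top_index k = [4, 8, 11, 13, 14] ! k"

definition top_supported :: "real mat \<Rightarrow> bool" where
  "top_supported Q \<longleftrightarrow> (\<forall>i<15. \<forall>j<15. mode_degree i \<le> 3 \<or> mode_degree j \<le> 3 \<longrightarrow> Q $$ (i, j) = 0)"

lemma less_5_iff: "k < 5 \<longleftrightarrow> k = 0 \<or> k = 1 \<or> k = 2 \<or> k = 3 \<or> k = (4::nat)"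
  by auto

lemma all_less_5: "(\<forall>k<5. P k) \<longleftrightarrow> P 0 \<and> P 1 \<and> P 2 \<and> P 3 \<and> P (4::nat)"
  unfolding less_5_iff by blast

lemma sum_less_5: "(\<Sum>k<5. f k) = f 0 + f 1 + f 2 + f 3 + f (4::nat)"
  by (simp add: lessThan_nat_numeral lessThan_Suc add_ac)

lemma modes_top: "k < 5 \<Longrightarrow> modes ! top_index k = (k, 4 - k)"
  unfolding less_5_iff by (elim disjE) (simp_all add: top_index_def modes_def)

lemma top_index_less: "k < 5 \<Longrightarrow> top_index k < 15"
  unfolding less_5_iff by (elim disjE) (simp_all add: top_index_def)

lemma inj_top_index: "inj_on top_index {..<5}"
proof (rule inj_onI)
  fix k l assume kl: "k \<in> {..<5}" "l \<in> {..<5}" and eq: "top_index k = top_index l"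
  have "modes ! top_index k = (k, 4 - k)" "modes ! top_index l = (l, 4 - l)"
    using kl by (simp_all add: modes_top)
  then show "k = l" unfolding eq by simp
qed

lemma mode_degree_top: "k < 5 \<Longrightarrow> mode_degree (top_index k) = 4"
  by (simp add: modes_top)

lemma top_mode_iff:
  assumes "i < 15"
  shows "mode_degree i > 3 \<longleftrightarrow> (\<exists>k<5. i = top_index k)"
proof
  assume deg: "mode_degree i > 3"
  have len: "i < length modes" using assms by (simp add: length_modes)
  define v where "v = fst (modes ! i)"
  have "mode_degree i = 4" using deg mode_degree_le[OF assms] by simp
  then have v: "v < 5" "modes ! i = (v, 4 - v)"
    by (auto simp: v_def prod_eq_iff)
  then have "modes ! i = modes ! top_index v" by (simp add: modes_top)
  moreover have "distinct modes" by (simp add: modes_def)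
  ultimately have "i = top_index v"
    using len top_index_less[OF v(1)] by (simp add: nth_eq_iff_index_eq length_modes)
  then show "\<exists>k<5. i = top_index k" using v(1) by auto
qed (use mode_degree_top in auto)

lemma top_modes_eq: "{i \<in> {..<15}. mode_degree i > 3} = top_index ` {..<5}"
  using top_mode_iff top_index_less by fastforce

lemma sum_top:
  fixes f :: "nat \<Rightarrow> real"
  assumes "\<And>i. i < 15 \<Longrightarrow> mode_degree i \<le> 3 \<Longrightarrow> f i = 0"
  shows "(\<Sum>i<15. f i) = (\<Sum>k<5. f (top_index k))"
proof -
  have "(\<Sum>i<15. f i) = (\<Sum>i\<in>top_index ` {..<5}. f i)"
    unfolding top_modes_eq[symmetric]
  proof (rule sum.mono_neutral_right)
    show "\<forall>i\<in>{..<15} - {i \<in> {..<15}. mode_degree i > 3}. f i = 0"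
    proof
      fix i assume "i \<in> {..<15} - {i \<in> {..<15}. mode_degree i > 3}"
      then have "i < 15" "mode_degree i \<le> 3" by auto
      then show "f i = 0" by (rule assms)
    qed
  qed auto
  then show ?thesis by (simp add: sum.reindex inj_top_index)
qed

lemma mat_mult_entry:
  assumes "A \<in> carrier_mat 15 15" "B \<in> carrier_mat 15 15" "i < 15" "j < 15"
  shows "(A * B) $$ (i, j) = (\<Sum>l<15. A $$ (i, l) * B $$ (l, j) :: real)"
  using assms by (simp add: scalar_prod_def atLeast0LessThan)

text \<open>Sandwiching (E2) between \<open>u\<close> and \<open>v\<close> exhibits it as
  skew-adjointness of \<open>D\<close> for the bilinear form of \<open>Q\<close>.\<close>

lemma skew_form:
  fixes Q D :: "real mat"
  assumes Q: "Q \<in> carrier_mat n n" "transpose_mat Q = Q" and D: "D \<in> carrier_mat n n"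
    and skew: "Q * D + transpose_mat D * transpose_mat Q = 0\<^sub>m n n"
    and u: "u \<in> carrier_vec n" and v: "v \<in> carrier_vec n"
  shows "scalar_prod (D *\<^sub>v u) (Q *\<^sub>v v) = - scalar_prod u (Q *\<^sub>v (D *\<^sub>v v))"
proof -
  have c: "Q *\<^sub>v v \<in> carrier_vec n" "D *\<^sub>v v \<in> carrier_vec n" "Q *\<^sub>v (D *\<^sub>v v) \<in> carrier_vec n"
    "D *\<^sub>v u \<in> carrier_vec n" "transpose_mat D *\<^sub>v (Q *\<^sub>v v) \<in> carrier_vec n"
    using Q D u v by auto
  have "0\<^sub>m n n *\<^sub>v v = 0\<^sub>v n" using v by (intro eq_vecI) auto
  then have "0 = scalar_prod u (0\<^sub>m n n *\<^sub>v v)" using u by simp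
  also have "0\<^sub>m n n *\<^sub>v v = Q *\<^sub>v (D *\<^sub>v v) + transpose_mat D *\<^sub>v (Q *\<^sub>v v)"
    unfolding skew[symmetric] Q(2) using Q(1) D v
    by (subst add_mult_distrib_mat_vec[of _ n n]) (auto simp: assoc_mult_mat_vec[of _ n n _ n])
  also have "scalar_prod u \<dots> = scalar_prod u (Q *\<^sub>v (D *\<^sub>v v)) + scalar_prod u (transpose_mat D *\<^sub>v (Q *\<^sub>v v))"
    by (rule scalar_prod_add_distrib[OF u c(3) c(5)])
  also have "scalar_prod u (transpose_mat D *\<^sub>v (Q *\<^sub>v v)) = scalar_prod (transpose_mat D *\<^sub>v (Q *\<^sub>v v)) u"
    by (rule comm_scalar_prod[OF u c(5)])
  also have "\<dots> = scalar_prod (Q *\<^sub>v v) (D *\<^sub>v u)"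
    by (rule transpose_vec_mult_scalar[OF D u c(1)])
  also have "\<dots> = scalar_prod (D *\<^sub>v u) (Q *\<^sub>v v)"
    by (rule comm_scalar_prod[OF c(1) c(4)])
  finally show ?thesis by linarith
qed

lemma Dx_carrier: "Dx_mat 4 \<in> carrier_mat 15 15" and Dy_carrier: "Dy_mat 4 \<in> carrier_mat 15 15"
  unfolding Dx_mat_def Dy_mat_def by (rule Dx.carrier Dy.carrier)+

lemma skew_imp_top_supported:
  assumes Q: "Q \<in> carrier_mat 15 15" "transpose_mat Q = Q"
    and Dx: "Q * Dx_mat 4 + transpose_mat (Dx_mat 4) * transpose_mat Q = 0\<^sub>m 15 15"
    and Dy: "Q * Dy_mat 4 + transpose_mat (Dy_mat 4) * transpose_mat Q = 0\<^sub>m 15 15"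
  shows "top_supported Q"
proof -
  define \<beta> where "\<beta> a b c d = scalar_prod (monomial_coords a b) (Q *\<^sub>v monomial_coords c d)" for a b c d
  have mc: "monomial_coords a b \<in> carrier_vec 15" "Q *\<^sub>v monomial_coords a b \<in> carrier_vec 15"
    if "a + b \<le> 4" for a b
    using monomial_coords_carrier[OF that] Q(1) by auto
  have X: "real a * \<beta> (a - 1) b c d = - (real c * \<beta> a b (c - 1) d)" if "a + b \<le> 4" "c + d \<le> 4" for a b c d
  proof -
    have "(a - 1) + b \<le> 4" "(c - 1) + d \<le> 4" using that by auto
    note mcs = mc[OF that(1)] mc[OF that(2)] mc[OF this(1)] mc[OF this(2)]
    have "scalar_prod (real a \<cdot>\<^sub>v monomial_coords (a - 1) b) (Q *\<^sub>v monomial_coords c d)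
        = - scalar_prod (monomial_coords a b) (Q *\<^sub>v (real c \<cdot>\<^sub>v monomial_coords (c - 1) d))"
      using skew_form[OF Q Dx_carrier Dx mcs(1) mcs(3)] by (simp add: Dx_monomial that)
    then show ?thesis
      unfolding \<beta>_def using mcs Q(1)
      by (simp add: mult_mat_vec[OF Q(1)] del: mult_mat_vec_carrier)
  qed
  have Y: "real b * \<beta> a (b - 1) c d = - (real d * \<beta> a b c (d - 1))" if "a + b \<le> 4" "c + d \<le> 4" for a b c d
  proof -
    have "a + (b - 1) \<le> 4" "c + (d - 1) \<le> 4" using that by auto
    note mcs = mc[OF that(1)] mc[OF that(2)] mc[OF this(1)] mc[OF this(2)]
    have "scalar_prod ((- (real b / sqrt 3)) \<cdot>\<^sub>v monomial_coords a (b - 1)) (Q *\<^sub>v monomial_coords c d)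
        = - scalar_prod (monomial_coords a b) (Q *\<^sub>v ((- (real d / sqrt 3)) \<cdot>\<^sub>v monomial_coords c (d - 1)))"
      using skew_form[OF Q Dy_carrier Dy mcs(1) mcs(3)] by (simp add: Dy_monomial that)
    then have "- (real b / sqrt 3) * \<beta> a (b - 1) c d = real d / sqrt 3 * \<beta> a b c (d - 1)"
      unfolding \<beta>_def using mcs Q(1)
      by (simp add: mult_mat_vec[OF Q(1)] del: mult_mat_vec_carrier)
    \<comment> \<open>The factor 1 / sqrt 3 from dt/dy is common to both sides; cancelling it gives
      the same relation as for x.\<close>
    then show ?thesis by (simp add: field_simps)
  qed
  have form0: "\<beta> a b c d = 0" if "a + b \<le> 3" "c + d \<le> 4" for a b c d
    using skew_shift_vanishes[where \<beta> = \<beta> and k = 4, OF X Y] that by simp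
  \<comment> \<open>Two passes from monomials to modes: entry i of \<open>Q\<close> times any
    monomial vanishes because mode i has degree at most 3; then row i is orthogonal to all monomials
    of degree at most 4 and must be zero.\<close>
  have row0: "Q $$ (i, j) = 0" if i: "i < 15" "mode_degree i \<le> 3" and j: "j < 15" for i j
  proof -
    have "scalar_prod (row Q i) (monomial_coords c d) = 0" if "c + d \<le> 4" for c d
    proof -
      have "(Q *\<^sub>v monomial_coords c d) $ i = 0"
      proof (rule orthogonal_low_modes[OF mc(2)[OF that] _ _ i])
        fix a b :: nat assume ab: "a + b \<le> 3"
        then have "scalar_prod (Q *\<^sub>v monomial_coords c d) (monomial_coords a b) = \<beta> a b c d"
          unfolding \<beta>_def by (intro comm_scalar_prod[OF mc(2)[OF that] mc(1)]) simp
        then show "scalar_prod (Q *\<^sub>v monomial_coords c d) (monomial_coords a b) = 0"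
          using form0 ab that by simp
      qed simp
      then show ?thesis using Q(1) i(1) by simp
    qed
    then have "row Q i $ j = 0"
      using orthogonal_low_modes[of "row Q i" 4 j] Q(1) i(1) j mode_degree_le[OF j] by auto
    then show ?thesis using Q(1) i(1) j by simp
  qed
  have "Q $$ (i, j) = Q $$ (j, i)" if "i < 15" "j < 15" for i j
    using that Q by (metis carrier_matD index_transpose_mat(1))
  then show ?thesis unfolding top_supported_def using row0 by metis
qed

text \<open>Already Q D = 0: in each product over an inner index l, either l is a low mode and
  column l of \<open>Q\<close> is zero, or l is a top mode and row l of \<open>D\<close> is
  zero.\<close>

lemma top_supported_imp_skew:
  assumes Q: "Q \<in> carrier_mat 15 15" and top: "top_supported Q" and D: "D \<in> carrier_mat 15 15"
    and rows: "\<And>i j. i < 15 \<Longrightarrow> mode_degree i > 3 \<Longrightarrow> j < 15 \<Longrightarrow> D $$ (i, j) = 0"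
  shows "Q * D + transpose_mat D * transpose_mat Q = 0\<^sub>m 15 15"
proof -
  have "Q * D = 0\<^sub>m 15 15"
  proof (rule eq_matI)
    fix i j assume ij: "i < dim_row (0\<^sub>m 15 15 :: real mat)" "j < dim_col (0\<^sub>m 15 15 :: real mat)"
    have "Q $$ (i, l) * D $$ (l, j) = 0" if "l < 15" for l
      using that ij top rows[of l j] by (cases "mode_degree l > 3") (auto simp: top_supported_def)
    then show "(Q * D) $$ (i, j) = 0\<^sub>m 15 15 $$ (i, j)"
      using ij by (simp add: mat_mult_entry[OF Q D] sum.neutral del: index_mult_mat mult_eq_0_iff)
  qed (use Q D in auto)
  moreover from this have "transpose_mat D * transpose_mat Q = 0\<^sub>m 15 15"
    using transpose_mult[OF Q D] by (metis zero_transpose_mat)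
  ultimately show ?thesis by simp
qed

text \<open>\<open>Q\<close> lives on the top block and \<open>R\<close> is block diagonal, so both
  products vanish off that block and sums over 15 indices shrink to sums over 5.\<close>

lemma commute_top_iff:
  assumes Q: "Q \<in> carrier_mat 15 15" and top: "top_supported Q" and R: "R \<in> carrier_mat 15 15"
    and block: "\<And>i j. i < 15 \<Longrightarrow> j < 15 \<Longrightarrow> (mode_degree i > 3) \<noteq> (mode_degree j > 3) \<Longrightarrow> R $$ (i, j) = 0"
  shows "Q * R = R * Q \<longleftrightarrow> (\<forall>i<5. \<forall>j<5.
     (\<Sum>l<5. Q $$ (top_index i, top_index l) * R $$ (top_index l, top_index j))
     = (\<Sum>l<5. R $$ (top_index i, top_index l) * Q $$ (top_index l, top_index j)))"
proof -
  have QR: "(Q * R) $$ (i, j) = (\<Sum>l<5. Q $$ (i, top_index l) * R $$ (top_index l, j))" if "i < 15" "j < 15" for i j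
    unfolding mat_mult_entry[OF Q R that]
    by (rule sum_top) (use top that in \<open>auto simp: top_supported_def\<close>)
  have RQ: "(R * Q) $$ (i, j) = (\<Sum>l<5. R $$ (i, top_index l) * Q $$ (top_index l, j))" if "i < 15" "j < 15" for i j
    unfolding mat_mult_entry[OF R Q that]
    by (rule sum_top) (use top that in \<open>auto simp: top_supported_def\<close>)
  have low: "(Q * R) $$ (i, j) = 0 \<and> (R * Q) $$ (i, j) = 0"
    if ij: "i < 15" "j < 15" "mode_degree i \<le> 3 \<or> mode_degree j \<le> 3" for i j
  proof -
    have "Q $$ (i, top_index l) * R $$ (top_index l, j) = 0 \<and> R $$ (i, top_index l) * Q $$ (top_index l, j) = 0"
      if "l < 5" for l
    proof (cases "mode_degree i \<le> 3")
      case True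
      then have "Q $$ (i, top_index l) = 0" "R $$ (i, top_index l) = 0"
        using top block[of i "top_index l"] ij that top_index_less[OF that] mode_degree_top[OF that]
        by (auto simp: top_supported_def)
      then show ?thesis by simp
    next
      case False
      then have "Q $$ (top_index l, j) = 0" "R $$ (top_index l, j) = 0"
        using top block[of "top_index l" j] ij that top_index_less[OF that] mode_degree_top[OF that]
        by (auto simp: top_supported_def)
      then show ?thesis by simp
    qed
    then show ?thesis
      unfolding QR[OF ij(1,2)] RQ[OF ij(1,2)] by (simp add: sum.neutral del: mult_eq_0_iff)
  qed
  have "Q * R = R * Q \<longleftrightarrow> (\<forall>i<15. \<forall>j<15. (Q * R) $$ (i, j) = (R * Q) $$ (i, j))"
    using Q R by (auto intro!: eq_matI simp del: index_mult_mat(1))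
  also have "\<dots> \<longleftrightarrow> (\<forall>i<5. \<forall>j<5. (Q * R) $$ (top_index i, top_index j) = (R * Q) $$ (top_index i, top_index j))"
  proof (intro iffI allI impI)
    fix i j :: nat assume "\<forall>i<15. \<forall>j<15. (Q * R) $$ (i, j) = (R * Q) $$ (i, j)" "i < 5" "j < 5"
    then show "(Q * R) $$ (top_index i, top_index j) = (R * Q) $$ (top_index i, top_index j)"
      using top_index_less by blast
  next
    fix i j :: nat
    assume *: "\<forall>i<5. \<forall>j<5. (Q * R) $$ (top_index i, top_index j) = (R * Q) $$ (top_index i, top_index j)"
      and ij: "i < 15" "j < 15"
    show "(Q * R) $$ (i, j) = (R * Q) $$ (i, j)"
    proof (cases "mode_degree i \<le> 3 \<or> mode_degree j \<le> 3")
      case True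
      then show ?thesis using low[OF ij] by simp
    next
      case False
      then obtain k l where "k < 5" "i = top_index k" "l < 5" "j = top_index l"
        using top_mode_iff[OF ij(1)] top_mode_iff[OF ij(2)] by (auto simp: not_le)
      then show ?thesis using * by blast
    qed
  qed
  also have "\<dots> \<longleftrightarrow> (\<forall>i<5. \<forall>j<5.
     (\<Sum>l<5. Q $$ (top_index i, top_index l) * R $$ (top_index l, top_index j))
     = (\<Sum>l<5. R $$ (top_index i, top_index l) * Q $$ (top_index l, top_index j)))"
    using QR RQ top_index_less by auto
  finally show ?thesis .
qed

section \<open>Rotation and reflection on the degree-four modes\<close>

definition top_poly :: "nat \<Rightarrow> real \<times> real \<Rightarrow> real" where
  "top_poly k = mode_poly k (4 - k)"

definition top_norm :: "nat \<Rightarrow> real" where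
  "top_norm k = mode_norm k (4 - k)"

text \<open>The list with index \<open>k\<close> expands the rotated polynomial \<open>top_poly k\<close> in \<open>top_poly 0\<close>, \<open>top_poly 1\<close>,
  and so on; no mode of lower degree occurs because the rotation is an isometry.\<close>

definition rotation_coeff :: "nat \<Rightarrow> nat \<Rightarrow> real" where
  "rotation_coeff l k = [[1/5, -3/5, 1, -7/5, 9/5],
                         [1/5, -1/2, 1/2, 0, -6/5],
                         [1/5, -3/10, -3/14, 4/5, 18/35],
                         [1/5, 0, -4/7, -1/2, -9/70],
                         [1/5, 2/5, 2/7, 1/10, 1/70]] ! k ! l"

lemma top_poly_explicit:
  "top_poly 0 (x, y) = 5 - 60 * tcoord y + 210 * tcoord y ^ 2 - 280 * tcoord y ^ 3 + 126 * tcoord y ^ 4"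
  "top_poly 1 (x, y) = x * (20 - 105 * tcoord y + 168 * tcoord y ^ 2 - 84 * tcoord y ^ 3)"
  "top_poly 2 (x, y) = (3 * x^2 - tcoord y ^ 2) / 2 * (21 - 56 * tcoord y + 36 * tcoord y ^ 2)"
  "top_poly 3 (x, y) = (5 * x^3 - 3 * x * tcoord y ^ 2) / 2 * (8 - 9 * tcoord y)"
  "top_poly 4 (x, y) = (35 * x^4 - 30 * x^2 * tcoord y ^ 2 + 3 * tcoord y ^ 4) / 8"
  by (simp_all add: top_poly_def mode_poly_def homogeneous_legendre_explicit shifted_jacobi_explicit
        algebra_simps power2_eq_square power3_eq_cube power4_eq_xxxx)

lemma top_poly_rotation:
  assumes "k < 5"
  shows "top_poly k (rotation3 p) = (\<Sum>l<5. rotation_coeff l k * top_poly l p)"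
proof (cases p)
  case (Pair x y)
  show ?thesis
    using assms unfolding Pair rotation3_eq sum_less_5 less_5_iff
    by (elim disjE; simp only: top_poly_explicit tcoord_rotation3;
        simp add: rotation_coeff_def field_simps power2_eq_square power3_eq_cube power4_eq_xxxx)
qed

lemma dubiner_top_interior:
  assumes "k < 5" "p \<in> interior ref_triangle"
  shows "dubiner 4 (Suc (top_index k)) p = top_norm k * top_poly k p"
  using dubiner_interior[OF top_index_less[OF assms(1)] assms(2)]
  by (simp add: modes_top assms(1) top_norm_def top_poly_def)

lemma top_norm_pos: "top_norm k > 0"
  by (simp add: top_norm_def mode_norm_pos)

text \<open>\<open>rotation_coeff\<close> refers to unnormalised polynomials, so orthonormal modes
  bring in a quotient of norms. Low rows are included: no index matches there and the sum is
  0.\<close>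

lemma rotation_top_column:
  assumes "k < 5" "i < 15"
  shows "rotation_mat 4 $$ (i, top_index k)
    = (\<Sum>l<5. if i = top_index l then rotation_coeff l k * (top_norm k / top_norm l) else 0)"
proof -
  let ?c = "vec 15 (\<lambda>i. \<Sum>l<5. if i = top_index l then rotation_coeff l k * (top_norm k / top_norm l) else 0)"
  have "is_coords ?c (dubiner 4 (Suc (top_index k)) \<circ> rotation3)"
    unfolding is_coords_def
  proof (intro conjI ballI)
    fix p assume p: "p \<in> interior ref_triangle"
    have "(\<Sum>i<15. ?c $ i * dubiner 4 (Suc i) p)
        = (\<Sum>i<15. \<Sum>l<5. if i = top_index l then rotation_coeff l k * (top_norm k / top_norm l) * dubiner 4 (Suc i) p else 0)"
      by (simp add: sum_distrib_right if_distrib[of "\<lambda>x. x * _"] cong: if_cong)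
    also have "\<dots> = (\<Sum>l<5. \<Sum>i<15. if i = top_index l then rotation_coeff l k * (top_norm k / top_norm l) * dubiner 4 (Suc i) p else 0)"
      by (rule sum.swap)
    also have "\<dots> = (\<Sum>l<5. rotation_coeff l k * (top_norm k / top_norm l) * dubiner 4 (Suc (top_index l)) p)"
      by (rule sum.cong) (simp_all add: top_index_less)
    also have "\<dots> = (\<Sum>l<5. top_norm k * (rotation_coeff l k * top_poly l p))"
      using top_norm_pos by (intro sum.cong) (auto simp: dubiner_top_interior p less_imp_neq[symmetric])
    also have "\<dots> = (dubiner 4 (Suc (top_index k)) \<circ> rotation3) p"
      by (simp add: dubiner_top_interior rotation3_interior p assms(1) top_poly_rotation sum_distrib_left)
    finally show "(dubiner 4 (Suc (top_index k)) \<circ> rotation3) p = (\<Sum>i<15. ?c $ i * dubiner 4 (Suc i) p)"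
      by simp
  qed simp
  from is_coords_unique[OF rotation.column[OF top_index_less[OF assms(1)]] this]
  have "col (modal_matrix 4 (\<lambda>f. f \<circ> rotation3)) (top_index k) $ i = ?c $ i" by simp
  then show ?thesis
    using rotation.carrier assms top_index_less[OF assms(1)] by (simp add: rotation_mat_def)
qed

lemma rotation_top_entry:
  assumes "k < 5" "l < 5"
  shows "rotation_mat 4 $$ (top_index l, top_index k) = rotation_coeff l k * (top_norm k / top_norm l)"
proof -
  have "(\<Sum>m<5. if top_index l = top_index m then rotation_coeff m k * (top_norm k / top_norm m) else 0)
     = (\<Sum>m<5. if m = l then rotation_coeff m k * (top_norm k / top_norm m) else 0)"
    using inj_top_index assms by (intro sum.cong) (auto simp: inj_on_def)
  then show ?thesis
    using rotation_top_column[OF assms(1) top_index_less[OF assms(2)]] assms by simp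
qed

text \<open>The two off-diagonal blocks vanish for different reasons: a rotated top mode is an
  explicit combination of top modes, whereas a rotated low mode keeps degree at most 3.\<close>

lemma rotation_block:
  assumes i: "i < 15" and j: "j < 15" and ij: "(mode_degree i > 3) \<noteq> (mode_degree j > 3)"
  shows "rotation_mat 4 $$ (i, j) = 0"
proof (cases "mode_degree j > 3")
  case True
  then obtain k where k: "k < 5" "j = top_index k" using top_mode_iff[OF j] by blast
  have "i \<noteq> top_index l" if "l < 5" for l using that mode_degree_top ij True by auto
  then show ?thesis using rotation_top_column[OF k(1) i] k(2) by simp
next
  case False
  then have le: "mode_degree j \<le> 3" by simp
  have "polys 3 (\<lambda>p. nth_norm j * nth_poly j (rotation3 p))"
    by (rule polys.scale, rule polys_compose[OF _ rotation_affine], rule polys_le[OF polys_mode_poly le])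
  then obtain c where c: "is_coords c (\<lambda>p. nth_norm j * nth_poly j (rotation3 p))"
      "\<forall>i<15. mode_degree i > 3 \<longrightarrow> c $ i = 0"
    using polys_coords[of 3] by auto
  have "col (modal_matrix 4 (\<lambda>f. f \<circ> rotation3)) j = c"
    by (rule is_coords_unique[OF rotation.column[OF j] c(1)])
       (simp add: dubiner_interior j rotation3_interior)
  then have "col (modal_matrix 4 (\<lambda>f. f \<circ> rotation3)) j $ i = 0" using c(2) i ij False by auto
  then show ?thesis using rotation.carrier i j by (simp add: rotation_mat_def)
qed

lemma homogeneous_legendre_minus:
  assumes "v \<le> 4"
  shows "homogeneous_legendre v (- x) t = (-1) ^ v * homogeneous_legendre v x t"
proof -
  have "v = 0 \<or> v = Suc 0 \<or> v = 2 \<or> v = 3 \<or> v = 4" using assms by linarith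
  then show ?thesis by (elim disjE) (simp_all add: homogeneous_legendre_explicit field_simps)
qed

lemma reflection_entry:
  assumes i: "i < 15" and j: "j < 15"
  shows "reflection_mat 4 $$ (i, j) = (if i = j then (-1) ^ fst (modes ! j) else 0)"
proof -
  let ?s = "(-1) ^ fst (modes ! j) :: real"
  have v: "fst (modes ! j) \<le> 4" using mode_degree_le[OF j] by simp
  have "is_coords (?s \<cdot>\<^sub>v unit_vec 15 j) (dubiner 4 (Suc j) \<circ> reflection_x)"
  proof (rule is_coords_cong[OF is_coords_scale[OF is_coords_unit[OF j]]])
    fix p assume p: "p \<in> interior ref_triangle"
    obtain x y where xy: "p = (x, y)" by (cases p)
    have "nth_poly j (reflection_x p) = ?s * nth_poly j p"
      unfolding xy reflection_x_def mode_poly_def prod.case homogeneous_legendre_minus[OF v] by simp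
    then show "?s * dubiner 4 (Suc j) p = (dubiner 4 (Suc j) \<circ> reflection_x) p"
      using p j by (simp add: dubiner_interior reflection_x_interior)
  qed
  from is_coords_unique[OF reflection.column[OF j] this]
  have "col (modal_matrix 4 (\<lambda>f. f \<circ> reflection_x)) j $ i = (?s \<cdot>\<^sub>v unit_vec 15 j) $ i" by simp
  then show ?thesis
    using reflection.carrier i j by (simp add: reflection_mat_def)
qed

lemma extended_range_conditions_iff:
  assumes Q: "Q \<in> carrier_mat 15 15"
  shows "extended_range_conditions 4 Q \<longleftrightarrow> transpose_mat Q = Q \<and> top_supported Q \<and>
    (\<forall>i<5. \<forall>j<5. (\<Sum>l<5. Q $$ (top_index i, top_index l) * (rotation_coeff l j * (top_norm j / top_norm l)))
       = (\<Sum>l<5. rotation_coeff i l * (top_norm l / top_norm i) * Q $$ (top_index l, top_index j))) \<and>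
    (\<forall>i<5. \<forall>j<5. odd (i + j) \<longrightarrow> Q $$ (top_index i, top_index j) = 0)"
proof -
  have rot: "Q * rotation_mat 4 = rotation_mat 4 * Q \<longleftrightarrow>
    (\<forall>i<5. \<forall>j<5. (\<Sum>l<5. Q $$ (top_index i, top_index l) * (rotation_coeff l j * (top_norm j / top_norm l)))
       = (\<Sum>l<5. rotation_coeff i l * (top_norm l / top_norm i) * Q $$ (top_index l, top_index j)))"
    if "top_supported Q"
    by (subst commute_top_iff[OF Q that _ rotation_block])
       (use rotation.carrier in \<open>simp_all add: rotation_mat_def[symmetric] rotation_top_entry\<close>)
  have refl: "Q * reflection_mat 4 = reflection_mat 4 * Q \<longleftrightarrow>
    (\<forall>i<5. \<forall>j<5. odd (i + j) \<longrightarrow> Q $$ (top_index i, top_index j) = 0)"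
    if "top_supported Q"
  proof -
    have entry: "reflection_mat 4 $$ (top_index i, top_index j) = (if i = j then (-1) ^ j else 0)"
      if "i < 5" "j < 5" for i j
      using that inj_top_index by (simp add: reflection_entry top_index_less modes_top inj_on_eq_iff)
    have "Q * reflection_mat 4 = reflection_mat 4 * Q \<longleftrightarrow> (\<forall>i<5. \<forall>j<5.
       (\<Sum>l<5. Q $$ (top_index i, top_index l) * (if l = j then (-1) ^ j else 0))
       = (\<Sum>l<5. (if i = l then (-1) ^ l else 0) * Q $$ (top_index l, top_index j)))"
      by (subst commute_top_iff[OF Q that])
         (use reflection.carrier in \<open>auto simp: reflection_mat_def[symmetric] entry reflection_entry\<close>)
    also have "\<dots> \<longleftrightarrow> (\<forall>i<5. \<forall>j<5.
        Q $$ (top_index i, top_index j) * (-1) ^ j = (-1) ^ i * Q $$ (top_index i, top_index j))"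
      by (simp add: if_distrib[of "\<lambda>x. x * _"] if_distrib[of "\<lambda>x. _ * x"] cong: if_cong)
    also have "\<dots> \<longleftrightarrow> (\<forall>i<5. \<forall>j<5. odd (i + j) \<longrightarrow> Q $$ (top_index i, top_index j) = 0)"
      by (intro all_cong) (auto simp: minus_one_power_iff)
    finally show ?thesis .
  qed
  have skew: "(Q * Dx_mat 4 + transpose_mat (Dx_mat 4) * transpose_mat Q = 0\<^sub>m 15 15 \<and>
     Q * Dy_mat 4 + transpose_mat (Dy_mat 4) * transpose_mat Q = 0\<^sub>m 15 15) \<longleftrightarrow> top_supported Q"
    if "transpose_mat Q = Q"
    using skew_imp_top_supported[OF Q that]
      top_supported_imp_skew[OF Q _ Dx_carrier derivative_top_rows(1)]
      top_supported_imp_skew[OF Q _ Dy_carrier derivative_top_rows(2)] by blast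
  show ?thesis
  \<comment> \<open>The equivalences \<open>rot\<close> and \<open>refl\<close> presuppose support
    on the top block, which (E1) and (E2) supply on either side.\<close>
  proof (cases "transpose_mat Q = Q \<and> top_supported Q")
    case True
    then have "Q * Dx_mat 4 + transpose_mat (Dx_mat 4) * transpose_mat Q = 0\<^sub>m 15 15"
      "Q * Dy_mat 4 + transpose_mat (Dy_mat 4) * transpose_mat Q = 0\<^sub>m 15 15"
      using skew by blast+
    with True show ?thesis
      unfolding extended_range_conditions_def num_modes_4
      by (simp only: Q rot refl simp_thms)
  next
    case False
    moreover have "extended_range_conditions 4 Q \<Longrightarrow> transpose_mat Q = Q"
      "extended_range_conditions 4 Q \<Longrightarrow> transpose_mat Q = Q \<Longrightarrow> top_supported Q"
      unfolding extended_range_conditions_def num_modes_4 using skew by auto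
    ultimately show ?thesis by argo
  qed
qed

section \<open>The commutation relation in rational form\<close>

lemma top_norm_eq: "k < 5 \<Longrightarrow> top_norm k = sqrt ((2 * real k + 1) * 5) / 3 powr (1 / 4)"
  by (simp add: top_norm_def mode_norm_def of_nat_diff)

text \<open>Rationalising the denominator leaves the root of a product of two of the numbers 1, 3,
  5, 7, 9. For indices of equal parity the only irrational roots left are those of 5, 21 and 45 = 9
  * 5.\<close>

lemma top_norm_ratio:
  assumes "k < 5" "l < 5"
  shows "top_norm k / top_norm l = sqrt ((2 * real k + 1) * (2 * real l + 1)) / (2 * real l + 1)"
proof -
  have cancel: "x * a / p / (y * a / p) = x * inverse y" if "a \<noteq> 0" "p \<noteq> 0" for x y a p :: real
    using that by (simp add: divide_simps)
  have "sqrt 5 \<noteq> 0" "(3::real) powr (1 / 4) \<noteq> 0" by simp_all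
  then have "top_norm k / top_norm l = sqrt (2 * real k + 1) * inverse (sqrt (2 * real l + 1))"
    unfolding top_norm_eq[OF assms(1)] top_norm_eq[OF assms(2)] real_sqrt_mult by (rule cancel)
  also have "inverse (sqrt (2 * real l + 1)) = sqrt (2 * real l + 1) / (2 * real l + 1)"
    by (rule sqrt_divide_self_eq[symmetric]) simp
  finally show ?thesis by (simp only: real_sqrt_mult times_divide_eq_right)
qed

text \<open>Conjugating by the diagonal of the norms makes the commutation relation rational.\<close>

lemma commute_rescale:
  fixes n :: "nat \<Rightarrow> real"
  assumes n: "\<And>k. n k > 0"
  shows "(\<Sum>l\<in>S. a l * (r l j * (n j / n l))) = (\<Sum>l\<in>S. r' i l * (n l / n i) * b l)
    \<longleftrightarrow> (\<Sum>l\<in>S. (n i / n l * a l) * r l j) = (\<Sum>l\<in>S. r' i l * (n l / n j * b l))"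
proof -
  have nz: "n k \<noteq> 0" for k using n[of k] by simp
  have left: "(\<Sum>l\<in>S. (n i / n l * a l) * r l j) = n i / n j * (\<Sum>l\<in>S. a l * (r l j * (n j / n l)))"
    unfolding sum_distrib_left by (rule sum.cong) (simp_all add: nz)
  have right: "(\<Sum>l\<in>S. r' i l * (n l / n j * b l)) = n i / n j * (\<Sum>l\<in>S. r' i l * (n l / n i) * b l)"
    unfolding sum_distrib_left by (rule sum.cong) (simp_all add: nz)
  have "n i / n j \<noteq> 0" by (simp add: nz)
  then show ?thesis unfolding left right mult_cancel_left by (simp only: simp_thms)
qed

lemma rotation_coeff_explicit:
  "rotation_coeff 0 0 = 1/5" "rotation_coeff 0 1 = 1/5" "rotation_coeff 0 2 = 1/5" "rotation_coeff 0 3 = 1/5" "rotation_coeff 0 4 = 1/5"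
  "rotation_coeff 1 0 = -3/5" "rotation_coeff 1 1 = -1/2" "rotation_coeff 1 2 = -3/10" "rotation_coeff 1 3 = 0" "rotation_coeff 1 4 = 2/5"
  "rotation_coeff 2 0 = 1" "rotation_coeff 2 1 = 1/2" "rotation_coeff 2 2 = -3/14" "rotation_coeff 2 3 = -4/7" "rotation_coeff 2 4 = 2/7"
  "rotation_coeff 3 0 = -7/5" "rotation_coeff 3 1 = 0" "rotation_coeff 3 2 = 4/5" "rotation_coeff 3 3 = -1/2" "rotation_coeff 3 4 = 1/10"
  "rotation_coeff 4 0 = 9/5" "rotation_coeff 4 1 = -6/5" "rotation_coeff 4 2 = 18/35" "rotation_coeff 4 3 = -9/70" "rotation_coeff 4 4 = 1/70"
  by (simp_all add: rotation_coeff_def)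

text \<open>H is the symmetric matrix of top entries conjugated by the norms: \<open>b\<close>,
  \<open>h\<close>, \<open>e\<close> stand for sqrt 5 times entry (0,2), sqrt 21 times entry (1,3)
  and sqrt 5 times entry (2,4). Nine unknowns with a four-dimensional solution space leave five
  independent equations. Positions (0,1) to (0,4) and (1,2) provide them; the others follow by
  substitution.\<close>

lemma rotation_commutant:
  fixes A b C D e F G h K :: real
  defines "H \<equiv> \<lambda>i j. [[A, 0, b / 5, 0, C / 3],
                      [0, G, 0, h / 7, 0],
                      [b, 0, D, 0, e / 3],
                      [0, h / 3, 0, K, 0],
                      [3 * C, 0, 3 * e / 5, 0, F]] ! i ! j"
  shows "(\<forall>i<5. \<forall>j<5. (\<Sum>l<5. H i l * rotation_coeff l j) = (\<Sum>l<5. rotation_coeff i l * H l j))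
    \<longleftrightarrow> A = (2 * h + 6 * G + 12 * C - 3 * b) / 6 \<and> K = (8 * h + 42 * G + 75 * C - 45 * b) / 42 \<and>
        F = (16 * h + 98 * G + 99 * C - 9 * b) / 98 \<and> D = (4 * h + 147 * G + 240 * C - 102 * b) / 147 \<and>
        e = (25 * h + 100 * C - 18 * b) / 49" (is "?L \<longleftrightarrow> ?R")
proof -
  have H: "H 0 0 = A" "H 0 1 = 0" "H 0 2 = b / 5" "H 0 3 = 0" "H 0 4 = C / 3"
    "H 1 0 = 0" "H 1 1 = G" "H 1 2 = 0" "H 1 3 = h / 7" "H 1 4 = 0"
    "H 2 0 = b" "H 2 1 = 0" "H 2 2 = D" "H 2 3 = 0" "H 2 4 = e / 3"
    "H 3 0 = 0" "H 3 1 = h / 3" "H 3 2 = 0" "H 3 3 = K" "H 3 4 = 0"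
    "H 4 0 = 3 * C" "H 4 1 = 0" "H 4 2 = 3 * e / 5" "H 4 3 = 0" "H 4 4 = F"
    by (simp_all add: H_def)
  show ?thesis
  proof
    assume L: ?L
    have row0: "(\<Sum>l<5. H 0 l * rotation_coeff l 1) = (\<Sum>l<5. rotation_coeff 0 l * H l 1)"
      "(\<Sum>l<5. H 0 l * rotation_coeff l 2) = (\<Sum>l<5. rotation_coeff 0 l * H l 2)"
      "(\<Sum>l<5. H 0 l * rotation_coeff l 3) = (\<Sum>l<5. rotation_coeff 0 l * H l 3)"
      "(\<Sum>l<5. H 0 l * rotation_coeff l 4) = (\<Sum>l<5. rotation_coeff 0 l * H l 4)"
      by (rule L[rule_format]; simp)+
    have row1: "(\<Sum>l<5. H 1 l * rotation_coeff l 2) = (\<Sum>l<5. rotation_coeff 1 l * H l 2)"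
      by (rule L[rule_format]) simp_all
    note rows = row0 row1
    have 1: "A / 5 + b / 10 - 2 * C / 5 - G / 5 - h / 15 = 0"
      using rows(1) unfolding sum_less_5 H rotation_coeff_explicit by (simp add: field_simps)
    have 2: "A / 5 - 29 * b / 350 + 6 * C / 35 - D / 5 - 3 * e / 25 = 0"
      using rows(2) unfolding sum_less_5 H rotation_coeff_explicit by (simp add: field_simps)
    have 3: "A / 5 - 4 * b / 35 - 3 * C / 70 - h / 35 - K / 5 = 0"
      using rows(3) unfolding sum_less_5 H rotation_coeff_explicit by (simp add: field_simps)
    have 4: "A / 5 + 2 * b / 35 - 13 * C / 210 - e / 15 - F / 5 = 0"
      using rows(4) unfolding sum_less_5 H rotation_coeff_explicit by (simp add: field_simps)
    have 5: "3 * b / 25 + 3 * D / 10 - 6 * e / 25 - 3 * G / 10 + 4 * h / 35 = 0"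
      using rows(5) unfolding sum_less_5 H rotation_coeff_explicit by (simp add: field_simps)
    have A: "6 * A = 2 * h + 6 * G + 12 * C - 3 * b" using 1 by linarith
    moreover have "42 * K = 8 * h + 42 * G + 75 * C - 45 * b" using 3 A by linarith
    moreover have e: "49 * e = 25 * h + 100 * C - 18 * b" using 1 2 5 by linarith
    moreover have "147 * D = 4 * h + 147 * G + 240 * C - 102 * b" using 2 A e by linarith
    moreover have "98 * F = 16 * h + 98 * G + 99 * C - 9 * b" using 4 A e by linarith
    ultimately show ?R by (simp add: eq_divide_eq mult.commute)
  next
    assume R: ?R
    note eqs = R[THEN conjunct1] R[THEN conjunct2, THEN conjunct1]
      R[THEN conjunct2, THEN conjunct2, THEN conjunct1]
      R[THEN conjunct2, THEN conjunct2, THEN conjunct2, THEN conjunct1]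
      R[THEN conjunct2, THEN conjunct2, THEN conjunct2, THEN conjunct2]
    show ?L
      unfolding all_less_5 sum_less_5 H rotation_coeff_explicit eqs
      by (intro conjI) (simp_all add: field_simps)
  qed
qed

section \<open>Identification with the four-parameter form\<close>

definition modal_entry :: "real mat \<Rightarrow> nat \<Rightarrow> nat \<Rightarrow> real" where
  "modal_entry Q i j = Q $$ (top_index i, top_index j)"

lemma modal_entry_sym:
  assumes "Q \<in> carrier_mat 15 15" "transpose_mat Q = Q" "i < 5" "j < 5"
  shows "modal_entry Q i j = modal_entry Q j i"
  unfolding modal_entry_def
  using assms top_index_less by (metis carrier_matD index_transpose_mat(1))

text \<open>Of the fifteen pairs of top modes on or above the diagonal, the nine listed ones have
  equal parity; the other six are exactly those that the reflection forces to 0. Symmetry takes care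
  of the entries below the diagonal.\<close>

lemma four_param_form_iff:
  assumes Q: "Q \<in> carrier_mat 15 15"
  shows "four_param_form q0 q1 q2 q3 Q \<longleftrightarrow> transpose_mat Q = Q \<and> top_supported Q \<and>
    (\<forall>i<5. \<forall>j<5. odd (i + j) \<longrightarrow> modal_entry Q i j = 0) \<and>
    modal_entry Q 0 0 = theta4 q0 q1 q2 q3 \<and> modal_entry Q 0 2 = q3 \<and> modal_entry Q 0 4 = q2 \<and>
    modal_entry Q 2 2 = theta3 q0 q1 q2 q3 \<and> modal_entry Q 2 4 = theta2 q0 q1 q2 q3 \<and>
    modal_entry Q 4 4 = theta0 q0 q1 q2 q3 \<and> modal_entry Q 1 1 = q1 \<and> modal_entry Q 1 3 = q0 \<and>
    modal_entry Q 3 3 = theta1 q0 q1 q2 q3" (is "?L \<longleftrightarrow> ?R")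
proof -
  define S :: "(nat \<times> nat) set" where
    "S = {(5, 5), (5, 12), (5, 15), (12, 12), (12, 15), (15, 15), (9, 9), (9, 14), (14, 14)}"
  have sym: "Q $$ (i, j) = Q $$ (j, i)" if "i < 15" "j < 15" "transpose_mat Q = Q" for i j
    using that Q by (metis carrier_matD index_transpose_mat(1))
  have S_top: "mode_degree i > 3 \<and> mode_degree j > 3" if "(Suc i, Suc j) \<in> S" for i j
    using that by (auto simp: S_def modes_def)
  have vals: "top_index 0 = 4" "top_index 1 = 8" "top_index 2 = 11" "top_index 3 = 13" "top_index 4 = 14"
    by (simp_all add: top_index_def)
  have zero: "(\<forall>i\<in>{1..15}. \<forall>j\<in>{i..15}. (i, j) \<notin> S \<longrightarrow> entry Q i j = 0) \<longleftrightarrow>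
      top_supported Q \<and> (\<forall>i<5. \<forall>j<5. odd (i + j) \<longrightarrow> modal_entry Q i j = 0)"
    if tr: "transpose_mat Q = Q"
  proof
    assume *: "\<forall>i\<in>{1..15}. \<forall>j\<in>{i..15}. (i, j) \<notin> S \<longrightarrow> entry Q i j = 0"
    have up: "Q $$ (i, j) = 0" if "i \<le> j" "j < 15" "(Suc i, Suc j) \<notin> S" for i j
      using *[rule_format, of "Suc i" "Suc j"] that by (simp add: entry_def)
    have "top_supported Q"
      unfolding top_supported_def
    proof (intro allI impI)
      fix i j :: nat assume ij: "i < 15" "j < 15" "mode_degree i \<le> 3 \<or> mode_degree j \<le> 3"
      have "(Suc i, Suc j) \<notin> S" "(Suc j, Suc i) \<notin> S"
        using S_top[of i j] S_top[of j i] ij(3) by auto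
      then show "Q $$ (i, j) = 0"
        using up[of i j] up[of j i] sym[OF ij(1,2) tr] ij(1,2) by (cases "i \<le> j") simp_all
    qed
    moreover have z: "Q $$ (4, 8) = 0" "Q $$ (4, 13) = 0" "Q $$ (8, 11) = 0" "Q $$ (8, 14) = 0"
        "Q $$ (11, 13) = 0" "Q $$ (13, 14) = 0"
      by (simp_all add: up S_def)
    moreover have "Q $$ (8, 4) = 0" "Q $$ (13, 4) = 0" "Q $$ (11, 8) = 0" "Q $$ (14, 8) = 0"
        "Q $$ (13, 11) = 0" "Q $$ (14, 13) = 0"
      using sym[OF _ _ tr, of 8 4] sym[OF _ _ tr, of 13 4] sym[OF _ _ tr, of 11 8]
        sym[OF _ _ tr, of 14 8] sym[OF _ _ tr, of 13 11] sym[OF _ _ tr, of 14 13]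
      unfolding z by simp_all
    ultimately show "top_supported Q \<and> (\<forall>i<5. \<forall>j<5. odd (i + j) \<longrightarrow> modal_entry Q i j = 0)"
      unfolding all_less_5 modal_entry_def vals by simp
  next
    assume *: "top_supported Q \<and> (\<forall>i<5. \<forall>j<5. odd (i + j) \<longrightarrow> modal_entry Q i j = 0)"
    show "\<forall>i\<in>{1..15}. \<forall>j\<in>{i..15}. (i, j) \<notin> S \<longrightarrow> entry Q i j = 0"
    proof (intro ballI impI)
      fix i j :: nat assume ij: "i \<in> {1..15}" "j \<in> {i..15}" "(i, j) \<notin> S"
      then have lt: "i - 1 < 15" "j - 1 < 15" by auto
      show "entry Q i j = 0"
      proof (cases "mode_degree (i - 1) \<le> 3 \<or> mode_degree (j - 1) \<le> 3")
        case True
        then show ?thesis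
          using conjunct1[OF *, unfolded top_supported_def, rule_format, OF lt] by (simp add: entry_def)
      next
        case False
        then have "mode_degree (i - 1) > 3" "mode_degree (j - 1) > 3" by linarith+
        then obtain k l where kl: "k < 5" "i - 1 = top_index k" "l < 5" "j - 1 = top_index l"
          unfolding top_mode_iff[OF lt(1)] top_mode_iff[OF lt(2)] by (elim exE conjE)
        have "i = Suc (i - 1)" "j = Suc (j - 1)" using ij(1,2) by simp_all
        then have eq: "i = Suc (top_index k)" "j = Suc (top_index l)" unfolding kl .
        have le: "top_index k \<le> top_index l" and notin: "(Suc (top_index k), Suc (top_index l)) \<notin> S"
          using ij unfolding eq by auto
        have "\<forall>k<5. \<forall>l<5. top_index k \<le> top_index l \<longrightarrow> (Suc (top_index k), Suc (top_index l)) \<notin> S \<longrightarrow> odd (k + l)"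
          unfolding all_less_5 vals S_def by simp
        then have "odd (k + l)" using kl le notin by blast
        then have "modal_entry Q k l = 0" using conjunct2[OF *] kl by simp
        then show ?thesis by (simp add: entry_def eq modal_entry_def)
      qed
    qed
  qed
  show ?thesis
  proof (cases "transpose_mat Q = Q")
    case True
    have entries: "entry Q 5 5 = modal_entry Q 0 0" "entry Q 5 12 = modal_entry Q 0 2"
      "entry Q 5 15 = modal_entry Q 0 4" "entry Q 12 12 = modal_entry Q 2 2"
      "entry Q 12 15 = modal_entry Q 2 4" "entry Q 15 15 = modal_entry Q 4 4"
      "entry Q 9 9 = modal_entry Q 1 1" "entry Q 9 14 = modal_entry Q 1 3"
      "entry Q 14 14 = modal_entry Q 3 3"
      by (simp_all add: entry_def modal_entry_def top_index_def)
    show ?thesis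
      unfolding four_param_form_def S_def[symmetric] zero[OF True] entries
      by (insert Q True, (rule iffI; elim conjE; intro conjI; assumption))
  next
    case False
    then show ?thesis unfolding four_param_form_def by blast
  qed
qed

lemma extended_range_iff_four_param:
  assumes Q: "Q \<in> carrier_mat 15 15"
  shows "extended_range_conditions 4 Q \<longleftrightarrow> (\<exists>q0 q1 q2 q3. four_param_form q0 q1 q2 q3 Q)"
proof -
  let ?a = "modal_entry Q"
  let ?base = "transpose_mat Q = Q \<and> top_supported Q \<and> (\<forall>i<5. \<forall>j<5. odd (i + j) \<longrightarrow> ?a i j = 0)"
  let ?rot = "\<forall>i<5. \<forall>j<5. (\<Sum>l<5. ?a i l * (rotation_coeff l j * (top_norm j / top_norm l)))
       = (\<Sum>l<5. rotation_coeff i l * (top_norm l / top_norm i) * ?a l j)"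
  have L: "extended_range_conditions 4 Q \<longleftrightarrow> ?base \<and> ?rot"
    unfolding extended_range_conditions_iff[OF Q] modal_entry_def by blast
  have params: "q0 = ?a 1 3 \<and> q1 = ?a 1 1 \<and> q2 = ?a 0 4 \<and> q3 = ?a 0 2"
    if "four_param_form q0 q1 q2 q3 Q" for q0 q1 q2 q3
    using that unfolding four_param_form_iff[OF Q] by (elim conjE) (intro conjI; erule sym)
  \<comment> \<open>The parameters are themselves entries of \<open>Q\<close>, so the existential
    quantifiers have only one possible choice of witnesses.\<close>
  have "(\<exists>q0 q1 q2 q3. four_param_form q0 q1 q2 q3 Q) \<longleftrightarrow>
      four_param_form (?a 1 3) (?a 1 1) (?a 0 4) (?a 0 2) Q"
  proof
    assume "\<exists>q0 q1 q2 q3. four_param_form q0 q1 q2 q3 Q"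
    then obtain q0 q1 q2 q3 where form: "four_param_form q0 q1 q2 q3 Q" by (elim exE)
    then show "four_param_form (?a 1 3) (?a 1 1) (?a 0 4) (?a 0 2) Q"
      using params[OF form] by (elim conjE) (simp only:)
  qed (intro exI)
  then have R: "(\<exists>q0 q1 q2 q3. four_param_form q0 q1 q2 q3 Q) \<longleftrightarrow> ?base \<and>
     ?a 0 0 = theta4 (?a 1 3) (?a 1 1) (?a 0 4) (?a 0 2) \<and>
     ?a 2 2 = theta3 (?a 1 3) (?a 1 1) (?a 0 4) (?a 0 2) \<and>
     ?a 2 4 = theta2 (?a 1 3) (?a 1 1) (?a 0 4) (?a 0 2) \<and>
     ?a 4 4 = theta0 (?a 1 3) (?a 1 1) (?a 0 4) (?a 0 2) \<and>
     ?a 3 3 = theta1 (?a 1 3) (?a 1 1) (?a 0 4) (?a 0 2)"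
    unfolding four_param_form_iff[OF Q] by (simp only: refl simp_thms conj_assoc)
  show ?thesis
  proof (cases ?base)
    case False
    then show ?thesis unfolding L R by blast
  next
    case True
    \<comment> \<open>These products absorb the irrational factors of the norm ratios and leave a
      system with rational coefficients.\<close>
    define b h e where "b = sqrt 5 * ?a 0 2" and "h = sqrt 21 * ?a 1 3" and "e = sqrt 5 * ?a 2 4"
    let ?H = "\<lambda>i j. [[?a 0 0, 0, b / 5, 0, ?a 0 4 / 3],
                      [0, ?a 1 1, 0, h / 7, 0],
                      [b, 0, ?a 2 2, 0, e / 3],
                      [0, h / 3, 0, ?a 3 3, 0],
                      [3 * ?a 0 4, 0, 3 * e / 5, 0, ?a 4 4]] ! i ! j"
    have sym: "?a 2 0 = ?a 0 2" "?a 4 0 = ?a 0 4" "?a 4 2 = ?a 2 4" "?a 3 1 = ?a 1 3"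
      using True modal_entry_sym[OF Q] by simp_all
    have odd: "?a 0 1 = 0" "?a 0 3 = 0" "?a 1 0 = 0" "?a 1 2 = 0" "?a 1 4 = 0" "?a 2 1 = 0"
       "?a 2 3 = 0" "?a 3 0 = 0" "?a 3 2 = 0" "?a 3 4 = 0" "?a 4 1 = 0" "?a 4 3 = 0"
      using True by auto
    have s: "sqrt 9 = 3" "sqrt 25 = 5" "sqrt 49 = 7" "sqrt 81 = 9" "sqrt 45 = 3 * sqrt 5"
      and sqrt_105: "sqrt 105 = sqrt 5 * sqrt 21"
      using real_sqrt_mult[of 9 5] real_sqrt_mult[of 5 21] real_sqrt_abs2[of 3] real_sqrt_abs2[of 5]
        real_sqrt_abs2[of 7] real_sqrt_abs2[of 9] by simp_all
    have "\<forall>i<5. \<forall>j<5. sqrt ((2 * real i + 1) * (2 * real j + 1)) / (2 * real j + 1) * ?a i j = ?H i j"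
      unfolding all_less_5
      by (simp add: odd[unfolded One_nat_def] sym[unfolded One_nat_def] b_def h_def e_def s)
    then have H: "top_norm i / top_norm j * ?a i j = ?H i j" if "i < 5" "j < 5" for i j
      unfolding top_norm_ratio[OF that] using that by blast
    have "?rot \<longleftrightarrow> (\<forall>i<5. \<forall>j<5.
        (\<Sum>l<5. (top_norm i / top_norm l * ?a i l) * rotation_coeff l j)
        = (\<Sum>l<5. rotation_coeff i l * (top_norm l / top_norm j * ?a l j)))"
    proof (intro all_cong)
      fix i j :: nat
      show "(\<Sum>l<5. ?a i l * (rotation_coeff l j * (top_norm j / top_norm l)))
          = (\<Sum>l<5. rotation_coeff i l * (top_norm l / top_norm i) * ?a l j) \<longleftrightarrow>
        (\<Sum>l<5. (top_norm i / top_norm l * ?a i l) * rotation_coeff l j)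
          = (\<Sum>l<5. rotation_coeff i l * (top_norm l / top_norm j * ?a l j))"
        by (rule commute_rescale[where n = top_norm and a = "?a i" and b = "\<lambda>l. ?a l j", OF top_norm_pos])
    qed
    also have "\<dots> \<longleftrightarrow> (\<forall>i<5. \<forall>j<5. (\<Sum>l<5. ?H i l * rotation_coeff l j) = (\<Sum>l<5. rotation_coeff i l * ?H l j))"
      by (intro all_cong arg_cong2[where f = "(=)"] sum.cong refl) (simp_all only: H lessThan_iff)
    also have "\<dots> \<longleftrightarrow> ?a 0 0 = (2 * h + 6 * ?a 1 1 + 12 * ?a 0 4 - 3 * b) / 6 \<and>
        ?a 3 3 = (8 * h + 42 * ?a 1 1 + 75 * ?a 0 4 - 45 * b) / 42 \<and>
        ?a 4 4 = (16 * h + 98 * ?a 1 1 + 99 * ?a 0 4 - 9 * b) / 98 \<and>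
        ?a 2 2 = (4 * h + 147 * ?a 1 1 + 240 * ?a 0 4 - 102 * b) / 147 \<and>
        e = (25 * h + 100 * ?a 0 4 - 18 * b) / 49"
      by (rule rotation_commutant)
    finally have rot: "?rot \<longleftrightarrow> ?a 0 0 = (2 * h + 6 * ?a 1 1 + 12 * ?a 0 4 - 3 * b) / 6 \<and>
        ?a 3 3 = (8 * h + 42 * ?a 1 1 + 75 * ?a 0 4 - 45 * b) / 42 \<and>
        ?a 4 4 = (16 * h + 98 * ?a 1 1 + 99 * ?a 0 4 - 9 * b) / 98 \<and>
        ?a 2 2 = (4 * h + 147 * ?a 1 1 + 240 * ?a 0 4 - 102 * b) / 147 \<and>
        e = (25 * h + 100 * ?a 0 4 - 18 * b) / 49" .
    have sqrt5: "sqrt 5 * (sqrt 5 * x) = 5 * x" for x by (simp add: mult.assoc[symmetric])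
    \<comment> \<open>Since sqrt 105 = sqrt 5 * sqrt 21, the equation for \<open>e\<close> is sqrt 5
      times the one defining \<open>theta2\<close>.\<close>
    have "(25 * h + 100 * ?a 0 4 - 18 * b) / 49 = sqrt 5 * theta2 (?a 1 3) (?a 1 1) (?a 0 4) (?a 0 2)"
      unfolding theta2_def sqrt_105 b_def h_def
      by (simp add: algebra_simps add_divide_distrib diff_divide_distrib sqrt5)
    then have e: "e = (25 * h + 100 * ?a 0 4 - 18 * b) / 49 \<longleftrightarrow>
        ?a 2 4 = theta2 (?a 1 3) (?a 1 1) (?a 0 4) (?a 0 2)"
      unfolding e_def by simp
    have thetas: "(2 * h + 6 * ?a 1 1 + 12 * ?a 0 4 - 3 * b) / 6 = theta4 (?a 1 3) (?a 1 1) (?a 0 4) (?a 0 2)"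
      "(8 * h + 42 * ?a 1 1 + 75 * ?a 0 4 - 45 * b) / 42 = theta1 (?a 1 3) (?a 1 1) (?a 0 4) (?a 0 2)"
      "(16 * h + 98 * ?a 1 1 + 99 * ?a 0 4 - 9 * b) / 98 = theta0 (?a 1 3) (?a 1 1) (?a 0 4) (?a 0 2)"
      "(4 * h + 147 * ?a 1 1 + 240 * ?a 0 4 - 102 * b) / 147 = theta3 (?a 1 3) (?a 1 1) (?a 0 4) (?a 0 2)"
      unfolding theta0_def theta1_def theta3_def theta4_def b_def h_def by (simp_all only: mult.assoc)
    show ?thesis
      unfolding L R rot e thetas using True by argo
  qed
qed

section \<open>Positive definiteness\<close>

lemma positive_form_2_iff:
  fixes a b d :: real
  shows "(\<forall>x y. (x, y) \<noteq> (0, 0) \<longrightarrow> a * x\<^sup>2 + 2 * b * x * y + d * y\<^sup>2 > 0) \<longleftrightarrow> a > 0 \<and> a * d - b\<^sup>2 > 0"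
    (is "?L \<longleftrightarrow> ?R")
proof
  assume L: ?L
  from L[rule_format, of 1 0] have a: "a > 0" by simp
  \<comment> \<open>The vector (-b, a) is orthogonal to the first row (a, b), so the form takes
    there the value a times the determinant.\<close>
  have "0 < a * (- b)\<^sup>2 + 2 * b * (- b) * a + d * a\<^sup>2" using L[rule_format, of "- b" a] a by simp
  also have "\<dots> = a * (a * d - b\<^sup>2)" by (simp add: power2_eq_square algebra_simps)
  finally show ?R using a by (simp add: zero_less_mult_iff)
next
  assume R: ?R
  show ?L
  proof (intro allI impI)
    fix x y :: real assume "(x, y) \<noteq> (0, 0)"
    then have "(a * x + b * y)\<^sup>2 + (a * d - b\<^sup>2) * y\<^sup>2 > 0"
      using R by (cases "y = 0") (auto intro: add_nonneg_pos)
    also have "(a * x + b * y)\<^sup>2 + (a * d - b\<^sup>2) * y\<^sup>2 = a * (a * x\<^sup>2 + 2 * b * x * y + d * y\<^sup>2)"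
      by (simp add: power2_eq_square algebra_simps)
    finally show "a * x\<^sup>2 + 2 * b * x * y + d * y\<^sup>2 > 0" using R by (simp add: zero_less_mult_iff)
  qed
qed

lemma positive_form_3_iff:
  fixes a b c d e f :: real
  shows "(\<forall>x y z. (x, y, z) \<noteq> (0, 0, 0) \<longrightarrow>
      a * x\<^sup>2 + d * y\<^sup>2 + f * z\<^sup>2 + 2 * b * x * y + 2 * c * x * z + 2 * e * y * z > 0) \<longleftrightarrow>
    a > 0 \<and> a * d - b\<^sup>2 > 0 \<and> a * d * f + 2 * b * c * e - a * e\<^sup>2 - d * c\<^sup>2 - f * b\<^sup>2 > 0"
    (is "?L \<longleftrightarrow> ?R")
proof
  let ?q = "\<lambda>x y z. a * x\<^sup>2 + d * y\<^sup>2 + f * z\<^sup>2 + 2 * b * x * y + 2 * c * x * z + 2 * e * y * z"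
  assume L: ?L
  have "\<forall>x y. (x, y) \<noteq> (0, 0) \<longrightarrow> a * x\<^sup>2 + 2 * b * x * y + d * y\<^sup>2 > 0"
  proof (intro allI impI)
    fix x y :: real assume "(x, y) \<noteq> (0, 0)"
    then show "a * x\<^sup>2 + 2 * b * x * y + d * y\<^sup>2 > 0" using L[rule_format, of x y 0] by (simp add: algebra_simps)
  qed
  then have ab: "a > 0" "a * d - b\<^sup>2 > 0" unfolding positive_form_2_iff by auto
  \<comment> \<open>The vector is the last column of the adjugate, so the form takes there the value
    of the leading 2 x 2 minor times the determinant.\<close>
  have "0 < ?q (b * e - c * d) (b * c - a * e) (a * d - b\<^sup>2)"
    using L[rule_format, of "b * e - c * d" "b * c - a * e" "a * d - b\<^sup>2"] ab by simp
  also have "\<dots> = (a * d - b\<^sup>2) * (a * d * f + 2 * b * c * e - a * e\<^sup>2 - d * c\<^sup>2 - f * b\<^sup>2)"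
    by (simp add: power2_eq_square algebra_simps)
  finally show ?R using ab by (simp add: zero_less_mult_iff)
next
  let ?q = "\<lambda>x y z. a * x\<^sup>2 + d * y\<^sup>2 + f * z\<^sup>2 + 2 * b * x * y + 2 * c * x * z + 2 * e * y * z"
  let ?m = "a * d - b\<^sup>2" and ?det = "a * d * f + 2 * b * c * e - a * e\<^sup>2 - d * c\<^sup>2 - f * b\<^sup>2"
  assume R: ?R
  show ?L
  proof (intro allI impI)
    fix x y z :: real assume nz: "(x, y, z) \<noteq> (0, 0, 0)"
    \<comment> \<open>The square is completed twice, and the result multiplied by a * ?m to avoid
      fractions.\<close>
    have "?m * (a * x + b * y + c * z)\<^sup>2 + (?m * y + (a * e - b * c) * z)\<^sup>2 + a * ?det * z\<^sup>2 > 0"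
    proof (cases "z = 0")
      case False
      then show ?thesis using R by (intro add_nonneg_pos add_nonneg_nonneg) auto
    next
      case z: True
      show ?thesis
      proof (cases "y = 0")
        case True
        then show ?thesis using R z nz by simp
      next
        case False
        then show ?thesis using R z by (auto intro!: add_nonneg_pos)
      qed
    qed
    also have "?m * (a * x + b * y + c * z)\<^sup>2 + (?m * y + (a * e - b * c) * z)\<^sup>2 + a * ?det * z\<^sup>2
        = a * ?m * ?q x y z"
      by (simp add: power2_eq_square algebra_simps)
    finally show "?q x y z > 0"
      by (rule zero_less_mult_pos) (use R in simp)
  qed
qed

text \<open>By parity the form splits into a sum of squares over the low positions, a ternary form
  in the even positions 4, 11, 14 and a binary form in the odd positions 8, 13. Vectors supported on
  one block give necessity.\<close>

lemma positive_definite_iff_blocks: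
  assumes Q: "Q \<in> carrier_mat 15 15" and sym: "transpose_mat Q = Q" and top: "top_supported Q"
    and parity: "\<forall>i<5. \<forall>j<5. odd (i + j) \<longrightarrow> modal_entry Q i j = 0"
  defines "a \<equiv> modal_entry Q"
  shows "positive_definite_mat (1\<^sub>m 15 + Q) \<longleftrightarrow>
    (\<forall>x y z. (x, y, z) \<noteq> (0, 0, 0) \<longrightarrow> (1 + a 0 0) * x\<^sup>2 + (1 + a 2 2) * y\<^sup>2 + (1 + a 4 4) * z\<^sup>2
        + 2 * a 0 2 * x * y + 2 * a 0 4 * x * z + 2 * a 2 4 * y * z > 0) \<and>
    (\<forall>x y. (x, y) \<noteq> (0, 0) \<longrightarrow> (1 + a 1 1) * x\<^sup>2 + 2 * a 1 3 * x * y + (1 + a 3 3) * y\<^sup>2 > 0)"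
    (is "_ \<longleftrightarrow> ?P3 \<and> ?P2")
proof -
  let ?q3 = "\<lambda>x y z. (1 + a 0 0) * x\<^sup>2 + (1 + a 2 2) * y\<^sup>2 + (1 + a 4 4) * z\<^sup>2
        + 2 * a 0 2 * x * y + 2 * a 0 4 * x * z + 2 * a 2 4 * y * z"
  let ?q2 = "\<lambda>x y. (1 + a 1 1) * x\<^sup>2 + 2 * a 1 3 * x * y + (1 + a 3 3) * y\<^sup>2"
  let ?low = "{..<15} - top_index ` {..<5}"
  have symm: "a 2 0 = a 0 2" "a 4 0 = a 0 4" "a 4 2 = a 2 4" "a 3 1 = a 1 3"
    unfolding a_def using modal_entry_sym[OF Q sym] by simp_all
  have odd: "a 0 1 = 0" "a 0 3 = 0" "a 1 0 = 0" "a 1 2 = 0" "a 1 4 = 0" "a 2 1 = 0"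
     "a 2 3 = 0" "a 3 0 = 0" "a 3 2 = 0" "a 3 4 = 0" "a 4 1 = 0" "a 4 3 = 0"
    unfolding a_def using parity by auto
  have vals: "top_index 0 = 4" "top_index 1 = 8" "top_index 2 = 11" "top_index 3 = 13" "top_index 4 = 14"
    by (simp_all add: top_index_def)
  have image: "top_index ` {..<5} \<subseteq> {..<15}" using top_index_less by auto
  have form: "scalar_prod u ((1\<^sub>m 15 + Q) *\<^sub>v u)
      = (\<Sum>i\<in>?low. (u $ i)\<^sup>2) + ?q3 (u $ 4) (u $ 11) (u $ 14) + ?q2 (u $ 8) (u $ 13)"
    if u: "u \<in> carrier_vec 15" for u
  proof -
    have "scalar_prod u ((1\<^sub>m 15 + Q) *\<^sub>v u) = scalar_prod u u + scalar_prod u (Q *\<^sub>v u)"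
      using u Q by (simp add: add_mult_distrib_mat_vec[of _ 15 15] scalar_prod_add_distrib[of _ 15])
    also have "scalar_prod u u = (\<Sum>i<15. (u $ i)\<^sup>2)"
      using u by (simp add: scalar_prod_def atLeast0LessThan power2_eq_square)
    also have "\<dots> = (\<Sum>i\<in>?low. (u $ i)\<^sup>2) + (\<Sum>k<5. (u $ top_index k)\<^sup>2)"
      by (simp add: sum.subset_diff[OF image] sum.reindex inj_top_index)
    also have "scalar_prod u (Q *\<^sub>v u) = (\<Sum>i<15. u $ i * (\<Sum>j<15. Q $$ (i, j) * u $ j))"
      using u Q by (simp add: scalar_prod_def atLeast0LessThan)
    also have "\<dots> = (\<Sum>k<5. u $ top_index k * (\<Sum>j<15. Q $$ (top_index k, j) * u $ j))"
      by (rule sum_top) (use top in \<open>simp add: top_supported_def\<close>)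
    also have "\<dots> = (\<Sum>k<5. u $ top_index k * (\<Sum>l<5. a k l * u $ top_index l))"
      unfolding a_def modal_entry_def
      by (intro sum.cong arg_cong2[where f = "(*)"] sum_top refl) (use top top_index_less in \<open>simp add: top_supported_def\<close>)
    finally show ?thesis
      by (simp only: sum_less_5 odd symm vals) (simp add: algebra_simps power2_eq_square)
  qed
  have base: "positive_definite_mat (1\<^sub>m 15 + Q) \<longleftrightarrow>
     (\<forall>u\<in>carrier_vec 15. u \<noteq> 0\<^sub>v 15 \<longrightarrow> scalar_prod u ((1\<^sub>m 15 + Q) *\<^sub>v u) > 0)"
    using Q sym by (simp add: positive_definite_mat_def transpose_add[of _ 15 15])
  show ?thesis
  proof
    assume pd: "positive_definite_mat (1\<^sub>m 15 + Q)"
    have pos: "?q3 x y z + ?q2 r s > 0" if "x \<noteq> 0 \<or> y \<noteq> 0 \<or> z \<noteq> 0 \<or> r \<noteq> 0 \<or> s \<noteq> 0" for x y z r s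
    proof -
      let ?u = "vec 15 (\<lambda>i. if i = 4 then x else if i = 11 then y else if i = 14 then z
                            else if i = 8 then r else if i = 13 then s else 0)"
      have "?u \<noteq> 0\<^sub>v 15"
      proof
        assume eq: "?u = 0\<^sub>v 15"
        have "?u $ i = 0" if "i < 15" for i unfolding eq using that by simp
        from this[of 4] this[of 11] this[of 14] this[of 8] this[of 13] show False using that by simp
      qed
      then have "scalar_prod ?u ((1\<^sub>m 15 + Q) *\<^sub>v ?u) > 0" using pd unfolding base by simp
      moreover have "(\<Sum>i\<in>?low. (?u $ i)\<^sup>2) = 0"
      proof (rule sum.neutral, rule ballI)
        fix i assume i: "i \<in> ?low"
        have "top_index 0 \<in> top_index ` {..<5}" "top_index 1 \<in> top_index ` {..<5}"
          "top_index 2 \<in> top_index ` {..<5}" "top_index 3 \<in> top_index ` {..<5}"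
          "top_index 4 \<in> top_index ` {..<5}" by simp_all
        then have "i \<noteq> 4" "i \<noteq> 8" "i \<noteq> 11" "i \<noteq> 13" "i \<noteq> 14" using i unfolding vals by blast+
        then show "(?u $ i)\<^sup>2 = 0" using i by simp
      qed
      ultimately show ?thesis by (simp add: form)
    qed
    have "?P3"
    proof (intro allI impI)
      fix x y z :: real assume "(x, y, z) \<noteq> (0, 0, 0)"
      then show "?q3 x y z > 0" using pos[of x y z 0 0] by simp
    qed
    moreover have "?P2"
    proof (intro allI impI)
      fix x y :: real assume "(x, y) \<noteq> (0, 0)"
      then show "?q2 x y > 0" using pos[of 0 0 0 x y] by simp
    qed
    ultimately show "?P3 \<and> ?P2" ..
  next
    assume P: "?P3 \<and> ?P2"
    show "positive_definite_mat (1\<^sub>m 15 + Q)"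
      unfolding base
    proof (intro ballI impI)
      fix u :: "real vec" assume u: "u \<in> carrier_vec 15" and nz: "u \<noteq> 0\<^sub>v 15"
      let ?low_sum = "\<Sum>i\<in>?low. (u $ i)\<^sup>2"
      have low: "?low_sum \<ge> 0" by (intro sum_nonneg) simp
      have q3: "?q3 (u $ 4) (u $ 11) (u $ 14) \<ge> 0"
        using P by (cases "(u $ 4, u $ 11, u $ 14) = (0, 0, 0)") (auto intro: less_imp_le)
      have q2: "?q2 (u $ 8) (u $ 13) \<ge> 0"
        using P by (cases "(u $ 8, u $ 13) = (0, 0)") (auto intro: less_imp_le)
      consider "(u $ 4, u $ 11, u $ 14) \<noteq> (0, 0, 0)" | "(u $ 8, u $ 13) \<noteq> (0, 0)"
        | "(u $ 4, u $ 11, u $ 14) = (0, 0, 0)" "(u $ 8, u $ 13) = (0, 0)" by blast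
      then show "scalar_prod u ((1\<^sub>m 15 + Q) *\<^sub>v u) > 0"
      proof cases
        case 1
        then have "?q3 (u $ 4) (u $ 11) (u $ 14) > 0" using P by blast
        then show ?thesis using low q2 unfolding form[OF u] by linarith
      next
        case 2
        then have "?q2 (u $ 8) (u $ 13) > 0" using P by blast
        then show ?thesis using low q3 unfolding form[OF u] by linarith
      next
        case 3
        have "\<exists>i<15. u $ i \<noteq> 0"
          using nz u by (metis carrier_vecD eq_vecI index_zero_vec(1) index_zero_vec(2))
        then obtain i where i: "i < 15" "u $ i \<noteq> 0" by blast
        have "top_index k \<in> {4, 8, 11, 13, 14}" if "k < 5" for k
          using that vals unfolding less_5_iff by auto
        then have "top_index ` {..<5} \<subseteq> {4, 8, 11, 13, 14}" by blast
        moreover have "i \<notin> {4, 8, 11, 13, 14}" using i(2) 3 by auto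
        ultimately have "i \<in> ?low" using i(1) by blast
        then have "?low_sum > 0" using i by (intro sum_pos2[of _ i]) auto
        then show ?thesis using q3 q2 unfolding form[OF u] by linarith
      qed
    qed
  qed
qed

lemma positive_definite_four_param:
  assumes form: "four_param_form q0 q1 q2 q3 Q"
  defines "\<theta>0 \<equiv> theta0 q0 q1 q2 q3" and "\<theta>1 \<equiv> theta1 q0 q1 q2 q3" and "\<theta>2 \<equiv> theta2 q0 q1 q2 q3"
    and "\<theta>3 \<equiv> theta3 q0 q1 q2 q3" and "\<theta>4 \<equiv> theta4 q0 q1 q2 q3"
  shows "positive_definite_mat (mass_mat 4 + Q) \<longleftrightarrow>
                \<theta>4 > -1 \<and>
                q1 > -1 \<and>
                - q3\<^sup>2 + \<theta>3 + \<theta>4 + \<theta>3 * \<theta>4 > -1 \<and>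
                - q0\<^sup>2 + q1 + \<theta>1 + q1 * \<theta>1 > -1 \<and>
                2 * \<theta>2 * q2 * q3 + \<theta>3 * (\<theta>4 - q2\<^sup>2 + 1)
                  + \<theta>0 * ((\<theta>3 + 1) * (\<theta>4 + 1) - q3\<^sup>2)
                  - (\<theta>4 + 1) * \<theta>2\<^sup>2 + \<theta>4 - q2\<^sup>2 - q3\<^sup>2 > -1"
proof -
  have Q: "Q \<in> carrier_mat 15 15" using form by (simp add: four_param_form_def)
  have F: "transpose_mat Q = Q" "top_supported Q"
      "\<forall>i<5. \<forall>j<5. odd (i + j) \<longrightarrow> modal_entry Q i j = 0"
    and v: "modal_entry Q 0 0 = \<theta>4" "modal_entry Q 0 2 = q3" "modal_entry Q 0 4 = q2"
      "modal_entry Q 2 2 = \<theta>3" "modal_entry Q 2 4 = \<theta>2" "modal_entry Q 4 4 = \<theta>0"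
      "modal_entry Q 1 1 = q1" "modal_entry Q 1 3 = q0" "modal_entry Q 3 3 = \<theta>1"
    using form unfolding four_param_form_iff[OF Q] \<theta>0_def \<theta>1_def \<theta>2_def \<theta>3_def \<theta>4_def by blast+
  \<comment> \<open>Each leading minor is 1 plus an expression of the statement, which turns
    positivity into a bound by -1.\<close>
  have m: "(1 + \<theta>4) * (1 + \<theta>3) - q3\<^sup>2 = 1 + (- q3\<^sup>2 + \<theta>3 + \<theta>4 + \<theta>3 * \<theta>4)"
    "(1 + q1) * (1 + \<theta>1) - q0\<^sup>2 = 1 + (- q0\<^sup>2 + q1 + \<theta>1 + q1 * \<theta>1)"
    "(1 + \<theta>4) * (1 + \<theta>3) * (1 + \<theta>0) + 2 * q3 * q2 * \<theta>2 - (1 + \<theta>4) * \<theta>2\<^sup>2 - (1 + \<theta>3) * q2\<^sup>2 - (1 + \<theta>0) * q3\<^sup>2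
      = 1 + (2 * \<theta>2 * q2 * q3 + \<theta>3 * (\<theta>4 - q2\<^sup>2 + 1) + \<theta>0 * ((\<theta>3 + 1) * (\<theta>4 + 1) - q3\<^sup>2)
             - (\<theta>4 + 1) * \<theta>2\<^sup>2 + \<theta>4 - q2\<^sup>2 - q3\<^sup>2)"
    by (simp_all add: algebra_simps)
  have "positive_definite_mat (mass_mat 4 + Q) \<longleftrightarrow>
     1 + \<theta>4 > 0 \<and> (1 + \<theta>4) * (1 + \<theta>3) - q3\<^sup>2 > 0 \<and>
     (1 + \<theta>4) * (1 + \<theta>3) * (1 + \<theta>0) + 2 * q3 * q2 * \<theta>2 - (1 + \<theta>4) * \<theta>2\<^sup>2 - (1 + \<theta>3) * q2\<^sup>2 - (1 + \<theta>0) * q3\<^sup>2 > 0 \<and>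
     1 + q1 > 0 \<and> (1 + q1) * (1 + \<theta>1) - q0\<^sup>2 > 0"
    unfolding mass_mat_4 positive_definite_iff_blocks[OF Q F] v positive_form_3_iff positive_form_2_iff
    by (simp only: conj_assoc)
  moreover have "0 < 1 + x \<longleftrightarrow> - 1 < x" for x :: real by linarith
  ultimately show ?thesis unfolding m by (simp only: conj_ac)
qed

section \<open>The single-parameter matrix\<close>

text \<open>One statement serves both directions, with factor 1 for x and -1 / sqrt 3 for t.
  Binomial times factorial is the falling factorial, which is 0 as soon as k > b, exactly where the
  index b - k is truncated. The bound \<open>N\<close> keeps the monomials within degree 4.\<close>

lemma pow_lowering:
  fixes D :: "real mat"
  assumes D: "D \<in> carrier_mat n n" and w: "\<And>b. b \<le> N \<Longrightarrow> w b \<in> carrier_vec n"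
    and lower: "\<And>b. b \<le> N \<Longrightarrow> D *\<^sub>v w b = (\<kappa> * real b) \<cdot>\<^sub>v w (b - 1)"
  shows "b \<le> N \<Longrightarrow> (D ^\<^sub>m k) *\<^sub>v w b = (\<kappa> ^ k * real (b choose k) * fact k) \<cdot>\<^sub>v w (b - k)"
proof (induction k arbitrary: b)
  case 0
  then show ?case using D w[of b] by simp
next
  case (Suc k)
  have Dk: "D ^\<^sub>m k \<in> carrier_mat n n" using D by (rule pow_carrier_mat)
  have b1: "b - 1 \<le> N" using Suc.prems by simp
  have "(D ^\<^sub>m Suc k) *\<^sub>v w b = D ^\<^sub>m k *\<^sub>v (D *\<^sub>v w b)"
    using assoc_mult_mat_vec[OF Dk D w[OF Suc.prems]] by simp
  also have "\<dots> = (\<kappa> * real b) \<cdot>\<^sub>v ((\<kappa> ^ k * real ((b - 1) choose k) * fact k) \<cdot>\<^sub>v w (b - 1 - k))"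
    unfolding lower[OF Suc.prems] mult_mat_vec[OF Dk w[OF b1]] Suc.IH[OF b1] ..
  also have "\<dots> = (\<kappa> * real b * (\<kappa> ^ k * real ((b - 1) choose k) * fact k)) \<cdot>\<^sub>v w (b - Suc k)"
    by (simp add: smult_smult_assoc)
  also have "\<kappa> * real b * (\<kappa> ^ k * real ((b - 1) choose k) * fact k)
      = \<kappa> ^ Suc k * real (b choose Suc k) * fact (Suc k)"
  proof (cases b)
    case (Suc c)
    have "real (Suc c) * real (c choose k) = real (Suc c choose Suc k) * real (Suc k)"
      using Suc_times_binomial_eq[of c k] by (simp only: of_nat_mult[symmetric])
    then show ?thesis unfolding Suc by (simp add: algebra_simps del: binomial_Suc_Suc of_nat_Suc)
  qed simp
  finally show ?case .
qed

lemma K_mat_carrier: "K_mat 4 m \<in> carrier_mat 15 15"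
  unfolding K_mat_def
  by (rule mult_carrier_mat[OF pow_carrier_mat[OF Dx_carrier] pow_carrier_mat[OF Dy_carrier]])

text \<open>\<open>K_mat 4 (Suc q)\<close> differentiates 4 - q times in x and q times in y. Within
  degree 4 every monomial other than x^(4 - q) t^q has too small an exponent in x or in t and is
  annihilated.\<close>

lemma K_mat_monomial:
  assumes ab: "a + b \<le> 4" and q: "q \<le> 4"
  shows "K_mat 4 (Suc q) *\<^sub>v monomial_coords a b =
    (if a = 4 - q \<and> b = q then (fact (4 - q) * (- (1 / sqrt 3)) ^ q * fact q) \<cdot>\<^sub>v monomial_coords 0 0 else 0\<^sub>v 15)"
proof -
  let ?y = "(- (1 / sqrt 3)) ^ q * real (b choose q) * fact q"
  let ?x = "1 ^ (4 - q) * real (a choose (4 - q)) * fact (4 - q)"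
  have Y: "(Dy_mat 4 ^\<^sub>m q) *\<^sub>v monomial_coords a b = ?y \<cdot>\<^sub>v monomial_coords a (b - q)"
    by (rule pow_lowering[OF Dy_carrier, of "4 - a"])
       (use ab in \<open>auto intro!: monomial_coords_carrier simp: Dy_monomial\<close>)
  have X: "(Dx_mat 4 ^\<^sub>m (4 - q)) *\<^sub>v monomial_coords a (b - q) = ?x \<cdot>\<^sub>v monomial_coords (a - (4 - q)) (b - q)"
    by (rule pow_lowering[OF Dx_carrier, of "4 - (b - q)" "\<lambda>a. monomial_coords a (b - q)"])
       (use ab in \<open>auto intro!: monomial_coords_carrier simp: Dx_monomial\<close>)
  have c: "monomial_coords a b \<in> carrier_vec 15" "monomial_coords a (b - q) \<in> carrier_vec 15"
    "monomial_coords (a - (4 - q)) (b - q) \<in> carrier_vec 15"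
    using ab by (auto intro: monomial_coords_carrier)
  have K: "K_mat 4 (Suc q) *\<^sub>v monomial_coords a b = (?y * ?x) \<cdot>\<^sub>v monomial_coords (a - (4 - q)) (b - q)"
    unfolding K_mat_def
    by (simp add: assoc_mult_mat_vec[OF pow_carrier_mat[OF Dx_carrier] pow_carrier_mat[OF Dy_carrier] c(1)]
          Y X mult_mat_vec[OF pow_carrier_mat[OF Dx_carrier] c(2)] smult_smult_assoc)
  show ?thesis
  proof (cases "a = 4 - q \<and> b = q")
    case True
    then show ?thesis unfolding K by (simp add: mult_ac)
  next
    case False
    then have "a < 4 - q \<or> b < q" using ab q by linarith
    then have zero: "?y * ?x = 0" by (auto simp: binomial_eq_0)
    have "K_mat 4 (Suc q) *\<^sub>v monomial_coords a b = 0 \<cdot>\<^sub>v monomial_coords (a - (4 - q)) (b - q)"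
      unfolding K zero ..
    also have "\<dots> = 0\<^sub>v 15" using c(3) by (intro eq_vecI) auto
    finally show ?thesis by (simp only: False if_False)
  qed
qed

lemma functional_lincomb:
  assumes z: "z \<in> carrier_vec 15" and L: "\<forall>(c, a, b)\<in>set L. a + b \<le> 4"
    and u: "is_coords u (\<lambda>p. \<Sum>(c, a, b)\<leftarrow>L. c * xt_monomial a b p)"
  shows "scalar_prod z u = (\<Sum>(c, a, b)\<leftarrow>L. c * scalar_prod z (monomial_coords a b))"
proof -
  have "\<exists>d. is_coords d (\<lambda>p. \<Sum>(c, a, b)\<leftarrow>L. c * xt_monomial a b p) \<and>
      scalar_prod z d = (\<Sum>(c, a, b)\<leftarrow>L. c * scalar_prod z (monomial_coords a b))"
    using L
  proof (induction L)
    case Nil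
    then show ?case using is_coords_zero z by (intro exI[of _ "0\<^sub>v 15"]) simp
  next
    case (Cons t L)
    obtain c a b where t: "t = (c, a, b)" by (cases t)
    obtain d where d: "is_coords d (\<lambda>p. \<Sum>(c, a, b)\<leftarrow>L. c * xt_monomial a b p)"
      "scalar_prod z d = (\<Sum>(c, a, b)\<leftarrow>L. c * scalar_prod z (monomial_coords a b))"
      using Cons by auto
    have m: "is_coords (monomial_coords a b) (xt_monomial a b)"
      using Cons.prems t by (intro is_coords_monomial) simp
    have "is_coords (c \<cdot>\<^sub>v monomial_coords a b + d) (\<lambda>p. \<Sum>(c, a, b)\<leftarrow>t # L. c * xt_monomial a b p)"
      using is_coords_add[OF is_coords_scale[OF m, of c] d(1)] by (simp add: t)
    moreover have "scalar_prod z (c \<cdot>\<^sub>v monomial_coords a b + d)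
        = c * scalar_prod z (monomial_coords a b) + scalar_prod z d"
      using z is_coords_carrier[OF m] is_coords_carrier[OF d(1)]
      by (simp add: scalar_prod_add_distrib[of _ 15] scalar_prod_smult_distrib[of _ 15])
    ultimately show ?case using d(2) by (intro exI[of _ "c \<cdot>\<^sub>v monomial_coords a b + d"]) (simp add: t)
  qed
  then show ?thesis using is_coords_unique[OF u] by blast
qed

section \<open>Leading forms and the entries of the single-parameter matrix\<close>

definition top_expansion :: "nat \<Rightarrow> (real \<times> nat \<times> nat) list" where
  "top_expansion k = [[(5, 0, 0), (-60, 0, 1), (210, 0, 2), (-280, 0, 3), (126, 0, 4)],
                      [(20, 1, 0), (-105, 1, 1), (168, 1, 2), (-84, 1, 3)],
                      [(63/2, 2, 0), (-84, 2, 1), (54, 2, 2), (-21/2, 0, 2), (28, 0, 3), (-18, 0, 4)],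
                      [(20, 3, 0), (-45/2, 3, 1), (-12, 1, 2), (27/2, 1, 3)],
                      [(35/8, 4, 0), (-15/4, 2, 2), (3/8, 0, 4)]] ! k"

text \<open>Entry q is the coefficient of x^(4 - q) t^q in \<open>top_poly k\<close>, the only part
  that fourth derivatives see.\<close>

definition leading_coeff :: "nat \<Rightarrow> nat \<Rightarrow> real" where
  "leading_coeff k q = [[0, 0, 0, 0, 126],
                        [0, 0, 0, -84, 0],
                        [0, 0, 54, 0, -18],
                        [0, -45/2, 0, 27/2, 0],
                        [35/8, 0, -15/4, 0, 3/8]] ! k ! q"

lemma top_poly_expansion:
  assumes "k < 5"
  shows "top_poly k p = (\<Sum>(c, a, b)\<leftarrow>top_expansion k. c * xt_monomial a b p)"
proof (cases p)
  case (Pair x y)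
  show ?thesis
    using assms unfolding Pair less_5_iff
    by (elim disjE; simp only: top_poly_explicit; simp add: top_expansion_def xt_monomial_def
          field_simps power2_eq_square power3_eq_cube power4_eq_xxxx)
qed

lemma top_expansion_degree: "k < 5 \<Longrightarrow> \<forall>(c, a, b)\<in>set (top_expansion k). a + b \<le> 4"
  unfolding less_5_iff by (elim disjE) (simp_all add: top_expansion_def)

lemma top_expansion_leading:
  assumes "k < 5" "q < 5"
  shows "(\<Sum>(c, a, b)\<leftarrow>top_expansion k. c * (if a = 4 - q \<and> b = q then s else 0)) = leading_coeff k q * s"
  using assms unfolding less_5_iff
  by (elim disjE) (simp_all add: top_expansion_def leading_coeff_def)

lemma K_mat_low_column:
  assumes i: "i < 15" "mode_degree i \<le> 3" and r: "r < 15" and q: "q \<le> 4"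
  shows "K_mat 4 (Suc q) $$ (r, i) = 0"
proof -
  let ?K = "K_mat 4 (Suc q)"
  have "row ?K r $ i = 0"
  proof (rule orthogonal_low_modes[of _ 3])
    fix a b :: nat assume ab: "a + b \<le> 3"
    then have "(?K *\<^sub>v monomial_coords a b) $ r = 0"
      using K_mat_monomial[of a b q] q r by auto
    then show "scalar_prod (row ?K r) (monomial_coords a b) = 0"
      using K_mat_carrier[of "Suc q"] r by simp
  qed (use i K_mat_carrier[of "Suc q"] r in auto)
  then show ?thesis using K_mat_carrier[of "Suc q"] r i by simp
qed

text \<open>The triangle has area sqrt 3, so the first mode is the constant 3^(-1/4).\<close>

lemma monomial_coords_0_0: "monomial_coords 0 0 = (3 powr (1 / 4)) \<cdot>\<^sub>v unit_vec 15 0"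
proof (rule is_coords_unique)
  show "is_coords (monomial_coords 0 0) (xt_monomial 0 0)" by (simp add: is_coords_monomial)
  show "is_coords ((3 powr (1 / 4)) \<cdot>\<^sub>v unit_vec 15 0) (\<lambda>p. 3 powr (1 / 4) * dubiner 4 (Suc 0) p)"
    by (intro is_coords_scale is_coords_unit) simp
  show "\<forall>p\<in>interior ref_triangle. xt_monomial 0 0 p = 3 powr (1 / 4) * dubiner 4 (Suc 0) p"
    by (auto simp: dubiner_interior modes_def xt_monomial_def mode_norm_def mode_poly_def
          homogeneous_legendre_explicit shifted_jacobi_explicit)
qed

text \<open>Fourth derivatives of quartics are constants, so only the row of the constant mode is
  occupied, and each summand of \<open>QC_mat\<close> has rank at most one.\<close>

lemma K_mat_top_column:
  assumes k: "k < 5" and r: "r < 15" and q: "q < 5"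
  shows "K_mat 4 (Suc q) $$ (r, top_index k) =
    (if r = 0 then 3 powr (1 / 4) * top_norm k * leading_coeff k q
                     * (fact (4 - q) * (- (1 / sqrt 3)) ^ q * fact q) else 0)"
proof -
  let ?K = "K_mat 4 (Suc q)" and ?s = "fact (4 - q) * (- (1 / sqrt 3)) ^ q * fact q :: real"
  let ?z = "row ?K r" and ?u = "(1 / top_norm k) \<cdot>\<^sub>v unit_vec 15 (top_index k)"
  have K: "?K \<in> carrier_mat 15 15" by (rule K_mat_carrier)
  then have z: "?z \<in> carrier_vec 15" using r by auto
  have "is_coords ?u (\<lambda>p. \<Sum>(c, a, b)\<leftarrow>top_expansion k. c * xt_monomial a b p)"
  proof (rule is_coords_cong[OF is_coords_scale[OF is_coords_unit[OF top_index_less[OF k]]]])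
    fix p assume "p \<in> interior ref_triangle"
    then show "1 / top_norm k * dubiner 4 (Suc (top_index k)) p
        = (\<Sum>(c, a, b)\<leftarrow>top_expansion k. c * xt_monomial a b p)"
      using top_norm_pos[of k] by (simp add: dubiner_top_interior k top_poly_expansion)
  qed
  from functional_lincomb[OF z top_expansion_degree[OF k] this]
  have "scalar_prod ?z ?u = (\<Sum>(c, a, b)\<leftarrow>top_expansion k. c * scalar_prod ?z (monomial_coords a b))" .
  also have "\<dots> = (\<Sum>(c, a, b)\<leftarrow>top_expansion k. c * (if a = 4 - q \<and> b = q then ?s * monomial_coords 0 0 $ r else 0))"
  proof (rule arg_cong[of _ _ sum_list], rule map_cong[OF refl])
    fix t assume t: "t \<in> set (top_expansion k)"
    obtain c a b where cab: "t = (c, a, b)" by (cases t)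
    have ab: "a + b \<le> 4" using top_expansion_degree[OF k] t cab by auto
    have "scalar_prod ?z (monomial_coords a b) = (?K *\<^sub>v monomial_coords a b) $ r"
      using K r by simp
    also have "\<dots> = (if a = 4 - q \<and> b = q then ?s * monomial_coords 0 0 $ r else 0)"
      using K_mat_monomial[OF ab, of q] q r monomial_coords_carrier[of 0 0] by auto
    finally show "(case t of (c, a, b) \<Rightarrow> c * scalar_prod ?z (monomial_coords a b))
        = (case t of (c, a, b) \<Rightarrow> c * (if a = 4 - q \<and> b = q then ?s * monomial_coords 0 0 $ r else 0))"
      by (simp add: cab)
  qed
  also have "\<dots> = leading_coeff k q * (?s * monomial_coords 0 0 $ r)"
    by (rule top_expansion_leading[OF k q])
  also have "scalar_prod ?z ?u = 1 / top_norm k * ?K $$ (r, top_index k)"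
    using K r top_index_less[OF k] z by (simp add: scalar_prod_smult_distrib[of _ 15] scalar_prod_right_unit)
  finally have "?K $$ (r, top_index k) = top_norm k * (leading_coeff k q * (?s * monomial_coords 0 0 $ r))"
    using top_norm_pos[of k] by (simp add: field_simps)
  then show ?thesis using r by (simp add: monomial_coords_0_0 mult_ac)
qed

lemma QC_mat_entry:
  assumes "i < 15" "j < 15"
  shows "QC_mat 4 c $$ (i, j) =
    c * (\<Sum>q<5. real (4 choose q) * (\<Sum>r<15. K_mat 4 (Suc q) $$ (r, i) * K_mat 4 (Suc q) $$ (r, j)))"
proof -
  have "(\<Sum>m = 1..4 + 1. f m) = (\<Sum>q<5. f (Suc q))" for f :: "nat \<Rightarrow> real"
    using sum.atLeast1_atMost_eq[of f 5] by simp
  moreover have "(transpose_mat (K_mat 4 m) * mass_mat 4 * K_mat 4 m) $$ (i, j)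
      = (\<Sum>r<15. K_mat 4 m $$ (r, i) * K_mat 4 m $$ (r, j))" for m
  proof -
    have K: "K_mat 4 m \<in> carrier_mat 15 15" "transpose_mat (K_mat 4 m) \<in> carrier_mat 15 15"
      using K_mat_carrier[of m] by auto
    then have "transpose_mat (K_mat 4 m) * mass_mat 4 * K_mat 4 m = transpose_mat (K_mat 4 m) * K_mat 4 m"
      by (simp add: mass_mat_4)
    then show ?thesis
      using mat_mult_entry[OF K(2,1) assms] K assms by simp
  qed
  ultimately show ?thesis
    using assms by (simp only: QC_mat_def num_modes_4 index_mat) simp
qed

text \<open>The norms of both modes combine with the constant's normalisation to 5 sqrt((2 k + 1) (2
  l + 1)), and squaring removes the sign of (-1 / sqrt 3)^q.\<close>

lemma QC_mat_top_entry:
  assumes k: "k < 5" and l: "l < 5"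
  shows "modal_entry (QC_mat 4 c) k l = c * (5 * sqrt ((2 * real k + 1) * (2 * real l + 1)) *
    (\<Sum>q<5. real (4 choose q) * (leading_coeff k q * leading_coeff l q * (fact (4 - q) * fact q)\<^sup>2 / 3 ^ q)))"
proof -
  have "3 powr (1 / 4) * top_norm k = sqrt (2 * real k + 1) * sqrt 5" if "k < 5" for k
    unfolding top_norm_eq[OF that] real_sqrt_mult by simp
  then have "(3 powr (1 / 4) * top_norm k) * (3 powr (1 / 4) * top_norm l)
      = (sqrt 5 * sqrt 5) * (sqrt (2 * real k + 1) * sqrt (2 * real l + 1))"
    using k l by (simp only: mult_ac)
  then have n: "(3 powr (1 / 4) * top_norm k) * (3 powr (1 / 4) * top_norm l)
      = 5 * sqrt ((2 * real k + 1) * (2 * real l + 1))"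
    unfolding real_sqrt_mult by simp
  have "(\<Sum>r<15. K_mat 4 (Suc q) $$ (r, top_index k) * K_mat 4 (Suc q) $$ (r, top_index l))
      = 5 * sqrt ((2 * real k + 1) * (2 * real l + 1)) *
        (leading_coeff k q * leading_coeff l q * (fact (4 - q) * fact q)\<^sup>2 / 3 ^ q)" if q: "q < 5" for q
  proof -
    let ?s = "fact (4 - q) * (- (1 / sqrt 3)) ^ q * fact q :: real"
    have "(\<Sum>r<15. K_mat 4 (Suc q) $$ (r, top_index k) * K_mat 4 (Suc q) $$ (r, top_index l))
        = (\<Sum>r<15. if r = (0::nat) then (3 powr (1 / 4) * top_norm k * leading_coeff k q * ?s)
                     * (3 powr (1 / 4) * top_norm l * leading_coeff l q * ?s) else 0)"
      by (rule sum.cong) (simp_all add: K_mat_top_column k l q)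
    also have "\<dots> = ((3 powr (1 / 4) * top_norm k) * (3 powr (1 / 4) * top_norm l))
        * (leading_coeff k q * leading_coeff l q * ?s\<^sup>2)"
      by (simp add: power2_eq_square mult_ac)
    also have "?s\<^sup>2 = (fact (4 - q) * fact q)\<^sup>2 / 3 ^ q"
    proof -
      have "((- (1 / sqrt 3)) ^ q)\<^sup>2 = ((- (1 / sqrt 3))\<^sup>2) ^ q"
        by (simp only: power_mult[symmetric] mult.commute)
      also have "(- (1 / sqrt 3))\<^sup>2 = 1 / 3" by (simp add: power_divide)
      finally show ?thesis by (simp add: power_mult_distrib power_divide)
    qed
    finally show ?thesis unfolding n by simp
  qed
  then show ?thesis
    unfolding modal_entry_def QC_mat_entry[OF top_index_less[OF k] top_index_less[OF l]]
    by (simp add: sum_distrib_left mult_ac)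
qed

lemma leading_coeff_explicit:
    "leading_coeff 0 0 = 0" "leading_coeff 0 1 = 0" "leading_coeff 0 2 = 0" "leading_coeff 0 3 = 0" "leading_coeff 0 4 = 126"
    "leading_coeff 1 0 = 0" "leading_coeff 1 1 = 0" "leading_coeff 1 2 = 0" "leading_coeff 1 3 = -84" "leading_coeff 1 4 = 0"
    "leading_coeff 2 0 = 0" "leading_coeff 2 1 = 0" "leading_coeff 2 2 = 54" "leading_coeff 2 3 = 0" "leading_coeff 2 4 = -18"
    "leading_coeff 3 0 = 0" "leading_coeff 3 1 = -45/2" "leading_coeff 3 2 = 0" "leading_coeff 3 3 = 27/2" "leading_coeff 3 4 = 0"
    "leading_coeff 4 0 = 35/8" "leading_coeff 4 1 = 0" "leading_coeff 4 2 = -15/4" "leading_coeff 4 3 = 0" "leading_coeff 4 4 = 3/8"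
  by (simp_all add: leading_coeff_def)

text \<open>The weights 576, 48, 32/3, 16/3, 64/9 are the values of (4 choose q) ((4 - q)! q!)^2 /
  3^q for q = 0 to 4.\<close>

lemma QC_mat_top_entry_explicit:
  assumes "k < 5" "l < 5"
  shows "modal_entry (QC_mat 4 c) k l = 5 * c * sqrt ((2 * real k + 1) * (2 * real l + 1)) *
    (576 * leading_coeff k 0 * leading_coeff l 0 + 48 * leading_coeff k 1 * leading_coeff l 1
     + 32 / 3 * leading_coeff k 2 * leading_coeff l 2 + 16 / 3 * leading_coeff k 3 * leading_coeff l 3
     + 64 / 9 * leading_coeff k 4 * leading_coeff l 4)"
proof -
  have "(4::nat) choose 0 = 1" "(4::nat) choose 1 = 4" "(4::nat) choose 2 = 6" "(4::nat) choose 3 = 4"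
    "(4::nat) choose 4 = 1" "(4::nat) - 0 = 4" "(4::nat) - 1 = 3" "(4::nat) - 2 = 2" "(4::nat) - 3 = 1"
    "(4::nat) - 4 = 0"
    by (simp_all add: numeral_eq_Suc)
  moreover have "fact 0 = (1::real)" "fact 1 = (1::real)" "fact 2 = (2::real)" "fact 3 = (6::real)"
    "fact 4 = (24::real)"
    by (simp_all add: fact_numeral)
  ultimately have "(\<Sum>q<5. real (4 choose q) * (leading_coeff k q * leading_coeff l q * (fact (4 - q) * fact q)\<^sup>2 / 3 ^ q))
      = 576 * leading_coeff k 0 * leading_coeff l 0 + 48 * leading_coeff k 1 * leading_coeff l 1
     + 32 / 3 * leading_coeff k 2 * leading_coeff l 2 + 16 / 3 * leading_coeff k 3 * leading_coeff l 3
     + 64 / 9 * leading_coeff k 4 * leading_coeff l 4"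
    unfolding sum_less_5 by (simp only:) simp
  then show ?thesis
    unfolding QC_mat_top_entry[OF assms] by (simp only: mult_ac)
qed

text \<open>With the binomial weights the sum is the squared norm of the full tensor of fourth
  derivatives, which is invariant under all orthogonal maps; this is why the matrix belongs to the
  family. The verification compares its nine entries with the thetas directly.\<close>

lemma four_param_QC:
  "four_param_form (- 30240 * sqrt 21 * c) (564480 * c) (5040 * c) (- 80640 * sqrt 5 * c) (QC_mat 4 c)"
proof -
  let ?Q = "QC_mat 4 c"
  have Q: "?Q \<in> carrier_mat 15 15" by (simp add: QC_mat_def num_modes_4)
  have sym: "transpose_mat ?Q = ?Q"
    by (rule eq_matI) (use Q in \<open>simp_all add: QC_mat_entry mult.commute\<close>)
  have top: "top_supported ?Q"
    unfolding top_supported_def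
  proof (intro allI impI)
    fix i j :: nat assume ij: "i < 15" "j < 15" "mode_degree i \<le> 3 \<or> mode_degree j \<le> 3"
    have "K_mat 4 (Suc q) $$ (r, i) * K_mat 4 (Suc q) $$ (r, j) = 0" if "r < 15" "q < 5" for q r
      using ij(3) K_mat_low_column[OF ij(1) _ that(1), of q] K_mat_low_column[OF ij(2) _ that(1), of q] that(2)
      by auto
    then show "?Q $$ (i, j) = 0"
      unfolding QC_mat_entry[OF ij(1,2)] by (simp add: sum.neutral del: mult_eq_0_iff)
  qed
  have roots: "sqrt 9 = 3" "sqrt 25 = 5" "sqrt 49 = 7" "sqrt 81 = 9" "sqrt 45 = 3 * sqrt 5"
    "sqrt 105 = sqrt 5 * sqrt 21"
    using real_sqrt_mult[of 9 5] real_sqrt_mult[of 5 21] real_sqrt_abs2[of 3] real_sqrt_abs2[of 5]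
      real_sqrt_abs2[of 7] real_sqrt_abs2[of 9] by simp_all
  have cancel: "sqrt 5 * (sqrt 5 * x) = 5 * x" "sqrt 21 * (sqrt 21 * x) = 21 * x" for x
    by (simp_all add: mult.assoc[symmetric])
  have parity: "\<forall>i<5. \<forall>j<5. odd (i + j) \<longrightarrow> modal_entry ?Q i j = 0"
  proof (intro allI impI)
    fix i j :: nat assume ij: "i < 5" "j < 5" "odd (i + j)"
    have "\<forall>i<5. \<forall>j<5. odd (i + j) \<longrightarrow> (\<forall>q<5. leading_coeff i q * leading_coeff j q = 0)"
      unfolding all_less_5 leading_coeff_explicit by simp
    then have zero: "leading_coeff i q * leading_coeff j q = 0" if "q < 5" for q
      using ij that by blast
    have "leading_coeff i 0 * leading_coeff j 0 = 0" "leading_coeff i 1 * leading_coeff j 1 = 0"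
      "leading_coeff i 2 * leading_coeff j 2 = 0" "leading_coeff i 3 * leading_coeff j 3 = 0"
      "leading_coeff i 4 * leading_coeff j 4 = 0"
      by (rule zero; simp)+
    then show "modal_entry ?Q i j = 0"
      unfolding QC_mat_top_entry_explicit[OF ij(1,2)]
      by (simp only: mult.assoc mult_zero_right add_0_right)
  qed
  have entries: "modal_entry ?Q 0 0 = 564480 * c" "modal_entry ?Q 0 2 = - 80640 * sqrt 5 * c"
    "modal_entry ?Q 0 4 = 5040 * c" "modal_entry ?Q 2 2 = 835200 * c"
    "modal_entry ?Q 2 4 = - 33120 * sqrt 5 * c" "modal_entry ?Q 4 4 = 502920 * c"
    "modal_entry ?Q 1 1 = 564480 * c" "modal_entry ?Q 1 3 = - 30240 * sqrt 21 * c"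
    "modal_entry ?Q 3 3 = 884520 * c"
    by (subst QC_mat_top_entry_explicit; (simp only: leading_coeff_explicit)?; simp add: roots)+
  have thetas: "theta4 (- 30240 * sqrt 21 * c) (564480 * c) (5040 * c) (- 80640 * sqrt 5 * c) = 564480 * c"
    "theta3 (- 30240 * sqrt 21 * c) (564480 * c) (5040 * c) (- 80640 * sqrt 5 * c) = 835200 * c"
    "theta2 (- 30240 * sqrt 21 * c) (564480 * c) (5040 * c) (- 80640 * sqrt 5 * c) = - 33120 * sqrt 5 * c"
    "theta1 (- 30240 * sqrt 21 * c) (564480 * c) (5040 * c) (- 80640 * sqrt 5 * c) = 884520 * c"
    "theta0 (- 30240 * sqrt 21 * c) (564480 * c) (5040 * c) (- 80640 * sqrt 5 * c) = 502920 * c"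
    by (simp_all add: theta0_def theta1_def theta2_def theta3_def theta4_def algebra_simps roots cancel)
  show ?thesis
    unfolding four_param_form_iff[OF Q] thetas entries
    by (intro conjI refl sym top parity)
qed

section \<open>The stability threshold of the single-parameter scheme\<close>

lemma sqrt_1129_bounds: "33.6 < sqrt 1129" "sqrt 1129 < 33.61"
proof -
  show "33.6 < sqrt 1129" by (rule real_less_rsqrt) (simp add: power2_eq_square)
  show "sqrt 1129 < 33.61" by (rule real_less_lsqrt) (simp_all add: power2_eq_square)
qed

text \<open>In the variable \<open>s = 2520 c\<close> the stability determinants are rational polynomials, and the
  largest one factors as \<open>(1 + 180 s) (1 + 575 s + 75600 s\<^sup>2)\<close>.\<close>

lemma QC_stability:
  fixes s :: real
  shows "1 + 224 * s > 0 \<and> 1 + 3888 / 7 * s + 69120 * s\<^sup>2 > 0 \<and> 1 + 575 * s + 75600 * s\<^sup>2 > 0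
      \<and> (1 + 180 * s) * (1 + 575 * s + 75600 * s\<^sup>2) > 0 \<longleftrightarrow> s > (sqrt 1129 - 115) / 30240"
proof -
  \<comment> \<open>\<open>s0\<close> and \<open>s1\<close> are the roots of 75600 s^2 + 575 s + 1,
    whose discriminant is 25 * 1129.\<close>
  define s0 where "s0 = (sqrt 1129 - 115) / 30240"
  define s1 where "s1 = (- sqrt 1129 - 115) / 30240"
  have b: "- 0.0027 < s0" "s0 < 0" "s1 < - 0.0049"
    using sqrt_1129_bounds by (simp_all add: s0_def s1_def field_simps)
  have factor: "1 + 575 * s + 75600 * s\<^sup>2 = 75600 * ((s - s0) * (s - s1))"
    by (simp add: s0_def s1_def field_simps power2_eq_square)
  have "s > s0" if "1 + 224 * s > 0" "1 + 575 * s + 75600 * s\<^sup>2 > 0"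
  proof -
    \<comment> \<open>The condition 1 + 224 s > 0 means s > -1/224, which lies above
      \<open>s1\<close> and excludes the lower branch of the quadratic.\<close>
    have "s - s1 > 0" using that(1) b by simp
    then show ?thesis using that(2) unfolding factor by (simp add: zero_less_mult_iff)
  qed
  moreover have "1 + 224 * s > 0 \<and> 1 + 3888 / 7 * s + 69120 * s\<^sup>2 > 0 \<and> 1 + 575 * s + 75600 * s\<^sup>2 > 0
      \<and> 1 + 180 * s > 0" if "s > s0"
  proof -
    have s: "s > - 0.0027" using that b by simp
    \<comment> \<open>Expansion about -0.0027, a point between the larger root of this quadratic
      (about -0.00272) and \<open>s0\<close> (about -0.00269): the value there is positive and the
      other summand is nonnegative.\<close>
    have "1 + 3888 / 7 * s + 69120 * s\<^sup>2 =
       (s + 0.0027) * (3888 / 7 + 69120 * (s - 0.0027)) + (1 - 3888 / 7 * 0.0027 + 69120 * 0.0027\<^sup>2)"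
      by (simp add: power2_eq_square field_simps)
    also have "\<dots> > 0"
      by (rule add_nonneg_pos, rule mult_nonneg_nonneg) (use s in \<open>simp_all add: power2_eq_square\<close>)
    finally have "1 + 3888 / 7 * s + 69120 * s\<^sup>2 > 0" .
    moreover have "1 + 575 * s + 75600 * s\<^sup>2 > 0" unfolding factor using that b by simp
    ultimately show ?thesis using s by simp
  qed
  ultimately show ?thesis unfolding s0_def by (auto simp: zero_less_mult_iff)
qed

lemma positive_definite_QC:
  "positive_definite_mat (mass_mat 4 + QC_mat 4 c) \<longleftrightarrow> c > (sqrt 1129 - 115) / 76204800"
proof -
  define s where "s = 2520 * c"
  let ?q0 = "- 30240 * sqrt 21 * c" and ?q1 = "564480 * c" and ?q2 = "5040 * c" and ?q3 = "- 80640 * sqrt 5 * c"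
  have q: "?q0\<^sup>2 = 3024 * s\<^sup>2" "?q1 = 224 * s" "?q2 = 2 * s" "?q3 = - 32 * sqrt 5 * s" "?q3\<^sup>2 = 5120 * s\<^sup>2"
    by (simp_all add: s_def power_mult_distrib)
  have sq: "sqrt 105 = sqrt 5 * sqrt 21" "sqrt 5 * (sqrt 5 * x) = 5 * x" "sqrt 21 * (sqrt 21 * x) = 21 * x" for x
    using real_sqrt_mult[of 5 21] by (simp_all add: mult.assoc[symmetric])
  have \<theta>: "theta0 ?q0 ?q1 ?q2 ?q3 = 1397 / 7 * s" "theta1 ?q0 ?q1 ?q2 ?q3 = 351 * s"
    "theta2 ?q0 ?q1 ?q2 ?q3 = - 92 / 7 * sqrt 5 * s" "theta3 ?q0 ?q1 ?q2 ?q3 = 2320 / 7 * s"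
    "theta4 ?q0 ?q1 ?q2 ?q3 = 224 * s"
    by (simp_all add: theta0_def theta1_def theta2_def theta3_def theta4_def s_def algebra_simps sq)
  have m2: "- (5120 * s\<^sup>2) + 2320 / 7 * s + 224 * s + 2320 / 7 * s * (224 * s) = 3888 / 7 * s + 69120 * s\<^sup>2"
    "- (3024 * s\<^sup>2) + 224 * s + 351 * s + 224 * s * (351 * s) = 575 * s + 75600 * s\<^sup>2"
    by (simp_all add: power2_eq_square)
  \<comment> \<open>The factor 1 + 180 s belongs to the rotation-invariant line. The remaining even
    directions carry, up to similarity, the same 2 x 2 matrix as the odd block, whose determinant
    therefore reappears.\<close>
  have m3: "2 * (- 92 / 7 * sqrt 5 * s) * (2 * s) * (- 32 * sqrt 5 * s) + 2320 / 7 * s * (224 * s - (2 * s)\<^sup>2 + 1)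
      + 1397 / 7 * s * ((2320 / 7 * s + 1) * (224 * s + 1) - 5120 * s\<^sup>2)
      - (224 * s + 1) * (- 92 / 7 * sqrt 5 * s)\<^sup>2 + 224 * s - (2 * s)\<^sup>2 - 5120 * s\<^sup>2
      = (1 + 180 * s) * (1 + 575 * s + 75600 * s\<^sup>2) - 1"
  proof -
    have "(- 92 / 7 * sqrt 5 * s)\<^sup>2 = 42320 / 49 * s\<^sup>2"
      by (simp add: power_mult_distrib power_divide)
    moreover have "2 * (- 92 / 7 * sqrt 5 * s) * (2 * s) * (- 32 * sqrt 5 * s) = 58880 / 7 * s\<^sup>2 * s"
      by (simp add: power2_eq_square algebra_simps sq)
    ultimately show ?thesis
      by (simp only:) (simp add: power2_eq_square field_simps)
  qed
  have "positive_definite_mat (mass_mat 4 + QC_mat 4 c) \<longleftrightarrow>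
     224 * s > -1 \<and> 224 * s > -1 \<and> 3888 / 7 * s + 69120 * s\<^sup>2 > -1 \<and> 575 * s + 75600 * s\<^sup>2 > -1 \<and>
     (1 + 180 * s) * (1 + 575 * s + 75600 * s\<^sup>2) - 1 > -1"
    \<comment> \<open>The thetas and the squares are rewritten before the bare parameters, since
      replacing the latter first would destroy the left-hand sides of the former.\<close>
    unfolding positive_definite_four_param[OF four_param_QC] \<theta>
    unfolding q(1,5)
    unfolding q(2,3,4) m2 m3 ..
  also have "\<dots> \<longleftrightarrow> 1 + 224 * s > 0 \<and> 1 + 3888 / 7 * s + 69120 * s\<^sup>2 > 0 \<and> 1 + 575 * s + 75600 * s\<^sup>2 > 0
      \<and> (1 + 180 * s) * (1 + 575 * s + 75600 * s\<^sup>2) > 0" by auto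
  also have "\<dots> \<longleftrightarrow> s > (sqrt 1129 - 115) / 30240" by (rule QC_stability)
  \<comment> \<open>The denominator is 76204800 = 2520 * 30240.\<close>
  also have "\<dots> \<longleftrightarrow> c > (sqrt 1129 - 115) / 76204800" by (simp add: s_def field_simps)
  finally show ?thesis .
qed

theorem mainTheorem8:
  shows
    "(\<forall>Q\<in>carrier_mat 15 15.
        extended_range_conditions 4 Q \<longleftrightarrow> (\<exists>q0 q1 q2 q3. four_param_form q0 q1 q2 q3 Q))
     \<and> (\<forall>Q q0 q1 q2 q3. four_param_form q0 q1 q2 q3 Q \<longrightarrow>
          (let \<theta>0 = theta0 q0 q1 q2 q3;
               \<theta>1 = theta1 q0 q1 q2 q3;
               \<theta>2 = theta2 q0 q1 q2 q3;
               \<theta>3 = theta3 q0 q1 q2 q3;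
               \<theta>4 = theta4 q0 q1 q2 q3
           in positive_definite_mat (mass_mat 4 + Q) \<longleftrightarrow>
                \<theta>4 > -1 \<and>
                q1 > -1 \<and>
                - q3\<^sup>2 + \<theta>3 + \<theta>4 + \<theta>3 * \<theta>4 > -1 \<and>
                - q0\<^sup>2 + q1 + \<theta>1 + q1 * \<theta>1 > -1 \<and>
                2 * \<theta>2 * q2 * q3 + \<theta>3 * (\<theta>4 - q2\<^sup>2 + 1)
                  + \<theta>0 * ((\<theta>3 + 1) * (\<theta>4 + 1) - q3\<^sup>2)
                  - (\<theta>4 + 1) * \<theta>2\<^sup>2 + \<theta>4 - q2\<^sup>2 - q3\<^sup>2 > -1))
     \<and> (\<forall>c. four_param_form (- 30240 * sqrt 21 * c) (564480 * c) (5040 * c)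
               (- 80640 * sqrt 5 * c) (QC_mat 4 c)
          \<and> (positive_definite_mat (mass_mat 4 + QC_mat 4 c)
               \<longleftrightarrow> c > (sqrt 1129 - 115) / 76204800))"
  unfolding Let_def
  using extended_range_iff_four_param positive_definite_four_param four_param_QC positive_definite_QC
  by blast

end
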